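(* Let $T\in(0,\infty)$, let $b:\mathbb R^n\to\mathbb R^n$ and $\sigma:\mathbb R^n\to\mathbb R^{n\times m}$ be continuous, and suppose that for some $L_b\in\mathbb R$ and $L_\sigma\ge 0$ and all $x,y\in\mathbb R^n$ $$\langle b(x)-b(y),x-y\rangle\le L_b|x-y|^2,\qquad |\sigma(x)-\sigma(y)|_{HS}\le L_\sigma|x-y|.$$ Let $X_0$ be an $\mathbb R^n$-valued $\mathscr F_0$-measurable random variable, let $X=\{X_t\}_{t\in[0,T]}$ be the solution of $dX_t=b(X_t)\,dt+\sigma(X_t)\,dW_t$ on $(0,T]$ with initial value $X_0$, and suppose that for some $p\ge 4$ $$\sup_{t\in[0,T]}\mathbb E|b(X_t)|^p+\sup_{t\in[0,T]}\mathbb E|X_t|^p<\infty .$$ Then for any positive integer $M>T$ such that $2L_b\tau<1$, where $\tau=T/M$ and $t_k=k\tau$, there exists $C$ such that the backward Euler scheme $\{Y^M_k\}_{k=0}^M$ satisfies $$\mathbb E\sup_{0\le k\le M}|X_{t_k}-Y_k^M|^p\le C\sum_{i=0}^{M-1}\int_{t_i}^{t_{i+1}}\Big(\mathbb E|b(X_r)-b(X_{t_{i+1}})|^p+\mathbb E|X_r-X_{t_i}|^p\Big)\,dr .$$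
   Context: $W$ is an $\mathbb R^m$-valued Wiener process on a filtered probability space $(\Omega,\mathscr F,\{\mathscr F_t\}_{t\ge0},\mathbb P)$. $|\cdot|$ is the Euclidean norm on $\mathbb R^n$ and $|\cdot|_{HS}$ the Hilbert--Schmidt (Frobenius) norm on $\mathbb R^{n\times m}$. Under the stated conditions on $b,\sigma$ the SDE has a unique adapted solution $X$ with continuous sample paths. The backward Euler scheme is $Y_0^M=X_0$, $Y^M_{k+1}=Y^M_k+b(Y^M_{k+1})\tau+\sigma(Y^M_k)(W_{t_{k+1}}-W_{t_k})$, $k=0,\dots,M-1$; it is almost surely solvable when $L_b\tau<1$. $C$ denotes a generic constant, which may be different in each appearance. *)

theory Defs
  imports "HOL-Probability.Probability"
begin

text \<open>The filtration is indexed by \<open>[0, \<infinity>)\<close>: only the values \<open>F t\<close> with \<open>0 \<le> t\<close> matter.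
  Neither completeness nor right-continuity is imposed.\<close>

locale filtered_prob_space = prob_space P for P :: "'a measure" +
  fixes F :: "real \<Rightarrow> 'a measure"
  assumes subalgebra_F: "0 \<le> t \<Longrightarrow> subalgebra P (F t)"
    and subalgebra_F_mono: "0 \<le> s \<Longrightarrow> s \<le> t \<Longrightarrow> subalgebra (F t) (F s)"

locale wiener_process = filtered_prob_space P F
  for P :: "'a measure" and F :: "real \<Rightarrow> 'a measure" +
  fixes W :: "real \<Rightarrow> 'a \<Rightarrow> real ^ 'm"
  assumes adapted: "0 \<le> t \<Longrightarrow> W t \<in> borel_measurable (F t)"
    and start: "AE \<omega> in P. W 0 \<omega> = 0"
    and continuous_paths: "AE \<omega> in P. continuous_on {0..} (\<lambda>t. W t \<omega>)"
    and gaussian_increments: "0 \<le> s \<Longrightarrow> s < t \<Longrightarrow>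
      distributed P lborel (\<lambda>\<omega>. W t \<omega> - W s \<omega>)
        (\<lambda>x. ennreal (\<Prod>i\<in>UNIV. normal_density 0 (sqrt (t - s)) (x $ i)))"
    and indep_increments: "0 \<le> s \<Longrightarrow> s < t \<Longrightarrow>
      indep_set (sets (F s)) (sets (vimage_algebra (space P) (\<lambda>\<omega>. W t \<omega> - W s \<omega>) borel))"

text \<open>Measurability is part of the notion, since \<open>measure\<close> vanishes on non-measurable sets.\<close>

definition tends_to_zero_in_prob :: "'a measure \<Rightarrow> (nat \<Rightarrow> 'a \<Rightarrow> ennreal) \<Rightarrow> bool" where
  "tends_to_zero_in_prob P Z \<longleftrightarrow>
    (\<forall>k. Z k \<in> borel_measurable P) \<and>
    (\<forall>\<epsilon>>0. (\<lambda>k. measure P {\<omega> \<in> space P. ennreal \<epsilon> < Z k \<omega>}) \<longlonglongrightarrow> 0)"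

definition progressively_measurable ::
    "(real \<Rightarrow> 'a measure) \<Rightarrow> real \<Rightarrow> (real \<Rightarrow> 'a \<Rightarrow> 'b::topological_space) \<Rightarrow> bool" where
  "progressively_measurable F T H \<longleftrightarrow>
    (\<forall>t\<in>{0..T}. (\<lambda>(s, \<omega>). H s \<omega>) \<in> borel_measurable (restrict_space borel {0..t} \<Otimes>\<^sub>M F t))"

text \<open>A simple process on \<open>[0, t]\<close> is \<open>\<Sum>i<N. \<xi>\<^sub>i 1\<^bsub>(s\<^sub>i, s\<^sub>i\<^sub>+\<^sub>1]\<^esub>\<close> for a partition
  \<open>0 \<le> s\<^sub>0 \<le> \<dots> \<le> s\<^sub>N \<le> t\<close> and bounded \<open>F s\<^sub>i\<close>-measurable \<open>\<xi>\<^sub>i\<close>. Matrices in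
  \<open>\<real>\<^sup>n\<^sup>\<times>\<^sup>m\<close> have the type \<open>real ^ 'm ^ 'n\<close>.\<close>

definition simple_process_data ::
    "(real \<Rightarrow> 'a measure) \<Rightarrow> real \<Rightarrow> nat \<Rightarrow> (nat \<Rightarrow> real) \<Rightarrow> (nat \<Rightarrow> 'a \<Rightarrow> real ^ 'm ^ 'n) \<Rightarrow> bool" where
  "simple_process_data F t N s \<xi> \<longleftrightarrow>
    0 \<le> s 0 \<and> mono_on {..N} s \<and> s N \<le> t \<and>
    (\<forall>i<N. \<xi> i \<in> borel_measurable (F (s i)) \<and> bounded (\<xi> i ` space (F (s i))))"

definition simple_process ::
    "nat \<Rightarrow> (nat \<Rightarrow> real) \<Rightarrow> (nat \<Rightarrow> 'a \<Rightarrow> real ^ 'm ^ 'n) \<Rightarrow> real \<Rightarrow> 'a \<Rightarrow> real ^ 'm ^ 'n" where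
  "simple_process N s \<xi> r \<omega> = (\<Sum>i<N. indicat_real {s i<..s (Suc i)} r *\<^sub>R \<xi> i \<omega>)"

definition simple_integral ::
    "(real \<Rightarrow> 'a \<Rightarrow> real ^ 'm) \<Rightarrow> nat \<Rightarrow> (nat \<Rightarrow> real) \<Rightarrow> (nat \<Rightarrow> 'a \<Rightarrow> real ^ 'm ^ 'n) \<Rightarrow> 'a \<Rightarrow> real ^ 'n" where
  "simple_integral W N s \<xi> \<omega> = (\<Sum>i<N. \<xi> i \<omega> *v (W (s (Suc i)) \<omega> - W (s i) \<omega>))"

text \<open>\<open>has_ito_integral P F W t H J\<close> says that \<open>J = \<integral>\<^sub>0\<^sup>t H\<^sub>r dW\<^sub>r\<close>, in the sense of the usual
  extension of the integral of simple processes to progressively measurable integrands with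
  \<open>\<integral>\<^sub>0\<^sup>t |H\<^sub>r|\<^sup>2 dr < \<infinity>\<close> almost surely: \<open>J\<close> is the limit in probability of
  \<open>\<integral>\<^sub>0\<^sup>t H\<^sup>k\<^sub>r dW\<^sub>r\<close> for simple \<open>H\<^sup>k\<close> with \<open>\<integral>\<^sub>0\<^sup>t |H\<^sup>k\<^sub>r - H\<^sub>r|\<^sup>2 dr \<rightarrow> 0\<close> in probability.
  Such \<open>J\<close> is unique up to null sets and does not depend on the approximating sequence; the
  pathwise square integrability of \<open>H\<close> follows from the existence of that sequence.\<close>

definition has_ito_integral ::
    "'a measure \<Rightarrow> (real \<Rightarrow> 'a measure) \<Rightarrow> (real \<Rightarrow> 'a \<Rightarrow> real ^ 'm) \<Rightarrow> real \<Rightarrow>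
     (real \<Rightarrow> 'a \<Rightarrow> real ^ 'm ^ 'n) \<Rightarrow> ('a \<Rightarrow> real ^ 'n) \<Rightarrow> bool" where
  "has_ito_integral P F W t H J \<longleftrightarrow>
    progressively_measurable F t H \<and> J \<in> borel_measurable P \<and>
    (\<exists>N s \<xi>. (\<forall>k. simple_process_data F t (N k) (s k) (\<xi> k)) \<and>
      tends_to_zero_in_prob P (\<lambda>k \<omega>. \<integral>\<^sup>+r\<in>{0..t}.
        ennreal ((norm (simple_process (N k) (s k) (\<xi> k) r \<omega> - H r \<omega>))\<^sup>2) \<partial>lborel) \<and>
      tends_to_zero_in_prob P (\<lambda>k \<omega>.
        ennreal (norm (simple_integral W (N k) (s k) (\<xi> k) \<omega> - J \<omega>))))"

definition sde_solution ::
    "'a measure \<Rightarrow> (real \<Rightarrow> 'a measure) \<Rightarrow> (real \<Rightarrow> 'a \<Rightarrow> real ^ 'm) \<Rightarrow> real \<Rightarrow>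
     (real ^ 'n \<Rightarrow> real ^ 'n) \<Rightarrow> (real ^ 'n \<Rightarrow> real ^ 'm ^ 'n) \<Rightarrow> ('a \<Rightarrow> real ^ 'n) \<Rightarrow>
     (real \<Rightarrow> 'a \<Rightarrow> real ^ 'n) \<Rightarrow> bool" where
  "sde_solution P F W T b \<sigma> X0 X \<longleftrightarrow>
    (\<forall>t\<in>{0..T}. X t \<in> borel_measurable (F t)) \<and>
    (\<forall>\<omega>\<in>space P. continuous_on {0..T} (\<lambda>t. X t \<omega>)) \<and>
    (AE \<omega> in P. X 0 \<omega> = X0 \<omega>) \<and>
    (\<forall>t\<in>{0..T}. \<exists>J. has_ito_integral P F W t (\<lambda>r \<omega>. \<sigma> (X r \<omega>)) J \<and>
      (AE \<omega> in P. X t \<omega> = X0 \<omega> + (LINT r:{0..t}|lborel. b (X r \<omega>)) + J \<omega>))"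

text \<open>The scheme is implicit; it determines \<open>Y\<close> up to null sets when \<open>L\<^sub>b \<tau> < 1\<close>.\<close>

definition backward_euler ::
    "'a measure \<Rightarrow> (real \<Rightarrow> 'a \<Rightarrow> real ^ 'm) \<Rightarrow> (real ^ 'n \<Rightarrow> real ^ 'n) \<Rightarrow>
     (real ^ 'n \<Rightarrow> real ^ 'm ^ 'n) \<Rightarrow> ('a \<Rightarrow> real ^ 'n) \<Rightarrow> real \<Rightarrow> nat \<Rightarrow>
     (nat \<Rightarrow> 'a \<Rightarrow> real ^ 'n) \<Rightarrow> bool" where
  "backward_euler P W b \<sigma> X0 \<tau> M Y \<longleftrightarrow>
    (\<forall>k\<le>M. Y k \<in> borel_measurable P) \<and>
    (AE \<omega> in P. Y 0 \<omega> = X0 \<omega>) \<and>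
    (\<forall>k<M. AE \<omega> in P. Y (Suc k) \<omega> =
      Y k \<omega> + \<tau> *\<^sub>R b (Y (Suc k) \<omega>) +
      \<sigma> (Y k \<omega>) *v (W (real (Suc k) * \<tau>) \<omega> - W (real k * \<tau>) \<omega>))"

text \<open>The norm of the type \<open>real ^ 'm ^ 'n\<close> is the Hilbert--Schmidt norm.\<close>

lemma norm_matrix_hilbert_schmidt:
  fixes A :: "real ^ 'm ^ 'n"
  shows "norm A = sqrt (\<Sum>i\<in>UNIV. \<Sum>j\<in>UNIV. (A $ i $ j)\<^sup>2)"
  by (simp add: norm_vec_def L2_set_def sum_nonneg)

end

theory Submission
  imports Defs
begin

text \<open>
  Write \<open>e k = X (t k) - Y k\<close>, let \<open>R k\<close> be the drift remainder \<open>\<integral> b (X r) - b (X (t (k + 1))) dr\<close> over the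
  \<open>k\<close>-th step, and let \<open>N k = \<integral> \<sigma> (X r) - \<sigma> (Y k) dW\<close> be the noise increment. Pairing the error equation
  with \<open>e (k + 1)\<close> and using the one-sided Lipschitz condition, the implicit terms are absorbed and
  \<open>|e n|\<^sup>2\<close> is controlled by \<open>\<tau> \<Sum> |e j|\<^sup>2\<close>, \<open>\<Sum> |R j|\<^sup>2 / \<tau>\<close>, the martingale \<open>\<Sum> e j \<bullet> N j\<close> and
  \<open>\<Sum> |N j|\<^sup>2\<close>. Taking powers \<open>p / 2\<close> and the maximum over \<open>n\<close>, the stochastic terms are bounded by the
  Burkholder-Davis-Gundy inequality, whose right-hand side is again of the form
  \<open>\<Sum> \<tau> E |e j|\<^sup>p + \<integral> E |X r - X (t j)|\<^sup>p dr\<close>, and Gronwall's lemma concludes. Gronwall is applied to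
  an explicit recursion in \<open>[0, \<infinity>]\<close>, so no moment of the scheme has to be known to be finite.

  The Burkholder-Davis-Gundy inequality is proved for simple integrands with bounded quadratic
  variation: Doob's maximal inequality follows from the supermartingale
  \<open>m\<^sup>q - q / (q - 1) m\<^sup>q\<^sup>-\<^sup>1 |S|\<close>, with \<open>m\<close> the running maximum of \<open>|S|\<close>, and a second-order Taylor
  bound for \<open>|S|\<^sup>q\<close> closes the estimate. Stopping an integrand before its quadratic variation exceeds
  \<open>K\<close> removes all integrability assumptions, and Fatou's lemma carries the result over to the
  stochastic integral, which is only a limit in probability.
\<close>

section \<open>Elementary inequalities\<close>

text \<open>The constant is fixed before \<open>M\<close> and the scheme, so absorbing the implicit
  terms must cost a factor that is uniform in \<open>M\<close>. Dividing by
  \<open>1 - (2 * L + \<epsilon>) * \<tau>\<close> is harmless only because \<open>M\<close> is an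
  integer: the steps with \<open>2 * L * \<tau> < 1\<close> then stay away from the critical one.
  The spare \<open>\<epsilon>\<close> pays for Young's inequality applied to
  \<open>R k \<bullet> e (k + 1)\<close>, which also produces the weight \<open>1 / \<tau>\<close>
  of the drift remainder.

  The noise is paired with \<open>e k\<close> and not with \<open>e (k + 1)\<close>, because only
  then is the sum a martingale. That sum enters with exponent \<open>p / 2\<close>, and the maximal
  inequality needs an exponent of at least 2: this is the origin of \<open>4 \<le> p\<close>.

  Two further obstacles shape the proof. A solution of the implicit scheme is given only up to null
  sets while the filtration need not be complete, so the scheme is replaced by an adapted version.
  And the stochastic integral is given separately for each time by its own approximating sequence,
  so one sequence on \<open>{0..T}\<close> must be shown to serve all grid times.\<close>

lemma powr_add_le:
  fixes x y p :: real
  assumes "0 \<le> x" "0 \<le> y" "0 \<le> p"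
  shows "(x + y) powr p \<le> 2 powr p * (x powr p + y powr p)"
proof -
  have "(x + y) powr p \<le> (2 * max x y) powr p" using assms by (intro powr_mono2) auto
  also have "\<dots> = 2 powr p * (max x y) powr p" using assms by (simp add: powr_mult)
  also have "\<dots> \<le> 2 powr p * (x powr p + y powr p)" by (intro mult_left_mono) (auto simp: max_def)
  finally show ?thesis .
qed

text \<open>This is \<open>ln x \<le> x - 1\<close> at \<open>x = y\<^sup>2 / (2 * a)\<close>. With
  the factor 1/4 in the exponent, the product of \<open>exp (- y\<^sup>2 / 2)\<close> and the bound
  is again a Gaussian profile, of twice the variance; the moments of increments are estimated in
  this way.\<close>

lemma powr_le_exp_square:
  fixes a :: real
  assumes "0 \<le> a"
  obtains C where "0 \<le> C" "\<And>y. 0 \<le> y \<Longrightarrow> y powr a \<le> C * exp (y\<^sup>2 / 4)"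
proof (cases "a = 0")
  case True
  show ?thesis
  proof (rule that[of 1])
    fix y :: real assume "0 \<le> y"
    have "1 \<le> exp (y\<^sup>2 / 4)" by simp
    then show "y powr a \<le> 1 * exp (y\<^sup>2 / 4)" using True by (auto simp: powr_def)
  qed simp
next
  case False
  with assms have a: "a > 0" by simp
  show ?thesis
  proof (rule that[of "exp (a / 2 * ln (2 * a))"])
    fix y :: real assume y: "0 \<le> y"
    show "y powr a \<le> exp (a / 2 * ln (2 * a)) * exp (y\<^sup>2 / 4)"
    proof (cases "y = 0")
      case False
      with y have y: "y > 0" by simp
      have "ln (y\<^sup>2 / (2 * a)) \<le> y\<^sup>2 / (2 * a) - 1"
        using a y by (intro ln_le_minus_one) auto
      moreover have "ln (y\<^sup>2 / (2 * a)) = 2 * ln y - ln (2 * a)"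
        using a y by (subst ln_div) (auto simp: ln_realpow)
      ultimately have "a / 2 * (2 * ln y) \<le> a / 2 * (y\<^sup>2 / (2 * a) + ln (2 * a))"
        using a by (intro mult_left_mono) auto
      then have "a * ln y \<le> a / 2 * ln (2 * a) + y\<^sup>2 / 4"
        using a by (simp add: distrib_left)
      then show ?thesis using y by (simp add: powr_def mult.commute flip: exp_add)
    qed simp
  qed simp
qed

text \<open>Young's inequality with explicit, non-optimal constants: either \<open>s\<close> is so
  small against \<open>m\<close> that half of \<open>m powr q\<close> covers the product, or
  \<open>m\<close> is at most \<open>2 * c * s\<close>. The factor 1/2 lets Doob's argument absorb
  the first term.\<close>

lemma powr_pred_mult_le:
  fixes c q m s :: real
  assumes "1 \<le> q" "1 \<le> c" "0 \<le> m" "0 \<le> s"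
  shows "c * m powr (q - 1) * s \<le> m powr q / 2 + c * (2 * c) powr (q - 1) * s powr q"
proof (cases "m = 0 \<or> s = 0")
  case True then show ?thesis using assms by auto
next
  case False
  with assms have m: "m > 0" and s: "s > 0" by auto
  have mq: "m powr (q - 1) * m = m powr q" and sq: "s powr (q - 1) * s = s powr q"
    using m s by (simp_all add: powr_diff)
  show ?thesis
  proof (cases "2 * c * s \<le> m")
    case True
    have "c * m powr (q - 1) * s = m powr (q - 1) * (2 * c * s) / 2" by simp
    also have "\<dots> \<le> m powr (q - 1) * m / 2" using True by (intro divide_right_mono mult_left_mono) auto
    also have "\<dots> \<le> m powr q / 2 + c * (2 * c) powr (q - 1) * s powr q"
      using mq assms by simp
    finally show ?thesis .
  next
    case False
    then have "m powr (q - 1) \<le> (2 * c * s) powr (q - 1)" using assms by (intro powr_mono2) auto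
    then have "c * m powr (q - 1) * s \<le> c * ((2 * c) powr (q - 1) * s powr (q - 1)) * s"
      using assms by (intro mult_right_mono mult_left_mono) (auto simp: powr_mult)
    also have "\<dots> = c * (2 * c) powr (q - 1) * s powr q" using sq by (simp add: mult.assoc)
    also have "\<dots> \<le> m powr q / 2 + c * (2 * c) powr (q - 1) * s powr q" by simp
    finally show ?thesis .
  qed
qed

text \<open>The same dichotomy with the threshold \<open>Q \<le> d * m\<^sup>2\<close>. The weight
  \<open>d\<close> is free, so that \<open>m powr q\<close> can be given a coefficient small enough
  to beat any constant found before.\<close>

lemma powr_pred2_mult_le:
  fixes q m Q d :: real
  assumes "2 \<le> q" "0 < d" "0 \<le> m" "0 \<le> Q"
  shows "m powr (q - 2) * Q \<le> d * m powr q + d powr (1 - q / 2) * Q powr (q / 2)"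
proof (cases "m = 0 \<or> Q = 0")
  case True then show ?thesis using assms by auto
next
  case False
  with assms have m: "m > 0" and Q: "Q > 0" by auto
  have mq: "m powr (q - 2) * m\<^sup>2 = m powr q"
    using m by (simp add: powr_diff powr_numeral)
  show ?thesis
  proof (cases "Q \<le> d * m\<^sup>2")
    case True
    then have "m powr (q - 2) * Q \<le> m powr (q - 2) * (d * m\<^sup>2)" by (intro mult_left_mono) auto
    also have "\<dots> = d * m powr q" using mq by simp
    finally show ?thesis by (smt (verit) powr_ge_zero mult_nonneg_nonneg)
  next
    case False
    then have "m\<^sup>2 \<le> Q / d" using assms by (simp add: field_simps)
    then have "(m\<^sup>2) powr (q / 2 - 1) \<le> (Q / d) powr (q / 2 - 1)" using assms by (intro powr_mono2) auto
    moreover have "(m\<^sup>2) powr (q / 2 - 1) = m powr (q - 2)"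
      using m by (simp add: powr_powr algebra_simps flip: powr_numeral)
    ultimately have "m powr (q - 2) * Q \<le> (Q / d) powr (q / 2 - 1) * Q"
      using Q by (intro mult_right_mono) auto
    also have "\<dots> = d powr (1 - q / 2) * Q powr (q / 2)"
    proof -
      have "Q powr (q / 2 - 1) * Q = Q powr (q / 2)" using Q by (simp add: powr_diff)
      moreover have "(Q / d) powr (q / 2 - 1) = Q powr (q / 2 - 1) * d powr (1 - q / 2)"
        using Q assms powr_minus_divide[of d "q / 2 - 1"] by (simp add: powr_divide)
      ultimately show ?thesis by simp
    qed
    finally show ?thesis using assms by (smt (verit) powr_ge_zero mult_nonneg_nonneg)
  qed
qed

text \<open>The condition on \<open>h\<close> keeps the intermediate point of the Taylor remainder
  in \<open>{0<..2 * x}\<close>, where the second derivative is controlled by its value at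
  \<open>x\<close> because \<open>q - 2\<close> is nonnegative.\<close>

lemma powr_add_le_tangent_pos:
  fixes q x h :: real
  assumes q: "2 \<le> q" and x: "0 < x" and h: "\<bar>h\<bar> \<le> x / 2"
  shows "(x + h) powr q \<le> x powr q + q * x powr (q - 1) * h + q * (q - 1) * 2 powr (q - 2) * x powr (q - 2) * h\<^sup>2"
proof -
  have D1: "((\<lambda>t. t powr q) has_real_derivative q * t powr (q - 1)) (at t)" if "t > 0" for t
    using that by (rule has_real_derivative_powr)
  have D2: "((\<lambda>t. q * t powr (q - 1)) has_real_derivative q * (q - 1) * t powr (q - 2)) (at t)" if "t > 0" for t
    using that by (auto intro!: derivative_eq_intros)
  have bnd: "t powr (q - 2) \<le> 2 powr (q - 2) * x powr (q - 2)" if "0 \<le> t" "t \<le> 2 * x" for t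
    using powr_mono2[of "q - 2" t "2 * x"] that q x by (simp add: powr_mult)
  \<comment> \<open>The mean value theorem is used twice, for the power and for its derivative; the
    sign of \<open>h\<close> decides the order of the endpoints.\<close>
  have main: "\<exists>v. 0 < v \<and> v \<le> 2 * x \<and> (x + h) powr q - x powr q - q * x powr (q - 1) * h \<le> q * (q - 1) * v powr (q - 2) * h\<^sup>2"
  proof (cases h "0::real" rule: linorder_cases)
    case equal then show ?thesis using x by (intro exI[of _ x]) auto
  next
    case greater
    obtain z where z: "x < z" "z < x + h" "(x + h) powr q - x powr q = h * (q * z powr (q - 1))"
      using MVT2[of x "x + h" "\<lambda>t. t powr q" "\<lambda>t. q * t powr (q - 1)"] D1 x greater by auto
    obtain v where v: "x < v" "v < z" "q * z powr (q - 1) - q * x powr (q - 1) = (z - x) * (q * (q - 1) * v powr (q - 2))"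
      using MVT2[of x z "\<lambda>t. q * t powr (q - 1)" "\<lambda>t. q * (q - 1) * t powr (q - 2)"] D2 x z(1) by force
    have "(x + h) powr q - x powr q - q * x powr (q - 1) * h = h * (q * z powr (q - 1) - q * x powr (q - 1))"
      using z(3) by (simp add: algebra_simps)
    also have "\<dots> = q * (q - 1) * v powr (q - 2) * (h * (z - x))" using v(3) by simp
    also have "\<dots> \<le> q * (q - 1) * v powr (q - 2) * h\<^sup>2"
      using z greater q unfolding power2_eq_square by (intro mult_left_mono) auto
    finally show ?thesis using v z h x by (intro exI[of _ v]) auto
  next
    case less
    have xh: "0 < x + h" using h x less by auto
    obtain z where z: "x + h < z" "z < x" "x powr q - (x + h) powr q = (- h) * (q * z powr (q - 1))"
      using MVT2[of "x + h" x "\<lambda>t. t powr q" "\<lambda>t. q * t powr (q - 1)"] D1 xh less by auto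
    obtain v where v: "z < v" "v < x" "q * x powr (q - 1) - q * z powr (q - 1) = (x - z) * (q * (q - 1) * v powr (q - 2))"
      using MVT2[of z x "\<lambda>t. q * t powr (q - 1)" "\<lambda>t. q * (q - 1) * t powr (q - 2)"] D2 xh z by force
    have "(x + h) powr q - x powr q - q * x powr (q - 1) * h = (- h) * (q * x powr (q - 1) - q * z powr (q - 1))"
      using z(3) by (simp add: algebra_simps)
    also have "\<dots> = q * (q - 1) * v powr (q - 2) * ((- h) * (x - z))" using v(3) by simp
    also have "\<dots> \<le> q * (q - 1) * v powr (q - 2) * ((- h) * (- h))"
      using z less q by (intro mult_left_mono) auto
    finally have "(x + h) powr q - x powr q - q * x powr (q - 1) * h \<le> q * (q - 1) * v powr (q - 2) * h\<^sup>2"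
      by (simp add: power2_eq_square)
    then show ?thesis using v z xh x by (intro exI[of _ v]) auto
  qed
  then obtain v where v: "0 < v" "v \<le> 2 * x"
     "(x + h) powr q - x powr q - q * x powr (q - 1) * h \<le> q * (q - 1) * v powr (q - 2) * h\<^sup>2" by blast
  have "q * (q - 1) * v powr (q - 2) * h\<^sup>2 \<le> q * (q - 1) * (2 powr (q - 2) * x powr (q - 2)) * h\<^sup>2"
    using bnd[of v] v q by (intro mult_right_mono mult_left_mono) auto
  with v(3) show ?thesis by simp
qed

text \<open>If \<open>h\<close> is small against \<open>x\<close> this is the Taylor bound;
  otherwise \<open>\<bar>x\<bar> \<le> 2 * \<bar>h\<bar>\<close> and the terms of either sign are
  covered by multiples of \<open>\<bar>h\<bar> powr q\<close>. \<open>C\<close> adds the constants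
  of both regimes, and negative \<open>x\<close> follow by reflection.\<close>

lemma abs_add_powr_le:
  fixes q :: real
  assumes q: "2 \<le> q"
  obtains C where "0 \<le> C" "\<And>x h. \<bar>x + h\<bar> powr q \<le>
    \<bar>x\<bar> powr q + q * \<bar>x\<bar> powr (q - 1) * sgn x * h + C * (\<bar>x\<bar> powr (q - 2) * h\<^sup>2 + \<bar>h\<bar> powr q)"
proof -
  define C where "C = q * (q - 1) * 2 powr (q - 2) + (3 powr q + q * 2 powr (q - 1))"
  have C1: "q * (q - 1) * 2 powr (q - 2) \<le> C" and C2: "3 powr q + q * 2 powr (q - 1) \<le> C" and C0: "0 \<le> C"
    using q unfolding C_def by auto
  have pos: "\<bar>x + h\<bar> powr q \<le> x powr q + q * x powr (q - 1) * h + C * (x powr (q - 2) * h\<^sup>2 + \<bar>h\<bar> powr q)"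
    if x: "0 \<le> x" for x h
  proof (cases "x > 0 \<and> \<bar>h\<bar> \<le> x / 2")
    case True
    have "\<bar>x + h\<bar> powr q \<le> x powr q + q * x powr (q - 1) * h + q * (q - 1) * 2 powr (q - 2) * (x powr (q - 2) * h\<^sup>2)"
      using powr_add_le_tangent_pos[OF q, of x h] True by auto
    also have "q * (q - 1) * 2 powr (q - 2) * (x powr (q - 2) * h\<^sup>2) \<le> C * (x powr (q - 2) * h\<^sup>2)"
      using C1 by (intro mult_right_mono) auto
    also have "\<dots> \<le> C * (x powr (q - 2) * h\<^sup>2 + \<bar>h\<bar> powr q)"
      using C0 by (intro mult_left_mono) auto
    finally show ?thesis by simp
  next
    case False
    then have xh: "x \<le> 2 * \<bar>h\<bar>" using x by auto
    have "\<bar>x + h\<bar> powr q \<le> (3 * \<bar>h\<bar>) powr q" using xh x q by (intro powr_mono2) auto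
    then have 1: "\<bar>x + h\<bar> powr q \<le> 3 powr q * \<bar>h\<bar> powr q" by (simp add: powr_mult)
    have "x powr (q - 1) \<le> (2 * \<bar>h\<bar>) powr (q - 1)" using xh x q by (intro powr_mono2) auto
    then have "q * x powr (q - 1) * \<bar>h\<bar> \<le> q * (2 * \<bar>h\<bar>) powr (q - 1) * \<bar>h\<bar>"
      using q by (intro mult_right_mono mult_left_mono) auto
    also have "\<dots> = q * 2 powr (q - 1) * \<bar>h\<bar> powr q"
      by (cases "h = 0") (auto simp: powr_mult powr_diff)
    finally have 2: "q * x powr (q - 1) * \<bar>h\<bar> \<le> q * 2 powr (q - 1) * \<bar>h\<bar> powr q" .
    have "- (q * x powr (q - 1) * h) \<le> q * x powr (q - 1) * \<bar>h\<bar>"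
      using mult_left_mono[of "- h" "\<bar>h\<bar>" "q * x powr (q - 1)"] q by simp
    with 1 2 have "\<bar>x + h\<bar> powr q - q * x powr (q - 1) * h \<le> (3 powr q + q * 2 powr (q - 1)) * \<bar>h\<bar> powr q"
      by (simp add: algebra_simps)
    also have "\<dots> \<le> C * \<bar>h\<bar> powr q" using C2 by (intro mult_right_mono) auto
    also have "\<dots> \<le> x powr q + C * (x powr (q - 2) * h\<^sup>2 + \<bar>h\<bar> powr q)"
      using C0 by (simp add: algebra_simps)
    finally show ?thesis by simp
  qed
  show ?thesis
  proof (rule that[OF C0])
    fix x h :: real
    show "\<bar>x + h\<bar> powr q \<le>
      \<bar>x\<bar> powr q + q * \<bar>x\<bar> powr (q - 1) * sgn x * h + C * (\<bar>x\<bar> powr (q - 2) * h\<^sup>2 + \<bar>h\<bar> powr q)"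
    proof (cases "0 \<le> x")
      case True
      then show ?thesis using pos[of x h] by (cases "x = 0") auto
    next
      case False
      moreover have "\<bar>- x + - h\<bar> = \<bar>x + h\<bar>" by simp
      ultimately show ?thesis using pos[of "- x" "- h"] by (simp add: sgn_if)
    qed
  qed
qed

text \<open>For fixed \<open>s'\<close> the expression has derivative
  \<open>q * m powr (q - 2) * (m - s')\<close> in \<open>m\<close>, exactly for this
  \<open>c\<close>, so it decreases up to \<open>m = s'\<close>. Hence raising the running maximum
  to a new record never increases it: the pathwise core of Doob's inequality.\<close>

lemma max_powr_step:
  fixes q m s s' :: real
  assumes q: "1 < q" and m: "0 \<le> m" and s': "0 \<le> s'"
  defines "c \<equiv> q / (q - 1)"
  shows "(max m s') powr q - c * (max m s') powr (q - 1) * s' \<le> m powr q - c * m powr (q - 1) * s'"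
proof (cases "s' \<le> m")
  case True then show ?thesis by (simp add: max_def)
next
  case False
  then have s: "m < s'" by simp
  have c: "1 - c = - (1 / (q - 1))" "c \<ge> 0" using q by (auto simp: c_def field_simps)
  show ?thesis
  proof (cases "m = 0")
    case True
    then have "max m s' = s'" using s by simp
    moreover have "s' powr (q - 1) * s' = s' powr q" using s m by (simp add: powr_diff)
    ultimately have "(max m s') powr q - c * (max m s') powr (q - 1) * s' = (1 - c) * s' powr q"
      by (simp add: algebra_simps)
    also have "\<dots> \<le> 0" using c q by (simp add: mult_nonpos_nonneg)
    finally show ?thesis using True q by simp
  next
    case False
    then have m0: "m > 0" using m by simp
    obtain z where z: "m < z" "z < s'" "s' powr q - m powr q = (s' - m) * (q * z powr (q - 1))"
      using MVT2[OF s, of "\<lambda>t. t powr q" "\<lambda>t. q * t powr (q - 1)"] has_real_derivative_powr m0 by auto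
    have "m powr (q - 1) \<le> z powr (q - 1)" using z m q by (intro powr_mono2) auto
    then have "(s' - m) * (q * m powr (q - 1)) \<le> s' powr q - m powr q"
      using z s q by (auto intro!: mult_left_mono)
    \<comment> \<open>Tangent inequality of the convex power at \<open>m\<close>; multiplication by
      \<open>1 - c\<close>, which is negative, reverses it.\<close>
    then have "m powr q + (s' - m) * (q * m powr (q - 1)) \<le> s' powr q" by simp
    then have "(1 - c) * s' powr q \<le> (1 - c) * (m powr q + (s' - m) * (q * m powr (q - 1)))"
      using c q by (intro mult_left_mono_neg) auto
    also have "\<dots> = (1 - c) * (m powr q) + (1 - c) * q * (s' - m) * m powr (q - 1)" by (simp add: algebra_simps)
    also have "(1 - c) * q = - c" using q by (simp add: c_def field_simps)
    also have "(1 - c) * m powr q + - c * (s' - m) * m powr (q - 1) = m powr q - c * m powr (q - 1) * s' + c * (m powr (q - 1) * m - m powr q)"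
      by (simp add: algebra_simps)
    also have "m powr (q - 1) * m = m powr q" using m0 by (simp add: powr_diff)
    finally have "(1 - c) * s' powr q \<le> m powr q - c * m powr (q - 1) * s'" by simp
    moreover have "s' powr (q - 1) * s' = s' powr q" using s m by (simp add: powr_diff)
    ultimately show ?thesis using s by (simp add: max_def algebra_simps)
  qed
qed

text \<open>Hoelder's inequality up to the factor \<open>2 powr p\<close>: integrate \<open>f \<le> c + c powr (1 - p) * f powr p\<close>
  and optimise over \<open>c\<close>.\<close>

lemma powr_le_nn_integral_powr:
  fixes f :: "'b \<Rightarrow> real" and p K B :: real
  assumes f[measurable]: "f \<in> borel_measurable M" and f0: "\<And>x. 0 \<le> f x"
    and p: "1 \<le> p" and K: "0 \<le> K" "ennreal K \<le> (\<integral>\<^sup>+x. ennreal (f x) \<partial>M)"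
    and B: "0 < B" "emeasure M (space M) \<le> ennreal B"
  shows "ennreal (K powr p) \<le> ennreal (2 powr p * B powr (p - 1)) * (\<integral>\<^sup>+x. ennreal (f x powr p) \<partial>M)"
proof (cases "(\<integral>\<^sup>+x. ennreal (f x powr p) \<partial>M)")
  case top
  then show ?thesis using B by (simp add: ennreal_mult_top)
next
  case (real G)
  have bound: "K \<le> c * B + c powr (1 - p) * G" if c: "0 < c" for c
  proof -
    have pt: "f x \<le> c + c powr (1 - p) * f x powr p" for x
    proof (cases "f x \<le> c")
      case True then show ?thesis by (smt (verit) mult_nonneg_nonneg powr_ge_zero)
    next
      case False
      then have fx: "f x > 0" using c by simp
      have "c powr (p - 1) \<le> f x powr (p - 1)" using False c p by (intro powr_mono2) auto
      then have "c powr (p - 1) * f x \<le> f x powr p" using fx by (simp add: powr_diff field_simps)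
      then have "f x \<le> f x powr p / c powr (p - 1)" using c by (simp add: field_simps)
      also have "\<dots> = c powr (1 - p) * f x powr p" using powr_minus_divide[of c "p - 1"] by simp
      finally show ?thesis using c by simp
    qed
    have "ennreal K \<le> (\<integral>\<^sup>+x. ennreal c + ennreal (c powr (1 - p)) * ennreal (f x powr p) \<partial>M)"
      using pt c by (intro order_trans[OF K(2)] nn_integral_mono)
        (simp flip: ennreal_mult' ennreal_plus)
    also have "\<dots> = ennreal c * emeasure M (space M) + ennreal (c powr (1 - p)) * ennreal G"
      using real by (subst nn_integral_add) (auto simp: nn_integral_cmult)
    also have "\<dots> \<le> ennreal c * ennreal B + ennreal (c powr (1 - p)) * ennreal G"
      using B by (intro add_mono mult_left_mono) auto
    also have "\<dots> = ennreal (c * B + c powr (1 - p) * G)"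
      using c B real(1) by (simp add: ennreal_mult' ennreal_plus)
    finally show ?thesis using c B real(1) by (subst (asm) ennreal_le_iff) auto
  qed
  have "K powr p \<le> 2 powr p * B powr (p - 1) * G"
  proof (cases "G = 0")
    case True
    \<comment> \<open>The optimal \<open>c\<close> would be 0, which is excluded;
      \<open>c = e / B\<close> approaches it.\<close>
    have "K \<le> 0"
    proof (rule field_le_epsilon)
      fix e :: real assume "0 < e"
      then show "K \<le> 0 + e" using bound[of "e / B"] True B by simp
    qed
    then show ?thesis using K True p by simp
  next
    case False
    then have G: "G > 0" using real by simp
    \<comment> \<open>This \<open>c\<close> balances the two terms of \<open>bound\<close>:
      \<open>c powr p = G / B\<close> means \<open>c powr (1 - p) * G = c * B\<close>.\<close>
    define c where "c = (G / B) powr (1 / p)"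
    have c: "c > 0" "c powr p = G / B" using G B p by (auto simp: c_def powr_powr)
    have "c powr (1 - p) * G = c * B" using c B G by (simp add: powr_diff)
    then have "K \<le> 2 * c * B" using bound[OF c(1)] by (simp add: ac_simps)
    then have "K powr p \<le> (2 * c * B) powr p" using K p by (intro powr_mono2) auto
    also have "\<dots> = 2 powr p * (G / B) * B powr p" using c B by (simp add: powr_mult)
    also have "\<dots> = 2 powr p * B powr (p - 1) * G" using B by (simp add: powr_diff)
    finally show ?thesis .
  qed
  then show ?thesis using real by (simp flip: ennreal_mult')
qed

lemma sum_powr_le:
  fixes x :: "'b \<Rightarrow> real"
  assumes A: "finite A" and x: "\<And>i. i \<in> A \<Longrightarrow> 0 \<le> x i" and p: "1 \<le> p"
  shows "(\<Sum>i\<in>A. x i) powr p \<le> 2 powr p * real (card A) powr (p - 1) * (\<Sum>i\<in>A. x i powr p)"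
proof (cases "A = {}")
  case False
  \<comment> \<open>The integral inequality wants nonnegative values everywhere, also outside
    \<open>A\<close>; absolute values provide them and change nothing on \<open>A\<close>. The
    measure is the counting measure of \<open>A\<close>, of total mass
    \<open>card A\<close>.\<close>
  define f where "f i = \<bar>x i\<bar>" for i
  have eq: "(\<Sum>i\<in>A. f i) = (\<Sum>i\<in>A. x i)" "(\<Sum>i\<in>A. f i powr p) = (\<Sum>i\<in>A. x i powr p)"
    using x by (simp_all add: f_def)
  have "ennreal ((\<Sum>i\<in>A. f i) powr p) \<le> ennreal (2 powr p * real (card A) powr (p - 1)) *
      (\<integral>\<^sup>+i. ennreal (f i powr p) \<partial>count_space A)"
    using A False p
    by (intro powr_le_nn_integral_powr) (auto simp: f_def sum_nonneg nn_integral_count_space_finite card_gt_0_iff ennreal_of_nat_eq_real_of_nat)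
  also have "\<dots> = ennreal (2 powr p * real (card A) powr (p - 1) * (\<Sum>i\<in>A. f i powr p))"
    using A by (simp add: nn_integral_count_space_finite ennreal_mult' sum_nonneg)
  finally show ?thesis unfolding eq using x by (subst (asm) ennreal_le_iff) (auto simp: sum_nonneg)
qed (use p in simp)

text \<open>The bound \<open>B + c * (\<Sum>j<m. a j)\<close> itself grows by at most the factor
  \<open>1 + c\<close> per step. Nothing is subtracted, so infinite values of \<open>a\<close> and
  \<open>B\<close> do no harm.\<close>

lemma ennreal_gronwall:
  fixes a :: "nat \<Rightarrow> ennreal" and c :: real and B :: ennreal
  assumes c: "0 \<le> c" and a: "\<And>m. m \<le> M \<Longrightarrow> a m \<le> B + ennreal c * (\<Sum>j<m. a j)" and m: "m \<le> M"
  shows "a m \<le> ennreal ((1 + c) ^ m) * B"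
proof -
  have S: "B + ennreal c * (\<Sum>j<m. a j) \<le> ennreal ((1 + c) ^ m) * B" if "m \<le> M" for m
    using that
  proof (induction m)
    case (Suc m)
    have "B + ennreal c * (\<Sum>j<Suc m. a j) = (B + ennreal c * (\<Sum>j<m. a j)) + ennreal c * a m"
      by (simp add: algebra_simps)
    also have "\<dots> \<le> (B + ennreal c * (\<Sum>j<m. a j)) + ennreal c * (B + ennreal c * (\<Sum>j<m. a j))"
      using Suc.prems a by (intro add_left_mono mult_left_mono) auto
    also have "\<dots> = ennreal (1 + c) * (B + ennreal c * (\<Sum>j<m. a j))"
      using c by (simp add: ennreal_plus algebra_simps)
    also have "\<dots> \<le> ennreal (1 + c) * (ennreal ((1 + c) ^ m) * B)"
      using Suc by (intro mult_left_mono) auto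
    also have "\<dots> = ennreal ((1 + c) ^ Suc m) * B" using c by (simp add: ennreal_mult' mult.assoc)
    finally show ?case .
  qed simp
  show ?thesis using a[OF m] S[OF m] by (rule order_trans)
qed

section \<open>Gaussian increments\<close>

text \<open>One class closed under sums, products, maxima and powers, so that integrability does not
  have to be tracked exponent by exponent in the martingale computations.\<close>

definition (in prob_space) all_moments :: "('a \<Rightarrow> real) \<Rightarrow> bool" where
  "all_moments X \<longleftrightarrow> X \<in> borel_measurable M \<and> (\<forall>a\<ge>0. integrable M (\<lambda>\<omega>. \<bar>X \<omega>\<bar> powr a))"

context prob_space
begin

lemma all_moments_measurable[measurable_dest]: "all_moments X \<Longrightarrow> X \<in> borel_measurable M"
  by (simp add: all_moments_def)

lemma all_moments_powr_integrable: "all_moments X \<Longrightarrow> 0 \<le> a \<Longrightarrow> integrable M (\<lambda>\<omega>. \<bar>X \<omega>\<bar> powr a)"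
  by (simp add: all_moments_def)

lemma all_moments_integrable:
  assumes "all_moments X" shows "integrable M X"
proof -
  have "integrable M (\<lambda>\<omega>. \<bar>X \<omega>\<bar> powr 1)" using assms by (rule all_moments_powr_integrable) simp
  then show ?thesis using assms by (simp add: integrable_abs_iff[of X] all_moments_measurable)
qed

lemma all_moments_mono:
  assumes "all_moments Y" "X \<in> borel_measurable M" "\<And>\<omega>. \<omega> \<in> space M \<Longrightarrow> \<bar>X \<omega>\<bar> \<le> \<bar>Y \<omega>\<bar>"
  shows "all_moments X"
  unfolding all_moments_def
proof (intro conjI allI impI)
  fix a :: real assume a: "0 \<le> a"
  show "integrable M (\<lambda>\<omega>. \<bar>X \<omega>\<bar> powr a)"
    by (rule Bochner_Integration.integrable_bound[OF all_moments_powr_integrable[OF assms(1) a]])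
      (use assms a in \<open>auto intro!: powr_mono2 AE_I2\<close>)
qed (use assms in simp)

lemma all_moments_bounded:
  assumes [measurable]: "X \<in> borel_measurable M" and B: "\<And>\<omega>. \<omega> \<in> space M \<Longrightarrow> \<bar>X \<omega>\<bar> \<le> B"
  shows "all_moments X"
  unfolding all_moments_def
proof (intro conjI allI impI)
  fix a :: real assume a: "0 \<le> a"
  show "integrable M (\<lambda>\<omega>. \<bar>X \<omega>\<bar> powr a)"
    by (rule integrable_const_bound[where B = "B powr a"]) (use B a in \<open>auto intro!: powr_mono2 AE_I2\<close>)
qed simp

lemma all_moments_const: "all_moments (\<lambda>_. c)"
  by (rule all_moments_bounded) auto

lemma all_moments_abs_add:
  assumes "all_moments X" "all_moments Y"
  shows "all_moments (\<lambda>\<omega>. \<bar>X \<omega>\<bar> + \<bar>Y \<omega>\<bar>)"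
  unfolding all_moments_def
proof (intro conjI allI impI)
  note [measurable] = assms[THEN all_moments_measurable]
  fix a :: real assume a: "0 \<le> a"
  show "integrable M (\<lambda>\<omega>. \<bar>\<bar>X \<omega>\<bar> + \<bar>Y \<omega>\<bar>\<bar> powr a)"
    by (rule Bochner_Integration.integrable_bound[of _ "\<lambda>\<omega>. 2 powr a * (\<bar>X \<omega>\<bar> powr a + \<bar>Y \<omega>\<bar> powr a)"])
      (use assms a in \<open>auto intro!: AE_I2 all_moments_powr_integrable powr_add_le\<close>)
qed (use assms in \<open>measurable\<close>)

lemma all_moments_add:
  assumes "all_moments X" "all_moments Y"
  shows "all_moments (\<lambda>\<omega>. X \<omega> + Y \<omega>)"
proof -
  note [measurable] = assms[THEN all_moments_measurable]
  show ?thesis by (rule all_moments_mono[OF all_moments_abs_add[OF assms]]) auto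
qed

lemma all_moments_max:
  assumes "all_moments X" "all_moments Y"
  shows "all_moments (\<lambda>\<omega>. max (X \<omega>) (Y \<omega>))"
proof -
  note [measurable] = assms[THEN all_moments_measurable]
  show ?thesis by (rule all_moments_mono[OF all_moments_abs_add[OF assms]]) auto
qed

lemma all_moments_sum:
  assumes "\<And>i. i \<in> I \<Longrightarrow> all_moments (X i)"
  shows "all_moments (\<lambda>\<omega>. \<Sum>i\<in>I. X i \<omega>)"
  using assms by (induction I rule: infinite_finite_induct) (auto intro: all_moments_const all_moments_add)

lemma all_moments_abs: "all_moments X \<Longrightarrow> all_moments (\<lambda>\<omega>. \<bar>X \<omega>\<bar>)"
  by (rule all_moments_mono[of X]) (auto dest: all_moments_measurable)

lemma all_moments_powr:
  assumes "all_moments X" "0 \<le> r" shows "all_moments (\<lambda>\<omega>. \<bar>X \<omega>\<bar> powr r)"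
proof -
  note [measurable] = assms(1)[THEN all_moments_measurable]
  show ?thesis
    unfolding all_moments_def
  proof (intro conjI allI impI)
    fix a :: real assume "0 \<le> a"
    then show "integrable M (\<lambda>\<omega>. \<bar>\<bar>X \<omega>\<bar> powr r\<bar> powr a)"
      using all_moments_powr_integrable[OF assms(1), of "r * a"] assms(2) by (simp add: powr_powr)
  qed simp
qed

text \<open>Since all exponents are available at once,
  \<open>\<bar>x * y\<bar> \<le> x\<^sup>2 + y\<^sup>2\<close> can replace Hoelder's
  inequality.\<close>

lemma all_moments_mult:
  assumes "all_moments X" "all_moments Y"
  shows "all_moments (\<lambda>\<omega>. X \<omega> * Y \<omega>)"
proof -
  note [measurable] = assms[THEN all_moments_measurable]
  have pt: "\<bar>x * y\<bar> \<le> \<bar>x\<bar> powr 2 + \<bar>y\<bar> powr 2" for x y :: real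
  proof -
    have "0 \<le> \<bar>x\<bar> * \<bar>y\<bar>" by simp
    moreover have "2 * (\<bar>x\<bar> * \<bar>y\<bar>) \<le> x\<^sup>2 + y\<^sup>2" using sum_squares_bound[of "\<bar>x\<bar>" "\<bar>y\<bar>"] by simp
    ultimately have "\<bar>x\<bar> * \<bar>y\<bar> \<le> x\<^sup>2 + y\<^sup>2" by linarith
    then show ?thesis by (simp add: abs_mult)
  qed
  have "all_moments (\<lambda>\<omega>. \<bar>X \<omega>\<bar> powr 2 + \<bar>Y \<omega>\<bar> powr 2)"
    using assms by (intro all_moments_add all_moments_powr) auto
  then show ?thesis by (rule all_moments_mono) (use pt in \<open>auto simp del: powr_numeral\<close>)
qed

end

lemma borel_measurable_vec_nth[measurable]:
  "(\<lambda>x :: 'b::topological_space ^ 'n. x $ i) \<in> borel_measurable borel"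
  by (intro borel_measurable_continuous_onI continuous_intros)

section \<open>Independence and moments of Wiener increments\<close>

context wiener_process
begin

lemma space_F: "0 \<le> s \<Longrightarrow> space (F s) = space P"
  using subalgebra_F by (auto simp: subalgebra_def)

lemma F_measurable_P: "f \<in> measurable (F s) N \<Longrightarrow> 0 \<le> s \<Longrightarrow> f \<in> measurable P N"
  using subalgebra_F by (rule measurable_from_subalg)

lemma F_measurable_mono: "f \<in> measurable (F s) N \<Longrightarrow> 0 \<le> s \<Longrightarrow> s \<le> t \<Longrightarrow> f \<in> measurable (F t) N"
  using subalgebra_F_mono by (rule measurable_from_subalg)

lemma W_measurable_F: "0 \<le> s \<Longrightarrow> s \<le> t \<Longrightarrow> W s \<in> borel_measurable (F t)"
  using adapted F_measurable_mono by blast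

lemma W_measurable_P: "0 \<le> s \<Longrightarrow> W s \<in> borel_measurable P"
  using adapted F_measurable_P by blast

text \<open>Independence of random variables is independence of the generated sigma-algebras. These
  are contained in \<open>F s\<close> and in the sigma-algebra of the increment, so
  \<open>indep_increments\<close> restricts to them.\<close>

lemma indep_var_increment:
  assumes s: "0 \<le> s" "s < t" and Z: "Z \<in> measurable (F s) (N :: 'c measure)"
    and g: "g \<in> measurable borel (N' :: 'c measure)"
  shows "indep_var N Z N' (\<lambda>\<omega>. g (W t \<omega> - W s \<omega>))"
proof -
  have [measurable]: "W t \<in> borel_measurable P" "W s \<in> borel_measurable P"
    using s by (auto intro: W_measurable_P)
  have [measurable]: "(\<lambda>\<omega>. g (W t \<omega> - W s \<omega>)) \<in> measurable P N'" using g by measurable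
  show ?thesis
    unfolding indep_var_eq
  proof (intro conjI)
    show "Z \<in> measurable P N" using Z s by (auto intro: F_measurable_P)
    have 1: "sigma_sets (space P) {Z -` A \<inter> space P |A. A \<in> sets N} \<subseteq> sets (F s)"
      using sets.sigma_sets_subset[of "{Z -` A \<inter> space P |A. A \<in> sets N}" "F s"] measurable_sets[OF Z] space_F[OF s(1)]
      by auto
    let ?V = "vimage_algebra (space P) (\<lambda>\<omega>. W t \<omega> - W s \<omega>) (borel :: (real ^ 'm) measure)"
    have "(\<lambda>\<omega>. g (W t \<omega> - W s \<omega>)) \<in> measurable ?V N'"
      by (rule measurable_compose[OF measurable_vimage_algebra1 g]) auto
    from measurable_sets[OF this] have "{(\<lambda>\<omega>. g (W t \<omega> - W s \<omega>)) -` A \<inter> space P |A. A \<in> sets N'} \<subseteq> sets ?V"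
      by auto
    then have 2: "sigma_sets (space P) {(\<lambda>\<omega>. g (W t \<omega> - W s \<omega>)) -` A \<inter> space P |A. A \<in> sets N'} \<subseteq> sets ?V"
      using sets.sigma_sets_subset[of _ ?V] by simp
    show "indep_set (sigma_sets (space P) {Z -` A \<inter> space P |A. A \<in> sets N})
        (sigma_sets (space P) {(\<lambda>\<omega>. g (W t \<omega> - W s \<omega>)) -` A \<inter> space P |A. A \<in> sets N'})"
      using indep_increments[OF s] 1 2 unfolding indep_set_def
      by (rule_tac indep_sets_mono_sets) (auto split: bool.split)
  qed measurable
qed

lemma prod_normal_density:
  fixes x :: "real ^ 'n"
  assumes d: "0 < d"
  shows "(\<Prod>i\<in>UNIV. normal_density 0 (sqrt d) (x $ i)) =
    (1 / sqrt (2 * pi * d)) ^ CARD('n) * exp (- (norm x)\<^sup>2 / (2 * d))"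
proof -
  have "(norm x)\<^sup>2 = (\<Sum>i\<in>UNIV. (x $ i)\<^sup>2)"
    by (simp add: norm_vec_def L2_set_def sum_nonneg)
  then have "exp (- (norm x)\<^sup>2 / (2 * d)) = (\<Prod>i\<in>UNIV. exp (- (x $ i)\<^sup>2 / (2 * d)))"
    by (simp add: sum_negf sum_divide_distrib flip: exp_sum)
  then show ?thesis using d
    by (simp add: normal_density_def prod.distrib del: times_divide_eq_left)
qed

text \<open>The density of variance \<open>d\<close> times \<open>norm x powr a\<close> is dominated
  by a multiple of the density of variance \<open>2 * d\<close>, whose total mass is 1. Scaling by
  \<open>sqrt d\<close> inside \<open>powr_le_exp_square\<close> gives the rate
  \<open>d powr (a / 2)\<close>.\<close>

lemma increment_moment:
  assumes a: "0 \<le> a"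
  obtains C where "0 \<le> C" "\<And>s t. 0 \<le> s \<Longrightarrow> s < t \<Longrightarrow>
    (\<integral>\<^sup>+\<omega>. ennreal (norm (W t \<omega> - W s \<omega>) powr a) \<partial>P) \<le> ennreal (C * (t - s) powr (a / 2))"
proof -
  obtain C0 where C0: "0 \<le> C0" "\<And>y::real. 0 \<le> y \<Longrightarrow> y powr a \<le> C0 * exp (y\<^sup>2 / 4)"
    using powr_le_exp_square[OF a] by blast
  \<comment> \<open>\<open>sqrt 2 ^ CARD('m)\<close> is the quotient of the normalising constants of
    the variances \<open>d\<close> and \<open>2 * d\<close>.\<close>
  define C where "C = C0 * sqrt 2 ^ CARD('m)"
  show ?thesis
  proof (rule that[of C])
    show "0 \<le> C" using C0 by (simp add: C_def)
    fix s t :: real assume st: "0 \<le> s" "s < t"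
    define d where "d = t - s"
    have d: "d > 0" using st by (simp add: d_def)
    define \<phi> where "\<phi> r x = (\<Prod>i\<in>UNIV. normal_density 0 (sqrt r) (x $ i))" for r and x :: "real ^ 'm"
    have \<phi>0: "0 \<le> \<phi> r x" for r x unfolding \<phi>_def by (intro prod_nonneg) auto
    have pt: "\<phi> d x * norm x powr a \<le> C * d powr (a / 2) * \<phi> (2 * d) x" for x
    proof -
      have "norm x powr a = d powr (a / 2) * (norm x / sqrt d) powr a"
        using d by (simp add: powr_divide powr_powr field_simps flip: powr_half_sqrt)
      also have "\<dots> \<le> d powr (a / 2) * (C0 * exp ((norm x / sqrt d)\<^sup>2 / 4))"
        using d by (intro mult_left_mono C0) auto
      also have "(norm x / sqrt d)\<^sup>2 / 4 = (norm x)\<^sup>2 / (4 * d)" using d by (simp add: power_divide)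
      finally have "\<phi> d x * norm x powr a \<le> \<phi> d x * (d powr (a / 2) * (C0 * exp ((norm x)\<^sup>2 / (4 * d))))"
        using \<phi>0 by (intro mult_left_mono) auto
      also have "\<dots> = C0 * d powr (a / 2) * (1 / sqrt (2 * pi * d)) ^ CARD('m) *
          (exp (- (norm x)\<^sup>2 / (2 * d)) * exp ((norm x)\<^sup>2 / (4 * d)))"
        unfolding \<phi>_def prod_normal_density[OF d] by (simp add: mult_ac)
      also have "exp (- (norm x)\<^sup>2 / (2 * d)) * exp ((norm x)\<^sup>2 / (4 * d)) = exp (- (norm x)\<^sup>2 / (2 * (2 * d)))"
        unfolding exp_add[symmetric] using d by (simp add: field_simps)
      also have "1 / sqrt (2 * pi * d) = sqrt 2 * (1 / sqrt (2 * pi * (2 * d)))"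
      proof -
        have "sqrt (2 * pi * (2 * d)) = sqrt 2 * sqrt (2 * pi * d)" by (simp flip: real_sqrt_mult)
        then show ?thesis using d by simp
      qed
      also have "(sqrt 2 * (1 / sqrt (2 * pi * (2 * d)))) ^ CARD('m) = sqrt 2 ^ CARD('m) * (1 / sqrt (2 * pi * (2 * d))) ^ CARD('m)"
        by (rule power_mult_distrib)
      also have "C0 * d powr (a / 2) * (sqrt 2 ^ CARD('m) * (1 / sqrt (2 * pi * (2 * d))) ^ CARD('m)) *
         exp (- (norm x)\<^sup>2 / (2 * (2 * d))) = C * d powr (a / 2) * \<phi> (2 * d) x"
        using prod_normal_density[of "2 * d" x] d by (simp add: \<phi>_def C_def mult_ac)
      finally show ?thesis .
    qed
    have [measurable]: "\<phi> r \<in> borel_measurable borel" for r unfolding \<phi>_def by measurable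
    \<comment> \<open>Instead of computing a Gaussian integral, the mass is read off from the
      increment over a time interval of length \<open>2 * d\<close>, whose law has this
      density.\<close>
    have one: "(\<integral>\<^sup>+x. ennreal (\<phi> (2 * d) x) \<partial>lborel) = 1"
    proof -
      have "(\<integral>\<^sup>+x. ennreal (\<phi> (2 * d) x) * 1 \<partial>lborel) = (\<integral>\<^sup>+\<omega>. 1 \<partial>P)"
        unfolding \<phi>_def
        using distributed_nn_integral[OF gaussian_increments[of s "s + 2 * d"], of "\<lambda>_. 1"] st d by simp
      then show ?thesis by (simp add: emeasure_space_1)
    qed
    have "(\<integral>\<^sup>+\<omega>. ennreal (norm (W t \<omega> - W s \<omega>) powr a) \<partial>P) = (\<integral>\<^sup>+x. ennreal (\<phi> d x) * ennreal (norm x powr a) \<partial>lborel)"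
      unfolding \<phi>_def d_def using distributed_nn_integral[OF gaussian_increments[OF st], of "\<lambda>x. ennreal (norm x powr a)"] by simp
    also have "\<dots> \<le> (\<integral>\<^sup>+x. ennreal (C * d powr (a / 2)) * ennreal (\<phi> (2 * d) x) \<partial>lborel)"
      using pt \<phi>0 C0 d by (intro nn_integral_mono) (simp add: C_def flip: ennreal_mult)
    also have "\<dots> = ennreal (C * d powr (a / 2))" by (simp add: nn_integral_cmult one)
    finally show "(\<integral>\<^sup>+\<omega>. ennreal (norm (W t \<omega> - W s \<omega>) powr a) \<partial>P) \<le> ennreal (C * (t - s) powr (a / 2))"
      by (simp add: d_def)
  qed
qed

lemma all_moments_increment:
  assumes s: "0 \<le> s" "s < t" shows "all_moments (\<lambda>\<omega>. norm (W t \<omega> - W s \<omega>))"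
  unfolding all_moments_def
proof (intro conjI allI impI)
  have [measurable]: "W t \<in> borel_measurable P" "W s \<in> borel_measurable P"
    using s by (auto intro: W_measurable_P)
  show "(\<lambda>\<omega>. norm (W t \<omega> - W s \<omega>)) \<in> borel_measurable P" by measurable
  fix a :: real assume "0 \<le> a"
  from increment_moment[OF this] obtain C where "\<And>s t. 0 \<le> s \<Longrightarrow> s < t \<Longrightarrow>
    (\<integral>\<^sup>+\<omega>. ennreal (norm (W t \<omega> - W s \<omega>) powr a) \<partial>P) \<le> ennreal (C * (t - s) powr (a / 2))"
    by blast
  note C = this[OF s]
  show "integrable P (\<lambda>\<omega>. \<bar>norm (W t \<omega> - W s \<omega>)\<bar> powr a)"
    by (rule integrableI_bounded) (use C in \<open>auto intro: order_le_less_trans\<close>)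
qed

text \<open>The density is even and the coordinate is odd, so reflecting Lebesgue measure shows the
  mean to be its own negative.\<close>

lemma increment_mean:
  assumes s: "0 \<le> s" "s < t" shows "(\<integral>\<omega>. (W t \<omega> - W s \<omega>) $ i \<partial>P) = 0"
proof -
  define \<phi> where "\<phi> x = (\<Prod>i\<in>UNIV. normal_density 0 (sqrt (t - s)) (x $ i))" for x :: "real ^ 'm"
  have [measurable]: "\<phi> \<in> borel_measurable borel" unfolding \<phi>_def by measurable
  have \<phi>0: "0 \<le> \<phi> x" for x unfolding \<phi>_def by (intro prod_nonneg) auto
  have \<phi>m: "\<phi> (- x) = \<phi> x" for x unfolding \<phi>_def by (simp add: normal_density_def)
  have "(\<integral>x. \<phi> x * x $ i \<partial>lborel) = (\<integral>\<omega>. (W t \<omega> - W s \<omega>) $ i \<partial>P)"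
    using gaussian_increments[OF s] \<phi>0 unfolding \<phi>_def[symmetric] by (intro distributed_integral) auto
  moreover have "(\<integral>x. \<phi> x * x $ i \<partial>lborel) = - (\<integral>x. \<phi> x * x $ i \<partial>lborel)"
  proof -
    have L: "lborel = distr lborel borel (uminus :: real ^ 'm \<Rightarrow> _)"
      using lborel_affine[of "-1" "0 :: real ^ 'm"] by (simp add: density_1)
    have "(\<integral>x. \<phi> x * x $ i \<partial>lborel) = (\<integral>x. \<phi> x * x $ i \<partial>distr lborel borel uminus)"
      using L by simp
    also have "\<dots> = (\<integral>x. \<phi> (- x) * (- x) $ i \<partial>lborel)"
      by (subst integral_distr) auto
    finally show ?thesis by (simp add: \<phi>m)
  qed
  ultimately show ?thesis by simp
qed

text \<open>The martingale property in the form used below, without conditional expectations: each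
  coordinate of \<open>\<xi>\<close> times \<open>Z\<close> is independent of the matching
  coordinate of the increment, and that has mean zero.\<close>

lemma expectation_mult_increment:
  assumes s: "0 \<le> s" "s < t"
    and Z: "Z \<in> borel_measurable (F s)" "all_moments Z"
    and \<xi>: "\<xi> \<in> borel_measurable (F s)" "all_moments (\<lambda>\<omega>. norm (\<xi> \<omega>))"
  shows "(\<integral>\<omega>. Z \<omega> * (\<xi> \<omega> \<bullet> (W t \<omega> - W s \<omega>)) \<partial>P) = 0"
proof -
  have \<xi>P: "\<xi> \<in> borel_measurable P" using \<xi> s by (auto intro: F_measurable_P)
  have [measurable]: "W t \<in> borel_measurable P" "W s \<in> borel_measurable P"
    using s by (auto intro: W_measurable_P)
  note [measurable] = \<xi>P \<xi>(1) Z(1)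
  have i1: "integrable P (\<lambda>\<omega>. Z \<omega> * \<xi> \<omega> $ i)" for i
    using \<xi>P by (intro all_moments_integrable all_moments_mult Z all_moments_mono[OF \<xi>(2)]) (auto simp: component_le_norm_cart)
  have i2: "integrable P (\<lambda>\<omega>. (W t \<omega> - W s \<omega>) $ i)" for i
    by (intro all_moments_integrable all_moments_mono[OF all_moments_increment[OF s]])
      (use component_le_norm_cart in \<open>auto simp del: vector_minus_component\<close>)
  have ind: "indep_var borel (\<lambda>\<omega>. Z \<omega> * \<xi> \<omega> $ i) borel (\<lambda>\<omega>. (W t \<omega> - W s \<omega>) $ i)" for i
    using Z(1) \<xi>(1) by (intro indep_var_increment[OF s]) auto
  have "(\<integral>\<omega>. Z \<omega> * (\<xi> \<omega> \<bullet> (W t \<omega> - W s \<omega>)) \<partial>P) =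
    (\<integral>\<omega>. (\<Sum>i\<in>UNIV. (Z \<omega> * \<xi> \<omega> $ i) * (W t \<omega> - W s \<omega>) $ i) \<partial>P)"
    by (simp add: inner_vec_def sum_distrib_left mult.assoc)
  also have "\<dots> = (\<Sum>i\<in>UNIV. (\<integral>\<omega>. (Z \<omega> * \<xi> \<omega> $ i) * (W t \<omega> - W s \<omega>) $ i \<partial>P))"
    by (intro Bochner_Integration.integral_sum indep_var_integrable[OF ind i1 i2])
  also have "\<dots> = (\<Sum>i\<in>UNIV. (\<integral>\<omega>. Z \<omega> * \<xi> \<omega> $ i \<partial>P) * (\<integral>\<omega>. (W t \<omega> - W s \<omega>) $ i \<partial>P))"
    using indep_var_lebesgue_integral[OF ind i1 i2] by simp
  also have "\<dots> = 0" using increment_mean[OF s] by simp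
  finally show ?thesis .
qed

text \<open>The moment of the increment factors out by independence. \<open>C\<close> depends on
  \<open>a\<close> but not on the times or the weight \<open>Z\<close>, because one constant has to
  serve every step of every grid.\<close>

lemma expectation_mult_increment_powr:
  assumes a: "0 \<le> a"
  obtains C where "0 \<le> C" "\<And>s t Z. 0 \<le> s \<Longrightarrow> s < t \<Longrightarrow> Z \<in> borel_measurable (F s) \<Longrightarrow> all_moments Z \<Longrightarrow>
    (\<And>\<omega>. 0 \<le> Z \<omega>) \<Longrightarrow>
    (\<integral>\<omega>. Z \<omega> * norm (W t \<omega> - W s \<omega>) powr a \<partial>P) \<le> C * (t - s) powr (a / 2) * (\<integral>\<omega>. Z \<omega> \<partial>P)"
proof -
  obtain C where C: "0 \<le> C" "\<And>s t. 0 \<le> s \<Longrightarrow> s < t \<Longrightarrow>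
    (\<integral>\<^sup>+\<omega>. ennreal (norm (W t \<omega> - W s \<omega>) powr a) \<partial>P) \<le> ennreal (C * (t - s) powr (a / 2))"
    using increment_moment[OF a] by blast
  show ?thesis
  proof (rule that[OF C(1)])
    fix s t Z assume s: "0 \<le> s" "s < t" and Z: "Z \<in> borel_measurable (F s)" "all_moments Z" "\<And>\<omega>. (0::real) \<le> Z \<omega>"
    have int: "integrable P (\<lambda>\<omega>. norm (W t \<omega> - W s \<omega>) powr a)"
      using all_moments_powr_integrable[OF all_moments_increment[OF s] a] by simp
    have ind: "indep_var borel Z borel (\<lambda>\<omega>. norm (W t \<omega> - W s \<omega>) powr a)"
      using Z(1) by (intro indep_var_increment[OF s]) auto
    have "ennreal (\<integral>\<omega>. norm (W t \<omega> - W s \<omega>) powr a \<partial>P) \<le> ennreal (C * (t - s) powr (a / 2))"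
      using C(2)[OF s] int by (subst (asm) nn_integral_eq_integral) auto
    then have "(\<integral>\<omega>. norm (W t \<omega> - W s \<omega>) powr a \<partial>P) \<le> C * (t - s) powr (a / 2)"
      using C(1) by (subst (asm) ennreal_le_iff) auto
    then have "(\<integral>\<omega>. Z \<omega> \<partial>P) * (\<integral>\<omega>. norm (W t \<omega> - W s \<omega>) powr a \<partial>P) \<le> (\<integral>\<omega>. Z \<omega> \<partial>P) * (C * (t - s) powr (a / 2))"
      using Z by (intro mult_left_mono) auto
    then show "(\<integral>\<omega>. Z \<omega> * norm (W t \<omega> - W s \<omega>) powr a \<partial>P) \<le> C * (t - s) powr (a / 2) * (\<integral>\<omega>. Z \<omega> \<partial>P)"
      using indep_var_lebesgue_integral[OF ind all_moments_integrable[OF Z(2)] int] by (simp add: mult_ac)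
  qed
qed

end

section \<open>Maximal inequality for elementary integrals\<close>

text \<open>The recursion is shaped for \<open>max_powr_step\<close>: one comparison per time
  index.\<close>

primrec running_max :: "(nat \<Rightarrow> real) \<Rightarrow> nat \<Rightarrow> real" where
  "running_max f 0 = \<bar>f 0\<bar>"
| "running_max f (Suc n) = max (running_max f n) \<bar>f (Suc n)\<bar>"

lemma abs_le_running_max: "k \<le> n \<Longrightarrow> \<bar>f k\<bar> \<le> running_max f n"
  by (induction n) (auto simp: le_Suc_eq)

lemma running_max_nonneg: "0 \<le> running_max f n"
  using abs_le_running_max[of 0 n f] by linarith

lemma running_max_cong: "(\<And>k. k \<le> n \<Longrightarrow> f k = g k) \<Longrightarrow> running_max f n = running_max g n"
  by (induction n) auto

lemma running_max_measurable:
  "(\<And>k. k \<le> n \<Longrightarrow> f k \<in> borel_measurable M) \<Longrightarrow> (\<lambda>\<omega>. running_max (\<lambda>k. f k \<omega>) n) \<in> borel_measurable M"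
  by (induction n) auto

lemma (in prob_space) all_moments_running_max:
  "(\<And>k. k \<le> n \<Longrightarrow> all_moments (f k)) \<Longrightarrow> all_moments (\<lambda>\<omega>. running_max (\<lambda>k. f k \<omega>) n)"
  by (induction n) (auto intro!: all_moments_max all_moments_abs)

lemma powr_add_powr_le:
  fixes x y r :: real
  assumes "0 \<le> x" "0 \<le> y" "1 \<le> r"
  shows "x powr r + y powr r \<le> (x + y) powr r"
proof -
  have eq: "z powr r = z * z powr (r - 1)" if "0 \<le> z" for z :: real
    using that by (cases "z = 0") (auto simp: powr_diff)
  have "x powr r + y powr r = x * x powr (r - 1) + y * y powr (r - 1)" using assms eq by simp
  also have "\<dots> \<le> x * (x + y) powr (r - 1) + y * (x + y) powr (r - 1)"
    using assms by (intro add_mono mult_left_mono powr_mono2) auto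
  also have "\<dots> = (x + y) powr r" using assms eq[of "x + y"] by (simp add: algebra_simps)
  finally show ?thesis .
qed

lemma sum_powr_le_powr_sum:
  fixes x :: "'b \<Rightarrow> real"
  assumes "\<And>i. i \<in> I \<Longrightarrow> 0 \<le> x i" "1 \<le> r"
  shows "(\<Sum>i\<in>I. x i powr r) \<le> (\<Sum>i\<in>I. x i) powr r"
  using assms(1)
proof (induction I rule: infinite_finite_induct)
  case (insert i I)
  then have "(\<Sum>i\<in>insert i I. x i powr r) \<le> x i powr r + (\<Sum>i\<in>I. x i) powr r" by simp
  also have "\<dots> \<le> (x i + (\<Sum>i\<in>I. x i)) powr r"
    using insert assms by (intro powr_add_powr_le sum_nonneg) auto
  finally show ?case using insert by simp
qed (use assms in auto)

text \<open>The integral is scalar: \<open>\<xi> l\<close> acts as a row vector on the increment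
  over the \<open>l\<close>-th cell. As every cell has positive length, the bound \<open>K\<close>
  on the quadratic variation makes each \<open>\<xi> l\<close> bounded, and all quantities below
  have all moments.\<close>

locale elementary_integral = wiener_process P F W
  for P :: "'a measure" and F and W :: "real \<Rightarrow> 'a \<Rightarrow> real ^ 'm" +
  fixes u :: "nat \<Rightarrow> real" and L :: nat and \<xi> :: "nat \<Rightarrow> 'a \<Rightarrow> real ^ 'm" and K :: real
  assumes u_0: "0 \<le> u 0"
    and u_less_Suc: "l < L \<Longrightarrow> u l < u (Suc l)"
    and \<xi>_F: "l < L \<Longrightarrow> \<xi> l \<in> borel_measurable (F (u l))"
    and variation_le: "\<omega> \<in> space P \<Longrightarrow> (\<Sum>l<L. (norm (\<xi> l \<omega>))\<^sup>2 * (u (Suc l) - u l)) \<le> K"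
begin

text \<open>\<open>Q\<close> is the quadratic variation, \<open>D\<close> the martingale
  differences, \<open>S\<close> the martingale and \<open>mx\<close> its running maximum.\<close>

definition "Q n \<omega> = (\<Sum>l<n. (norm (\<xi> l \<omega>))\<^sup>2 * (u (Suc l) - u l))"
definition "D l \<omega> = \<xi> l \<omega> \<bullet> (W (u (Suc l)) \<omega> - W (u l) \<omega>)"
definition "S n \<omega> = (\<Sum>l<n. D l \<omega>)"
definition "mx n \<omega> = running_max (\<lambda>k. S k \<omega>) n"

lemma u_mono: "l \<le> k \<Longrightarrow> k \<le> L \<Longrightarrow> u l \<le> u k"
proof (induction k)
  case (Suc k) then show ?case using u_less_Suc[of k] by (auto simp: le_Suc_eq)
qed simp

lemma u_nonneg: "l \<le> L \<Longrightarrow> 0 \<le> u l"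
  using u_mono[of 0 l] u_0 by simp

lemma \<xi>_P: "l < L \<Longrightarrow> \<xi> l \<in> borel_measurable P"
  using F_measurable_P[OF \<xi>_F u_nonneg] by simp

lemma all_moments_\<xi>: assumes "l < L" shows "all_moments (\<lambda>\<omega>. norm (\<xi> l \<omega>))"
proof (rule all_moments_bounded)
  fix \<omega> assume \<omega>: "\<omega> \<in> space P"
  have d: "0 < u (Suc l) - u l" using u_less_Suc[OF assms] by simp
  have "(norm (\<xi> l \<omega>))\<^sup>2 * (u (Suc l) - u l) \<le> (\<Sum>l<L. (norm (\<xi> l \<omega>))\<^sup>2 * (u (Suc l) - u l))"
    using assms less_imp_le[OF u_less_Suc] by (intro member_le_sum) auto
  also have "\<dots> \<le> K" using variation_le[OF \<omega>] .
  finally have "(norm (\<xi> l \<omega>))\<^sup>2 \<le> K / (u (Suc l) - u l)" using d by (simp add: field_simps)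
  then have "norm (\<xi> l \<omega>) \<le> sqrt (K / (u (Suc l) - u l))" by (rule real_le_rsqrt)
  then show "\<bar>norm (\<xi> l \<omega>)\<bar> \<le> sqrt (K / (u (Suc l) - u l))" by simp
qed (use \<xi>_P[OF assms] in measurable)

lemma D_F: assumes "l < L" shows "D l \<in> borel_measurable (F (u (Suc l)))"
proof -
  have [measurable]: "\<xi> l \<in> borel_measurable (F (u (Suc l)))"
    using \<xi>_F[OF assms] u_nonneg[of l] u_less_Suc[OF assms] assms by (auto intro: F_measurable_mono)
  have [measurable]: "W (u l) \<in> borel_measurable (F (u (Suc l)))" "W (u (Suc l)) \<in> borel_measurable (F (u (Suc l)))"
    using u_nonneg[of l] u_less_Suc[OF assms] assms by (auto intro!: W_measurable_F)
  show ?thesis unfolding D_def by measurable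
qed

lemma D_P: assumes "l < L" shows "D l \<in> borel_measurable P"
  using F_measurable_P[OF D_F[OF assms] u_nonneg] assms by simp

lemma abs_D_le: "\<bar>D l \<omega>\<bar> \<le> norm (\<xi> l \<omega>) * norm (W (u (Suc l)) \<omega> - W (u l) \<omega>)"
  unfolding D_def by (rule Cauchy_Schwarz_ineq2)

lemma all_moments_W: "l < L \<Longrightarrow> all_moments (\<lambda>\<omega>. norm (W (u (Suc l)) \<omega> - W (u l) \<omega>))"
  using u_nonneg u_less_Suc by (intro all_moments_increment) auto

lemma all_moments_D: "l < L \<Longrightarrow> all_moments (D l)"
  by (rule all_moments_mono[OF all_moments_mult[OF all_moments_\<xi> all_moments_W] D_P])
    (auto simp: abs_mult intro: order_trans[OF abs_D_le])

lemma all_moments_S: "n \<le> L \<Longrightarrow> all_moments (S n)"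
  unfolding S_def by (intro all_moments_sum all_moments_D) auto

lemma all_moments_mx: "n \<le> L \<Longrightarrow> all_moments (mx n)"
  unfolding mx_def by (intro all_moments_running_max all_moments_S) auto

lemma Q_nonneg: "n \<le> L \<Longrightarrow> 0 \<le> Q n \<omega>"
  unfolding Q_def using less_imp_le[OF u_less_Suc] by (intro sum_nonneg) auto

lemma all_moments_\<xi>2: "l < L \<Longrightarrow> all_moments (\<lambda>\<omega>. (norm (\<xi> l \<omega>))\<^sup>2 * (u (Suc l) - u l))"
  unfolding power2_eq_square by (intro all_moments_mult all_moments_\<xi> all_moments_const)

lemma all_moments_Q: "n \<le> L \<Longrightarrow> all_moments (Q n)"
  unfolding Q_def by (intro all_moments_sum all_moments_\<xi>2) auto

lemma S_F: assumes "n \<le> L" shows "S n \<in> borel_measurable (F (u n))"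
  unfolding S_def
proof (intro borel_measurable_sum)
  fix l assume "l \<in> {..<n}"
  then show "D l \<in> borel_measurable (F (u n))"
    using assms D_F[of l] u_nonneg[of "Suc l"] u_mono[of "Suc l" n] by (auto intro: F_measurable_mono)
qed

lemma mx_F: assumes "n \<le> L" shows "mx n \<in> borel_measurable (F (u n))"
  unfolding mx_def
proof (intro running_max_measurable)
  fix k assume "k \<le> n"
  then show "S k \<in> borel_measurable (F (u n))"
    using assms S_F[of k] u_nonneg[of k] u_mono[of k n] by (auto intro: F_measurable_mono)
qed

lemma mx_nonneg: "0 \<le> mx n \<omega>"
  unfolding mx_def by (rule running_max_nonneg)

lemma abs_S_le_mx: "k \<le> n \<Longrightarrow> \<bar>S k \<omega>\<bar> \<le> mx n \<omega>"
  unfolding mx_def by (rule abs_le_running_max)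

lemma S_0: "S 0 \<omega> = 0" and S_Suc: "S (Suc n) \<omega> = S n \<omega> + D n \<omega>"
  by (simp_all add: S_def)

lemma mx_Suc: "mx (Suc n) \<omega> = max (mx n \<omega>) \<bar>S (Suc n) \<omega>\<bar>"
  by (simp add: mx_def)

lemma expectation_mult_D:
  assumes "l < L" "Z \<in> borel_measurable (F (u l))" "all_moments Z"
  shows "(\<integral>\<omega>. Z \<omega> * D l \<omega> \<partial>P) = 0"
  unfolding D_def using assms u_nonneg[of l] u_less_Suc[of l] \<xi>_F all_moments_\<xi>
  by (intro expectation_mult_increment) auto

lemma all_moments_sgn_mult: "n \<le> L \<Longrightarrow> all_moments X \<Longrightarrow> all_moments (\<lambda>\<omega>. X \<omega> * sgn (S n \<omega>))"
  by (intro all_moments_mult all_moments_bounded[of "\<lambda>\<omega>. sgn (S n \<omega>)" 1])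
    (use all_moments_measurable[OF all_moments_S] in \<open>auto simp: sgn_if\<close>)

lemma doob:
  fixes q :: real
  assumes q: "2 \<le> q"
  defines "c \<equiv> q / (q - 1)"
  shows "(\<integral>\<omega>. mx L \<omega> powr q \<partial>P) \<le> 2 * (c * (2 * c) powr (q - 1)) * (\<integral>\<omega>. \<bar>S L \<omega>\<bar> powr q \<partial>P)"
proof -
  have c: "1 \<le> c" using q by (simp add: c_def)
  have mom_mx: "all_moments (\<lambda>\<omega>. mx n \<omega> powr r)" if "n \<le> L" "0 \<le> r" for n r
    using all_moments_powr[OF all_moments_mx[OF that(1)] that(2)] by (simp add: mx_nonneg)
  \<comment> \<open>\<open>A\<close> starts at 0 and its mean never increases:
    \<open>max_powr_step\<close> allows the maximum to be frozen at step \<open>n\<close>, and what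
    remains is linear in \<open>D n\<close> with a coefficient known at time
    \<open>u n\<close>.\<close>
  define A where "A n \<omega> = mx n \<omega> powr q - c * (mx n \<omega> powr (q - 1) * \<bar>S n \<omega>\<bar>)" for n \<omega>
  have int1: "integrable P (\<lambda>\<omega>. mx n \<omega> powr q)" if "n \<le> L" for n
    using mom_mx[OF that, of q] q by (intro all_moments_integrable) auto
  have int2: "integrable P (\<lambda>\<omega>. c * (mx n \<omega> powr (q - 1) * \<bar>S n \<omega>\<bar>))" if "n \<le> L" for n
    using mom_mx[OF that, of "q - 1"] q all_moments_S[OF that]
    by (intro all_moments_integrable all_moments_mult all_moments_const all_moments_abs) auto
  have intA: "integrable P (A n)" if "n \<le> L" for n
    unfolding A_def using int1[OF that] int2[OF that] by simp
  have "(\<integral>\<omega>. A n \<omega> \<partial>P) \<le> 0" if "n \<le> L" for n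
    using that
  proof (induction n)
    case 0
    have "A 0 \<omega> = 0" for \<omega> using q by (simp add: A_def mx_def S_0)
    then show ?case by simp
  next
    case (Suc n)
    then have n: "n < L" "n \<le> L" by auto
    define Z where "Z \<omega> = mx n \<omega> powr (q - 1) * sgn (S n \<omega>)" for \<omega>
    have momZ: "all_moments Z" unfolding Z_def
      using mom_mx[OF n(2), of "q - 1"] q n by (intro all_moments_sgn_mult) auto
    have Z: "Z \<in> borel_measurable (F (u n))"
      using S_F[OF n(2)] mx_F[OF n(2)] unfolding Z_def by (auto simp: sgn_if)
    have intZ: "integrable P (\<lambda>\<omega>. Z \<omega> * D n \<omega>)"
      using momZ all_moments_D[OF n(1)] by (intro all_moments_integrable all_moments_mult)
    have pt: "A (Suc n) \<omega> \<le> A n \<omega> - c * (Z \<omega> * D n \<omega>)" for \<omega>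
    proof -
      \<comment> \<open>Subgradient inequality of the absolute value at \<open>S n\<close>, with
        subgradient 0 at the kink.\<close>
      have tri: "\<bar>S n \<omega>\<bar> + sgn (S n \<omega>) * D n \<omega> \<le> \<bar>S (Suc n) \<omega>\<bar>"
        by (auto simp: S_Suc sgn_if)
      have "A (Suc n) \<omega> \<le> mx n \<omega> powr q - c * mx n \<omega> powr (q - 1) * \<bar>S (Suc n) \<omega>\<bar>"
        unfolding A_def mx_Suc using max_powr_step[of q "mx n \<omega>" "\<bar>S (Suc n) \<omega>\<bar>"] q mx_nonneg
        by (simp add: c_def mult.assoc)
      also have "\<dots> \<le> mx n \<omega> powr q - c * mx n \<omega> powr (q - 1) * (\<bar>S n \<omega>\<bar> + sgn (S n \<omega>) * D n \<omega>)"
        using tri c by (intro diff_left_mono mult_left_mono) auto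
      also have "\<dots> = A n \<omega> - c * (Z \<omega> * D n \<omega>)" by (simp add: A_def Z_def algebra_simps)
      finally show ?thesis .
    qed
    have "(\<integral>\<omega>. A (Suc n) \<omega> \<partial>P) \<le> (\<integral>\<omega>. A n \<omega> - c * (Z \<omega> * D n \<omega>) \<partial>P)"
      using pt intA[OF Suc.prems] intA[OF n(2)] intZ by (intro integral_mono) auto
    also have "\<dots> = (\<integral>\<omega>. A n \<omega> \<partial>P) - c * (\<integral>\<omega>. Z \<omega> * D n \<omega> \<partial>P)"
      using intA[OF n(2)] intZ by simp
    also have "(\<integral>\<omega>. Z \<omega> * D n \<omega> \<partial>P) = 0" using n Z momZ by (intro expectation_mult_D)
    finally show ?case using Suc.IH n by simp
  qed
  from this[of L] have "(\<integral>\<omega>. mx L \<omega> powr q \<partial>P) \<le> (\<integral>\<omega>. c * (mx L \<omega> powr (q - 1) * \<bar>S L \<omega>\<bar>) \<partial>P)"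
    unfolding A_def using int1 int2 by simp
  \<comment> \<open>Half of the left-hand side reappears on the right and is moved back, which is
    legitimate because \<open>mx L\<close> has finite moments. This is the factor 2 in the
    conclusion.\<close>
  also have "\<dots> \<le> (\<integral>\<omega>. mx L \<omega> powr q / 2 + c * (2 * c) powr (q - 1) * \<bar>S L \<omega>\<bar> powr q \<partial>P)"
  proof (rule integral_mono)
    show "c * (mx L \<omega> powr (q - 1) * \<bar>S L \<omega>\<bar>) \<le> mx L \<omega> powr q / 2 + c * (2 * c) powr (q - 1) * \<bar>S L \<omega>\<bar> powr q" for \<omega>
      using powr_pred_mult_le[of q c "mx L \<omega>" "\<bar>S L \<omega>\<bar>"] q c mx_nonneg by (simp add: mult.assoc)
  qed (use int1 int2 all_moments_powr_integrable[OF all_moments_S] q in auto)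
  also have "\<dots> = (\<integral>\<omega>. mx L \<omega> powr q \<partial>P) / 2 + c * (2 * c) powr (q - 1) * (\<integral>\<omega>. \<bar>S L \<omega>\<bar> powr q \<partial>P)"
    using int1 all_moments_powr_integrable[OF all_moments_S] q by simp
  finally show ?thesis by simp
qed

text \<open>Summed Taylor expansion of \<open>\<bar>S\<bar> powr q\<close>: the linear term has mean
  zero, and the increments in the other two terms are averaged out by independence.
  \<open>C\<close>, \<open>A2\<close> and \<open>Aq\<close> are taken as hypotheses so that they can
  be fixed before the grid and the integrand are known.\<close>

lemma moment_S_le:
  fixes q C A2 Aq :: real
  assumes q: "2 \<le> q" and C: "0 \<le> C" "\<And>x h. \<bar>x + h\<bar> powr q \<le>
      \<bar>x\<bar> powr q + q * \<bar>x\<bar> powr (q - 1) * sgn x * h + C * (\<bar>x\<bar> powr (q - 2) * h\<^sup>2 + \<bar>h\<bar> powr q)"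
    and A2: "0 \<le> A2" "\<And>s t Z. 0 \<le> s \<Longrightarrow> s < t \<Longrightarrow> Z \<in> borel_measurable (F s) \<Longrightarrow> all_moments Z \<Longrightarrow> (\<And>\<omega>. 0 \<le> Z \<omega>) \<Longrightarrow>
      (\<integral>\<omega>. Z \<omega> * norm (W t \<omega> - W s \<omega>) powr 2 \<partial>P) \<le> A2 * (t - s) powr (2 / 2) * (\<integral>\<omega>. Z \<omega> \<partial>P)"
    and Aq: "0 \<le> Aq" "\<And>s t Z. 0 \<le> s \<Longrightarrow> s < t \<Longrightarrow> Z \<in> borel_measurable (F s) \<Longrightarrow> all_moments Z \<Longrightarrow> (\<And>\<omega>. 0 \<le> Z \<omega>) \<Longrightarrow>
      (\<integral>\<omega>. Z \<omega> * norm (W t \<omega> - W s \<omega>) powr q \<partial>P) \<le> Aq * (t - s) powr (q / 2) * (\<integral>\<omega>. Z \<omega> \<partial>P)"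
  shows "(\<integral>\<omega>. \<bar>S L \<omega>\<bar> powr q \<partial>P) \<le>
    C * (A2 * (\<integral>\<omega>. mx L \<omega> powr (q - 2) * Q L \<omega> \<partial>P) + Aq * (\<integral>\<omega>. Q L \<omega> powr (q / 2) \<partial>P))"
proof -
  define v where "v l \<omega> = (norm (\<xi> l \<omega>))\<^sup>2 * (u (Suc l) - u l)" for l \<omega>
  have v0: "0 \<le> v l \<omega>" if "l < L" for l \<omega> using u_less_Suc[OF that] by (simp add: v_def)
  have mom_v: "all_moments (v l)" if "l < L" for l
    unfolding v_def[abs_def] using all_moments_\<xi>2[OF that] .
  have mom_mx: "all_moments (\<lambda>\<omega>. mx n \<omega> powr r)" if "n \<le> L" "0 \<le> r" for n r
    using all_moments_powr[OF all_moments_mx[OF that(1)] that(2)] by (simp add: mx_nonneg)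
  have mom_S: "all_moments (\<lambda>\<omega>. \<bar>S n \<omega>\<bar> powr r)" if "n \<le> L" "0 \<le> r" for n r
    using all_moments_powr[OF all_moments_S[OF that(1)] that(2)] .
  have mom_mv: "all_moments (\<lambda>\<omega>. mx L \<omega> powr (q - 2) * v l \<omega>)" if "l < L" for l
    using mom_v[OF that] mom_mx[of L "q - 2"] q by (intro all_moments_mult) auto
  have mom_vq: "all_moments (\<lambda>\<omega>. v l \<omega> powr (q / 2))" if "l < L" for l
    using all_moments_powr[OF mom_v[OF that], of "q / 2"] q v0[OF that] by simp
  have step: "(\<integral>\<omega>. \<bar>S (Suc n) \<omega>\<bar> powr q \<partial>P) \<le> (\<integral>\<omega>. \<bar>S n \<omega>\<bar> powr q \<partial>P) +
      C * (A2 * (\<integral>\<omega>. mx L \<omega> powr (q - 2) * v n \<omega> \<partial>P) + Aq * (\<integral>\<omega>. v n \<omega> powr (q / 2) \<partial>P))"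
    if n: "n < L" for n
  proof -
    define d where "d = u (Suc n) - u n"
    have d: "d > 0" using u_less_Suc[OF n] by (simp add: d_def)
    have un: "0 \<le> u n" "u n < u (Suc n)" using u_nonneg[of n] u_less_Suc[OF n] n by auto
    let ?w = "\<lambda>\<omega>. norm (W (u (Suc n)) \<omega> - W (u n) \<omega>)"
    have [measurable]: "\<xi> n \<in> borel_measurable (F (u n))" "S n \<in> borel_measurable (F (u n))"
      using \<xi>_F[OF n] S_F[of n] n by auto
    define Z where "Z \<omega> = \<bar>S n \<omega>\<bar> powr (q - 1) * sgn (S n \<omega>)" for \<omega>
    have momZ: "all_moments Z" unfolding Z_def
      using mom_S[of n "q - 1"] q n by (intro all_moments_sgn_mult) auto
    have Z: "Z \<in> borel_measurable (F (u n))" unfolding Z_def by (simp add: sgn_if)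
    have intZ: "integrable P (\<lambda>\<omega>. Z \<omega> * D n \<omega>)"
      using momZ all_moments_D[OF n] by (intro all_moments_integrable all_moments_mult)
    define Y where "Y \<omega> = \<bar>S n \<omega>\<bar> powr (q - 2) * (norm (\<xi> n \<omega>))\<^sup>2" for \<omega>
    have momY: "all_moments Y" unfolding Y_def power2_eq_square
      using mom_S[of n "q - 2"] all_moments_\<xi>[OF n] q n by (intro all_moments_mult) auto
    have Y: "Y \<in> borel_measurable (F (u n))" unfolding Y_def by measurable
    define V where "V \<omega> = norm (\<xi> n \<omega>) powr q" for \<omega>
    have momV: "all_moments V" unfolding V_def
      using all_moments_powr[OF all_moments_\<xi>[OF n], of q] q by simp
    have V: "V \<in> borel_measurable (F (u n))" unfolding V_def by measurable
    have mom_w: "all_moments (\<lambda>\<omega>. ?w \<omega> powr r)" if "0 \<le> r" for r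
      using all_moments_powr[OF all_moments_W[OF n] that] by simp
    have intY: "integrable P (\<lambda>\<omega>. Y \<omega> * ?w \<omega> powr 2)" and intV: "integrable P (\<lambda>\<omega>. V \<omega> * ?w \<omega> powr q)"
      using mom_w[of 2] mom_w[of q] q momY momV by (auto intro!: all_moments_integrable all_moments_mult simp del: powr_numeral)
    have pt: "\<bar>S (Suc n) \<omega>\<bar> powr q \<le> \<bar>S n \<omega>\<bar> powr q + q * (Z \<omega> * D n \<omega>) + C * (Y \<omega> * ?w \<omega> powr 2 + V \<omega> * ?w \<omega> powr q)" for \<omega>
    proof -
      have "\<bar>S (Suc n) \<omega>\<bar> powr q \<le> \<bar>S n \<omega>\<bar> powr q + q * (Z \<omega> * D n \<omega>) + C * (\<bar>S n \<omega>\<bar> powr (q - 2) * (D n \<omega>)\<^sup>2 + \<bar>D n \<omega>\<bar> powr q)"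
        using C(2)[of "S n \<omega>" "D n \<omega>"] by (simp add: S_Suc Z_def mult.assoc)
      also have "\<dots> \<le> \<bar>S n \<omega>\<bar> powr q + q * (Z \<omega> * D n \<omega>) + C * (Y \<omega> * ?w \<omega> powr 2 + V \<omega> * ?w \<omega> powr q)"
      proof (intro add_left_mono mult_left_mono add_mono C(1))
        have "(D n \<omega>)\<^sup>2 \<le> (norm (\<xi> n \<omega>) * ?w \<omega>)\<^sup>2"
          using abs_D_le[of n \<omega>] by (subst power2_abs[symmetric]) (intro power_mono, auto)
        then have "\<bar>S n \<omega>\<bar> powr (q - 2) * (D n \<omega>)\<^sup>2 \<le> \<bar>S n \<omega>\<bar> powr (q - 2) * (norm (\<xi> n \<omega>) * ?w \<omega>)\<^sup>2"
          by (intro mult_left_mono) auto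
        then show "\<bar>S n \<omega>\<bar> powr (q - 2) * (D n \<omega>)\<^sup>2 \<le> Y \<omega> * ?w \<omega> powr 2"
          by (simp add: Y_def power_mult_distrib mult.assoc)
        have "\<bar>D n \<omega>\<bar> powr q \<le> (norm (\<xi> n \<omega>) * ?w \<omega>) powr q"
          using abs_D_le[of n \<omega>] q by (intro powr_mono2) auto
        then show "\<bar>D n \<omega>\<bar> powr q \<le> V \<omega> * ?w \<omega> powr q" by (simp add: V_def powr_mult)
      qed
      finally show ?thesis .
    qed
    have "(\<integral>\<omega>. \<bar>S (Suc n) \<omega>\<bar> powr q \<partial>P) \<le>
        (\<integral>\<omega>. \<bar>S n \<omega>\<bar> powr q + q * (Z \<omega> * D n \<omega>) + C * (Y \<omega> * ?w \<omega> powr 2 + V \<omega> * ?w \<omega> powr q) \<partial>P)"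
      using pt intZ intY intV mom_S[of n q] mom_S[of "Suc n" q] n q
      by (intro integral_mono Bochner_Integration.integrable_add integrable_mult_right)
        (auto intro: all_moments_integrable)
    also have "\<dots> = (\<integral>\<omega>. \<bar>S n \<omega>\<bar> powr q \<partial>P) + q * (\<integral>\<omega>. Z \<omega> * D n \<omega> \<partial>P) +
        C * ((\<integral>\<omega>. Y \<omega> * ?w \<omega> powr 2 \<partial>P) + (\<integral>\<omega>. V \<omega> * ?w \<omega> powr q \<partial>P))"
      using intZ intY intV all_moments_integrable[OF mom_S[of n q]] n q by (simp del: powr_numeral)
    also have "(\<integral>\<omega>. Z \<omega> * D n \<omega> \<partial>P) = 0" using n Z momZ by (intro expectation_mult_D)
    also have "(\<integral>\<omega>. Y \<omega> * ?w \<omega> powr 2 \<partial>P) \<le> A2 * (\<integral>\<omega>. mx L \<omega> powr (q - 2) * v n \<omega> \<partial>P)"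
    proof -
      have "(\<integral>\<omega>. Y \<omega> * ?w \<omega> powr 2 \<partial>P) \<le> A2 * d powr (2 / 2) * (\<integral>\<omega>. Y \<omega> \<partial>P)"
        unfolding d_def by (rule A2(2)[OF un Y momY]) (simp add: Y_def)
      also have "\<dots> = A2 * (\<integral>\<omega>. d * Y \<omega> \<partial>P)" using d by simp
      \<comment> \<open>Only now, with the increment averaged out, may
        \<open>\<bar>S n\<bar>\<close> be replaced by the final maximum, which is not known at time
        \<open>u n\<close>. The factor then no longer depends on \<open>n\<close>, so the variations
        of the cells add up to \<open>Q L\<close>.\<close>
      also have "\<dots> \<le> A2 * (\<integral>\<omega>. mx L \<omega> powr (q - 2) * v n \<omega> \<partial>P)"
      proof (intro mult_left_mono integral_mono A2(1))
        fix \<omega>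
        have "\<bar>S n \<omega>\<bar> powr (q - 2) \<le> mx L \<omega> powr (q - 2)"
          using abs_S_le_mx[of n L \<omega>] n q by (intro powr_mono2) auto
        then have "\<bar>S n \<omega>\<bar> powr (q - 2) * v n \<omega> \<le> mx L \<omega> powr (q - 2) * v n \<omega>"
          using v0[OF n] by (intro mult_right_mono) auto
        then show "d * Y \<omega> \<le> mx L \<omega> powr (q - 2) * v n \<omega>" by (simp add: Y_def v_def d_def mult_ac)
      qed (use momY mom_mv[OF n] in \<open>auto intro: all_moments_integrable\<close>)
      finally show ?thesis .
    qed
    also have "(\<integral>\<omega>. V \<omega> * ?w \<omega> powr q \<partial>P) \<le> Aq * (\<integral>\<omega>. v n \<omega> powr (q / 2) \<partial>P)"
    proof -
      have "(\<integral>\<omega>. V \<omega> * ?w \<omega> powr q \<partial>P) \<le> Aq * d powr (q / 2) * (\<integral>\<omega>. V \<omega> \<partial>P)"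
        unfolding d_def by (rule Aq(2)[OF un V momV]) (simp add: V_def)
      also have "\<dots> = Aq * (\<integral>\<omega>. d powr (q / 2) * V \<omega> \<partial>P)" by simp
      also have "(\<lambda>\<omega>. d powr (q / 2) * V \<omega>) = (\<lambda>\<omega>. v n \<omega> powr (q / 2))"
      proof
        fix \<omega>
        have "((norm (\<xi> n \<omega>))\<^sup>2) powr (q / 2) = norm (\<xi> n \<omega>) powr q"
          by (cases "\<xi> n \<omega> = 0") (auto simp: powr_powr simp flip: powr_numeral)
        then show "d powr (q / 2) * V \<omega> = v n \<omega> powr (q / 2)"
          using d by (simp add: v_def V_def powr_mult flip: d_def)
      qed
      finally show ?thesis .
    qed
    finally show ?thesis using C(1) by (simp add: mult_left_mono)
  qed
  have "(\<integral>\<omega>. \<bar>S n \<omega>\<bar> powr q \<partial>P) \<le>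
      C * (\<Sum>l<n. A2 * (\<integral>\<omega>. mx L \<omega> powr (q - 2) * v l \<omega> \<partial>P) + Aq * (\<integral>\<omega>. v l \<omega> powr (q / 2) \<partial>P))"
    if "n \<le> L" for n
    using that
  proof (induction n)
    case 0 then show ?case using q by (simp add: S_0)
  next
    case (Suc n) then show ?case using step[of n] by (simp add: algebra_simps)
  qed
  from this[of L] have "(\<integral>\<omega>. \<bar>S L \<omega>\<bar> powr q \<partial>P) \<le>
      C * (\<Sum>l<L. A2 * (\<integral>\<omega>. mx L \<omega> powr (q - 2) * v l \<omega> \<partial>P) + Aq * (\<integral>\<omega>. v l \<omega> powr (q / 2) \<partial>P))" by simp
  also have "(\<Sum>l<L. A2 * (\<integral>\<omega>. mx L \<omega> powr (q - 2) * v l \<omega> \<partial>P) + Aq * (\<integral>\<omega>. v l \<omega> powr (q / 2) \<partial>P)) =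
      A2 * (\<Sum>l<L. \<integral>\<omega>. mx L \<omega> powr (q - 2) * v l \<omega> \<partial>P) + Aq * (\<Sum>l<L. \<integral>\<omega>. v l \<omega> powr (q / 2) \<partial>P)"
    by (simp add: sum.distrib sum_distrib_left)
  also have "(\<Sum>l<L. \<integral>\<omega>. mx L \<omega> powr (q - 2) * v l \<omega> \<partial>P) = (\<integral>\<omega>. (\<Sum>l<L. mx L \<omega> powr (q - 2) * v l \<omega>) \<partial>P)"
    using mom_mv by (intro Bochner_Integration.integral_sum[symmetric] all_moments_integrable) auto
  also have "\<dots> = (\<integral>\<omega>. mx L \<omega> powr (q - 2) * Q L \<omega> \<partial>P)"
    by (simp add: Q_def v_def sum_distrib_left)
  also have "(\<Sum>l<L. \<integral>\<omega>. v l \<omega> powr (q / 2) \<partial>P) = (\<integral>\<omega>. (\<Sum>l<L. v l \<omega> powr (q / 2)) \<partial>P)"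
    using mom_vq by (intro Bochner_Integration.integral_sum[symmetric] all_moments_integrable) auto
  also have "\<dots> \<le> (\<integral>\<omega>. Q L \<omega> powr (q / 2) \<partial>P)"
  proof (rule integral_mono)
    show "integrable P (\<lambda>\<omega>. \<Sum>l<L. v l \<omega> powr (q / 2))"
      using mom_vq by (intro all_moments_integrable all_moments_sum) auto
    show "integrable P (\<lambda>\<omega>. Q L \<omega> powr (q / 2))"
      using all_moments_powr_integrable[OF all_moments_Q[of L], of "q / 2"] q Q_nonneg[of L] by simp
    show "(\<Sum>l<L. v l \<omega> powr (q / 2)) \<le> Q L \<omega> powr (q / 2)" for \<omega>
      unfolding Q_def v_def[symmetric] using v0 q by (intro sum_powr_le_powr_sum) auto
  qed
  finally show ?thesis using C(1) A2(1) Aq(1) by (simp add: mult_left_mono)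
qed

lemma integrable_mx: "0 \<le> q \<Longrightarrow> integrable P (\<lambda>\<omega>. mx L \<omega> powr q)"
  using all_moments_powr_integrable[OF all_moments_mx[of L], of q] mx_nonneg by simp

lemma integrable_Q: "0 \<le> q \<Longrightarrow> integrable P (\<lambda>\<omega>. Q L \<omega> powr q)"
  using all_moments_powr_integrable[OF all_moments_Q[of L], of q] Q_nonneg[of L] by simp

end

text \<open>The upper Burkholder-Davis-Gundy inequality with a constant independent of
  \<open>K\<close>. Doob and the Taylor bound estimate the moment \<open>m\<close> of the maximum by
  a mixed term containing \<open>mx L powr (q - 2)\<close>; Young's inequality splits it, and a
  fraction of the finite number \<open>m\<close> is absorbed.\<close>

lemma (in wiener_process) elementary_integral_max_moment:
  fixes q :: real
  assumes q: "2 \<le> q"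
  obtains C where "0 \<le> C" "\<And>u L \<xi> K. elementary_integral P F W u L \<xi> K \<Longrightarrow>
    (\<integral>\<omega>. running_max (\<lambda>n. \<Sum>l<n. \<xi> l \<omega> \<bullet> (W (u (Suc l)) \<omega> - W (u l) \<omega>)) L powr q \<partial>P) \<le>
    C * (\<integral>\<omega>. (\<Sum>l<L. (norm (\<xi> l \<omega>))\<^sup>2 * (u (Suc l) - u l)) powr (q / 2) \<partial>P)"
proof -
  obtain B where B: "0 \<le> B" "\<And>x h. \<bar>x + h\<bar> powr q \<le>
      \<bar>x\<bar> powr q + q * \<bar>x\<bar> powr (q - 1) * sgn x * h + B * (\<bar>x\<bar> powr (q - 2) * h\<^sup>2 + \<bar>h\<bar> powr q)"
    using abs_add_powr_le[OF q] by blast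
  obtain A2 where A2: "0 \<le> A2" "\<And>s t Z. 0 \<le> s \<Longrightarrow> s < t \<Longrightarrow> Z \<in> borel_measurable (F s) \<Longrightarrow> all_moments Z \<Longrightarrow> (\<And>\<omega>. 0 \<le> Z \<omega>) \<Longrightarrow>
      (\<integral>\<omega>. Z \<omega> * norm (W t \<omega> - W s \<omega>) powr 2 \<partial>P) \<le> A2 * (t - s) powr (2 / 2) * (\<integral>\<omega>. Z \<omega> \<partial>P)"
    by (rule expectation_mult_increment_powr[of 2]) (simp, blast)
  obtain Aq where Aq: "0 \<le> Aq" "\<And>s t Z. 0 \<le> s \<Longrightarrow> s < t \<Longrightarrow> Z \<in> borel_measurable (F s) \<Longrightarrow> all_moments Z \<Longrightarrow> (\<And>\<omega>. 0 \<le> Z \<omega>) \<Longrightarrow>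
      (\<integral>\<omega>. Z \<omega> * norm (W t \<omega> - W s \<omega>) powr q \<partial>P) \<le> Aq * (t - s) powr (q / 2) * (\<integral>\<omega>. Z \<omega> \<partial>P)"
    by (rule expectation_mult_increment_powr[of q]) (use q in simp, blast)
  define c where "c = q / (q - 1)"
  define C1 where "C1 = 2 * (c * (2 * c) powr (q - 1))"
  have c: "0 \<le> c" using q by (simp add: c_def)
  have C1: "0 \<le> C1" using c by (simp add: C1_def)
  define G where "G = C1 * B * A2"
  have G: "0 \<le> G" using C1 B A2 by (simp add: G_def)
  \<comment> \<open>The weight in Young's inequality: the coefficient of \<open>m\<close> on the
    right becomes \<open>G * d\<close>, at most 1/2. The \<open>+ 1\<close> covers
    \<open>G = 0\<close>.\<close>
  define d where "d = 1 / (2 * (G + 1))"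
  have d: "0 < d" "G * d \<le> 1 / 2" using G by (auto simp: d_def field_simps)
  define C where "C = 2 * (G * d powr (1 - q / 2) + C1 * B * Aq)"
  show ?thesis
  proof (rule that[of C])
    show "0 \<le> C" using G C1 B Aq by (simp add: C_def)
    fix u L \<xi> K assume "elementary_integral P F W u L \<xi> K"
    then interpret E: elementary_integral P F W u L \<xi> K .
    define m where "m = (\<integral>\<omega>. E.mx L \<omega> powr q \<partial>P)"
    define v where "v = (\<integral>\<omega>. E.Q L \<omega> powr (q / 2) \<partial>P)"
    have "m \<le> C1 * (\<integral>\<omega>. \<bar>E.S L \<omega>\<bar> powr q \<partial>P)"
      unfolding m_def C1_def c_def by (rule E.doob[OF q])
    also have "\<dots> \<le> C1 * (B * (A2 * (\<integral>\<omega>. E.mx L \<omega> powr (q - 2) * E.Q L \<omega> \<partial>P) + Aq * v))"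
      unfolding v_def by (intro mult_left_mono C1 E.moment_S_le[OF q B A2 Aq])
    finally have m: "m \<le> C1 * (B * (A2 * (\<integral>\<omega>. E.mx L \<omega> powr (q - 2) * E.Q L \<omega> \<partial>P) + Aq * v))" .
    have "(\<integral>\<omega>. E.mx L \<omega> powr (q - 2) * E.Q L \<omega> \<partial>P) \<le>
        (\<integral>\<omega>. d * E.mx L \<omega> powr q + d powr (1 - q / 2) * E.Q L \<omega> powr (q / 2) \<partial>P)"
    proof (rule integral_mono)
      show "integrable P (\<lambda>\<omega>. E.mx L \<omega> powr (q - 2) * E.Q L \<omega>)"
        using all_moments_powr[OF E.all_moments_mx[of L], of "q - 2"] q E.mx_nonneg
        by (intro all_moments_integrable all_moments_mult E.all_moments_Q) auto
      show "E.mx L \<omega> powr (q - 2) * E.Q L \<omega> \<le> d * E.mx L \<omega> powr q + d powr (1 - q / 2) * E.Q L \<omega> powr (q / 2)" for \<omega>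
        using q d E.mx_nonneg E.Q_nonneg[of L] by (intro powr_pred2_mult_le) auto
    qed (use E.integrable_mx E.integrable_Q q in auto)
    also have "\<dots> = d * m + d powr (1 - q / 2) * v"
      unfolding m_def v_def using E.integrable_mx E.integrable_Q q by simp
    finally have "C1 * (B * (A2 * (\<integral>\<omega>. E.mx L \<omega> powr (q - 2) * E.Q L \<omega> \<partial>P) + Aq * v)) \<le>
        C1 * (B * (A2 * (d * m + d powr (1 - q / 2) * v) + Aq * v))"
      using C1 B(1) A2(1) by (intro mult_left_mono add_right_mono) auto
    with m have "m \<le> C1 * (B * (A2 * (d * m + d powr (1 - q / 2) * v) + Aq * v))" by linarith
    also have "\<dots> = G * d * m + (G * d powr (1 - q / 2) + C1 * B * Aq) * v"
      by (simp add: G_def algebra_simps)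
    also have "G * d * m \<le> 1 / 2 * m"
      using d(2) by (intro mult_right_mono) (auto simp: m_def)
    finally have "m \<le> C * v" by (simp add: C_def algebra_simps)
    then show "(\<integral>\<omega>. running_max (\<lambda>n. \<Sum>l<n. \<xi> l \<omega> \<bullet> (W (u (Suc l)) \<omega> - W (u l) \<omega>)) L powr q \<partial>P) \<le>
        C * (\<integral>\<omega>. (\<Sum>l<L. (norm (\<xi> l \<omega>))\<^sup>2 * (u (Suc l) - u l)) powr (q / 2) \<partial>P)"
      unfolding m_def v_def E.mx_def E.S_def E.D_def E.Q_def .
  qed
qed

section \<open>Norm bounds and measurability of matrix-vector products\<close>

lemma norm_matrix_vector_mult_le:
  fixes A :: "real ^ 'm ^ 'n"
  shows "norm (A *v x) \<le> norm A * norm x"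
proof -
  have "norm (A *v x) \<le> L2_set (\<lambda>i. norm (A $ i) * norm x) UNIV"
    unfolding norm_vec_def[of "A *v x"]
    by (intro L2_set_mono) (auto simp: matrix_vector_mul_component Cauchy_Schwarz_ineq2)
  also have "\<dots> = norm A * norm x" by (simp add: L2_set_left_distrib norm_vec_def)
  finally show ?thesis .
qed

lemma norm_vector_matrix_mult_le:
  fixes A :: "real ^ 'm ^ 'n"
  shows "norm (x v* A) \<le> norm x * norm A"
proof (cases "x v* A = 0")
  case False
  have "norm (x v* A) * norm (x v* A) = x \<bullet> (A *v (x v* A))"
    unfolding dot_lmul_matrix[symmetric] by (simp add: power2_norm_eq_inner flip: power2_eq_square)
  also have "\<dots> \<le> norm x * (norm A * norm (x v* A))"
    by (rule order_trans[OF norm_cauchy_schwarz]) (intro mult_left_mono norm_matrix_vector_mult_le norm_ge_zero)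
  finally show ?thesis using False by (simp flip: mult.assoc)
qed simp

lemma bounded_bilinear_matrix_vector_mult:
  "bounded_bilinear ((*v) :: real ^ 'm ^ 'n \<Rightarrow> real ^ 'm \<Rightarrow> real ^ 'n)"
  by (intro bounded_bilinear.intro)
    (auto simp: matrix_vector_mult_add_rdistrib matrix_vector_right_distrib matrix_vector_mult_scaleR
      scaleR_matrix_vector_assoc intro!: exI[of _ 1] norm_matrix_vector_mult_le)

lemma bounded_bilinear_vector_matrix_mult:
  "bounded_bilinear ((v*) :: real ^ 'n \<Rightarrow> real ^ 'm ^ 'n \<Rightarrow> real ^ 'm)"
  by (intro bounded_bilinear.intro)
    (auto simp: vector_matrix_mult_def vec_eq_iff sum.distrib sum_distrib_left algebra_simps
      intro!: exI[of _ 1] order_trans[OF norm_vector_matrix_mult_le, unfolded vector_matrix_mult_def])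

lemma borel_measurable_matrix_vector_mult[measurable (raw)]:
  fixes A :: "'a \<Rightarrow> real ^ 'm ^ 'n"
  assumes "A \<in> borel_measurable M" "x \<in> borel_measurable M"
  shows "(\<lambda>\<omega>. A \<omega> *v x \<omega>) \<in> borel_measurable M"
  using assms by (rule borel_measurable_continuous_Pair)
    (intro bounded_bilinear.continuous_on[OF bounded_bilinear_matrix_vector_mult] continuous_intros)

lemma borel_measurable_vector_matrix_mult[measurable (raw)]:
  fixes A :: "'a \<Rightarrow> real ^ 'm ^ 'n"
  assumes "x \<in> borel_measurable M" "A \<in> borel_measurable M"
  shows "(\<lambda>\<omega>. x \<omega> v* A \<omega>) \<in> borel_measurable M"
  using assms by (rule borel_measurable_continuous_Pair)
    (intro bounded_bilinear.continuous_on[OF bounded_bilinear_vector_matrix_mult] continuous_intros)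

section \<open>Truncation\<close>

text \<open>Stopping keeps the integrand adapted because the variation including the next cell is
  already known at the left end of that cell. On the event that the total variation is at most
  \<open>K\<close> the stopped integral is the original one, and elsewhere the left-hand side is
  0.\<close>

lemma (in wiener_process) truncated_max_moment:
  fixes q :: real
  assumes q: "2 \<le> q"
  obtains C where "0 \<le> C" "\<And>u L V K. 0 \<le> K \<Longrightarrow> 0 \<le> u 0 \<Longrightarrow> (\<And>l. l < L \<Longrightarrow> u l < u (Suc l)) \<Longrightarrow>
    (\<And>l. l < L \<Longrightarrow> V l \<in> borel_measurable (F (u l))) \<Longrightarrow>
    (\<integral>\<^sup>+\<omega>. (if (\<Sum>l<L. (norm (V l \<omega>))\<^sup>2 * (u (Suc l) - u l)) \<le> K
      then ennreal (running_max (\<lambda>n. \<Sum>l<n. V l \<omega> \<bullet> (W (u (Suc l)) \<omega> - W (u l) \<omega>)) L powr q) else 0) \<partial>P) \<le>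
    ennreal C * (\<integral>\<^sup>+\<omega>. ennreal (min (\<Sum>l<L. (norm (V l \<omega>))\<^sup>2 * (u (Suc l) - u l)) K powr (q / 2)) \<partial>P)"
proof -
  obtain C where C: "0 \<le> C" "\<And>u L \<xi> K. elementary_integral P F W u L \<xi> K \<Longrightarrow>
    (\<integral>\<omega>. running_max (\<lambda>n. \<Sum>l<n. \<xi> l \<omega> \<bullet> (W (u (Suc l)) \<omega> - W (u l) \<omega>)) L powr q \<partial>P) \<le>
    C * (\<integral>\<omega>. (\<Sum>l<L. (norm (\<xi> l \<omega>))\<^sup>2 * (u (Suc l) - u l)) powr (q / 2) \<partial>P)"
    using elementary_integral_max_moment[OF q] by blast
  show ?thesis
  proof (rule that[OF C(1)])
    fix u :: "nat \<Rightarrow> real" and L :: nat and V :: "nat \<Rightarrow> 'a \<Rightarrow> real ^ 'm" and K :: real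
    assume K: "0 \<le> K" and u0: "0 \<le> u 0" and u: "\<And>l. l < L \<Longrightarrow> u l < u (Suc l)"
      and V: "\<And>l. l < L \<Longrightarrow> V l \<in> borel_measurable (F (u l))"
    define v where "v l \<omega> = (norm (V l \<omega>))\<^sup>2 * (u (Suc l) - u l)" for l \<omega>
    define Q where "Q n \<omega> = (\<Sum>l<n. v l \<omega>)" for n \<omega>
    \<comment> \<open>\<open>Suc l\<close> and not \<open>l\<close>: the test includes the cell
      about to be used, so the variation of \<open>\<xi>\<close> never overshoots \<open>K\<close>,
      not even by one cell.\<close>
    define \<xi> where "\<xi> l \<omega> = (if Q (Suc l) \<omega> \<le> K then V l \<omega> else 0)" for l \<omega>
    have v0: "0 \<le> v l \<omega>" if "l < L" for l \<omega> using u[OF that] by (simp add: v_def)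
    have u_mono: "u l \<le> u k" if "l \<le> k" "k \<le> L" for l k
      using that
    proof (induction k)
      case (Suc k) then show ?case using u[of k] by (auto simp: le_Suc_eq)
    qed simp
    have un: "0 \<le> u l" if "l \<le> L" for l using u_mono[of 0 l] that u0 by simp
    have trunc: "(\<Sum>l<n. (norm (\<xi> l \<omega>))\<^sup>2 * (u (Suc l) - u l)) \<le> min (Q n \<omega>) K" if "n \<le> L" for n \<omega>
      using that
    proof (induction n)
      case 0 then show ?case using K by (simp add: Q_def)
    next
      case (Suc n)
      then show ?case using v0[of n \<omega>] by (auto simp: \<xi>_def Q_def v_def)
    qed
    interpret E: elementary_integral P F W u L \<xi> K
    proof unfold_locales
      fix l assume l: "l < L"
      have "v i \<in> borel_measurable (F (u l))" if "i \<le> l" for i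
      proof -
        have [measurable]: "V i \<in> borel_measurable (F (u l))"
          using F_measurable_mono[OF V[of i] un[of i] u_mono[of i l]] that l by auto
        show ?thesis unfolding v_def by measurable
      qed
      then have [measurable]: "Q (Suc l) \<in> borel_measurable (F (u l))"
        unfolding Q_def by (intro borel_measurable_sum) auto
      have [measurable]: "V l \<in> borel_measurable (F (u l))" by (rule V[OF l])
      show "\<xi> l \<in> borel_measurable (F (u l))" unfolding \<xi>_def by measurable
    qed (use u0 u trunc[of L] in auto)
    have "Q n \<omega> \<le> Q L \<omega>" if "n \<le> L" for n \<omega>
      unfolding Q_def using that v0 by (intro sum_mono2) auto
    then have eq: "\<xi> l \<omega> = V l \<omega>" if "Q L \<omega> \<le> K" "l < L" for l \<omega>
      using that by (auto simp: \<xi>_def intro: order_trans Suc_leI)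
    have "(\<integral>\<^sup>+\<omega>. (if Q L \<omega> \<le> K
      then ennreal (running_max (\<lambda>n. \<Sum>l<n. V l \<omega> \<bullet> (W (u (Suc l)) \<omega> - W (u l) \<omega>)) L powr q) else 0) \<partial>P) \<le>
      (\<integral>\<^sup>+\<omega>. ennreal (E.mx L \<omega> powr q) \<partial>P)"
    proof (rule nn_integral_mono)
      fix \<omega>
      have "running_max (\<lambda>n. \<Sum>l<n. V l \<omega> \<bullet> (W (u (Suc l)) \<omega> - W (u l) \<omega>)) L = E.mx L \<omega>" if "Q L \<omega> \<le> K"
        unfolding E.mx_def E.S_def E.D_def
        using eq[OF that] by (intro running_max_cong sum.cong) auto
      then show "(if Q L \<omega> \<le> K
        then ennreal (running_max (\<lambda>n. \<Sum>l<n. V l \<omega> \<bullet> (W (u (Suc l)) \<omega> - W (u l) \<omega>)) L powr q) else 0) \<le> ennreal (E.mx L \<omega> powr q)"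
        by auto
    qed
    also have "\<dots> = ennreal (\<integral>\<omega>. E.mx L \<omega> powr q \<partial>P)"
      using E.integrable_mx q by (intro nn_integral_eq_integral) auto
    also have "\<dots> \<le> ennreal (C * (\<integral>\<omega>. E.Q L \<omega> powr (q / 2) \<partial>P))"
      using C(2)[OF E.elementary_integral_axioms]
      unfolding E.mx_def E.S_def E.D_def E.Q_def by (rule ennreal_leI)
    also have "\<dots> = ennreal C * (\<integral>\<^sup>+\<omega>. ennreal (E.Q L \<omega> powr (q / 2)) \<partial>P)"
      using E.integrable_Q q C(1) by (subst nn_integral_eq_integral) (auto simp: ennreal_mult)
    also have "\<dots> \<le> ennreal C * (\<integral>\<^sup>+\<omega>. ennreal (min (Q L \<omega>) K powr (q / 2)) \<partial>P)"
    proof (intro mult_left_mono nn_integral_mono ennreal_leI powr_mono2)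
      show "E.Q L \<omega> \<le> min (Q L \<omega>) K" for \<omega> using trunc[of L] by (simp add: E.Q_def)
    qed (use q E.Q_nonneg in auto)
    finally show "(\<integral>\<^sup>+\<omega>. (if (\<Sum>l<L. (norm (V l \<omega>))\<^sup>2 * (u (Suc l) - u l)) \<le> K
      then ennreal (running_max (\<lambda>n. \<Sum>l<n. V l \<omega> \<bullet> (W (u (Suc l)) \<omega> - W (u l) \<omega>)) L powr q) else 0) \<partial>P) \<le>
      ennreal C * (\<integral>\<^sup>+\<omega>. ennreal (min (\<Sum>l<L. (norm (V l \<omega>))\<^sup>2 * (u (Suc l) - u l)) K powr (q / 2)) \<partial>P)"
      unfolding Q_def v_def .
  qed
qed

text \<open>Continuity of the integral in probability, with no moment assumption on
  \<open>V\<close>. Where the variation exceeds 1 its truncation equals 1 and already dominates the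
  left-hand side; elsewhere the truncated second moment with \<open>K = 1\<close> applies. The two
  cases account for \<open>1 + C\<close>.\<close>

lemma (in wiener_process) elementary_integral_ky_fan:
  obtains C where "0 \<le> C" "\<And>u L V. 0 \<le> u 0 \<Longrightarrow> (\<And>l. l < L \<Longrightarrow> u l < u (Suc l)) \<Longrightarrow>
    (\<And>l. l < L \<Longrightarrow> V l \<in> borel_measurable (F (u l))) \<Longrightarrow>
    (\<integral>\<^sup>+\<omega>. min 1 (ennreal ((\<Sum>l<L. V l \<omega> \<bullet> (W (u (Suc l)) \<omega> - W (u l) \<omega>))\<^sup>2)) \<partial>P) \<le>
    ennreal C * (\<integral>\<^sup>+\<omega>. min 1 (ennreal (\<Sum>l<L. (norm (V l \<omega>))\<^sup>2 * (u (Suc l) - u l))) \<partial>P)"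
proof -
  obtain C where C: "0 \<le> C" "\<And>u L V K. 0 \<le> K \<Longrightarrow> 0 \<le> u 0 \<Longrightarrow> (\<And>l. l < L \<Longrightarrow> u l < u (Suc l)) \<Longrightarrow>
    (\<And>l. l < L \<Longrightarrow> V l \<in> borel_measurable (F (u l))) \<Longrightarrow>
    (\<integral>\<^sup>+\<omega>. (if (\<Sum>l<L. (norm (V l \<omega>))\<^sup>2 * (u (Suc l) - u l)) \<le> K
      then ennreal (running_max (\<lambda>n. \<Sum>l<n. V l \<omega> \<bullet> (W (u (Suc l)) \<omega> - W (u l) \<omega>)) L powr 2) else 0) \<partial>P) \<le>
    ennreal C * (\<integral>\<^sup>+\<omega>. ennreal (min (\<Sum>l<L. (norm (V l \<omega>))\<^sup>2 * (u (Suc l) - u l)) K powr (2 / 2)) \<partial>P)"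
    by (rule truncated_max_moment[of 2]) (simp, blast)
  show ?thesis
  proof (rule that[of "1 + C"])
    fix u :: "nat \<Rightarrow> real" and L :: nat and V :: "nat \<Rightarrow> 'a \<Rightarrow> real ^ 'm"
    assume u0: "0 \<le> u 0" and u: "\<And>l. l < L \<Longrightarrow> u l < u (Suc l)"
      and V: "\<And>l. l < L \<Longrightarrow> V l \<in> borel_measurable (F (u l))"
    define Q where "Q \<omega> = (\<Sum>l<L. (norm (V l \<omega>))\<^sup>2 * (u (Suc l) - u l))" for \<omega>
    define S where "S n \<omega> = (\<Sum>l<n. V l \<omega> \<bullet> (W (u (Suc l)) \<omega> - W (u l) \<omega>))" for n \<omega>
    have Q0: "0 \<le> Q \<omega>" for \<omega> unfolding Q_def using less_imp_le[OF u] by (intro sum_nonneg) auto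
    have u_nonneg: "0 \<le> u l" if "l \<le> L" for l
      using that
    proof (induction l)
      case (Suc l) then show ?case using u[of l] by simp
    qed (simp add: u0)
    have VP: "V l \<in> borel_measurable P" if "l < L" for l
      using F_measurable_P[OF V[OF that] u_nonneg] that by simp
    have WP: "W (u l) \<in> borel_measurable P" if "l \<le> L" for l
      using W_measurable_P[OF u_nonneg[OF that]] .
    have [measurable]: "Q \<in> borel_measurable P" unfolding Q_def using VP by measurable
    have "S n \<in> borel_measurable P" if "n \<le> L" for n
      unfolding S_def using that VP WP by (intro borel_measurable_sum borel_measurable_inner borel_measurable_diff) auto
    then have [measurable]: "(\<lambda>\<omega>. running_max (\<lambda>n. S n \<omega>) L) \<in> borel_measurable P"
      by (intro running_max_measurable) auto
    let ?A = "\<lambda>\<omega>. if Q \<omega> \<le> 1 then ennreal (running_max (\<lambda>n. S n \<omega>) L powr 2) else 0"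
    have "(\<integral>\<^sup>+\<omega>. min 1 (ennreal ((S L \<omega>)\<^sup>2)) \<partial>P) \<le> (\<integral>\<^sup>+\<omega>. min 1 (ennreal (Q \<omega>)) + ?A \<omega> \<partial>P)"
    proof (rule nn_integral_mono)
      fix \<omega>
      show "min 1 (ennreal ((S L \<omega>)\<^sup>2)) \<le> min 1 (ennreal (Q \<omega>)) + ?A \<omega>"
      proof (cases "Q \<omega> \<le> 1")
        case True
        have "(S L \<omega>)\<^sup>2 \<le> running_max (\<lambda>n. S n \<omega>) L powr 2"
          using abs_le_running_max[of L L "\<lambda>n. S n \<omega>"] running_max_nonneg[of "\<lambda>n. S n \<omega>" L]
          by (simp add: abs_le_square_iff[symmetric])
        then have "min 1 (ennreal ((S L \<omega>)\<^sup>2)) \<le> ?A \<omega>" using True by (auto intro: min.coboundedI2 ennreal_leI)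
        then show ?thesis by (rule order_trans) simp
      next
        case False
        then have "min 1 (ennreal (Q \<omega>)) = 1" by (simp add: min_def)
        then show ?thesis using False by simp
      qed
    qed
    also have "\<dots> = (\<integral>\<^sup>+\<omega>. min 1 (ennreal (Q \<omega>)) \<partial>P) + (\<integral>\<^sup>+\<omega>. ?A \<omega> \<partial>P)"
      by (rule nn_integral_add) measurable
    also have "(\<integral>\<^sup>+\<omega>. ?A \<omega> \<partial>P) \<le> ennreal C * (\<integral>\<^sup>+\<omega>. ennreal (min (Q \<omega>) 1 powr (2 / 2)) \<partial>P)"
      unfolding Q_def S_def by (rule C(2)) (use u0 u V in auto)
    also have "(\<lambda>\<omega>. ennreal (min (Q \<omega>) 1 powr (2 / 2))) = (\<lambda>\<omega>. min 1 (ennreal (Q \<omega>)))"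
      using Q0 by (auto simp: min_def)
    also have "(\<integral>\<^sup>+\<omega>. min 1 (ennreal (Q \<omega>)) \<partial>P) + ennreal C * (\<integral>\<^sup>+\<omega>. min 1 (ennreal (Q \<omega>)) \<partial>P) =
        ennreal (1 + C) * (\<integral>\<^sup>+\<omega>. min 1 (ennreal (Q \<omega>)) \<partial>P)"
      using C(1) by (simp add: ennreal_plus algebra_simps)
    finally show "(\<integral>\<^sup>+\<omega>. min 1 (ennreal ((\<Sum>l<L. V l \<omega> \<bullet> (W (u (Suc l)) \<omega> - W (u l) \<omega>))\<^sup>2)) \<partial>P) \<le>
    ennreal (1 + C) * (\<integral>\<^sup>+\<omega>. min 1 (ennreal (\<Sum>l<L. (norm (V l \<omega>))\<^sup>2 * (u (Suc l) - u l))) \<partial>P)"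
      unfolding Q_def S_def by (simp add: add_left_mono)
  qed (use C(1) in simp)
qed

section \<open>Refining partitions\<close>

definition step :: "nat \<Rightarrow> (nat \<Rightarrow> real) \<Rightarrow> (nat \<Rightarrow> 'b::real_vector) \<Rightarrow> real \<Rightarrow> 'b" where
  "step N s x r = (\<Sum>i<N. indicat_real {s i<..s (Suc i)} r *\<^sub>R x i)"

lemma simple_process_eq_step: "simple_process N s \<xi> r \<omega> = step N s (\<lambda>i. \<xi> i \<omega>) r"
  by (simp add: simple_process_def step_def)

text \<open>The integral of a simple process up to an arbitrary time \<open>t\<close>, along a
  single path \<open>w\<close>. Capping the partition points at \<open>t\<close> lets one simple
  process on the whole interval be integrated up to every grid time.\<close>

definition stopped_integral ::
    "nat \<Rightarrow> (nat \<Rightarrow> real) \<Rightarrow> (nat \<Rightarrow> real ^ 'm ^ 'n) \<Rightarrow> (real \<Rightarrow> real ^ 'm) \<Rightarrow> real \<Rightarrow> real ^ 'n" where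
  "stopped_integral N s x w t = (\<Sum>i<N. x i *v (w (min (s (Suc i)) t) - w (min (s i) t)))"

lemma stopped_integral_eq_simple_integral:
  assumes "mono_on {..N} s" "s N \<le> t"
  shows "stopped_integral N s (\<lambda>i. \<xi> i \<omega>) (\<lambda>r. W r \<omega>) t = simple_integral W N s \<xi> \<omega>"
proof -
  have "s i \<le> t" if "i \<le> N" for i
    using mono_onD[OF assms(1), of i N] that assms(2) by auto
  then show ?thesis
    unfolding stopped_integral_def simple_integral_def by (intro sum.cong) (auto simp: min_def)
qed

locale time_grid =
  fixes u :: "nat \<Rightarrow> real" and L :: nat
  assumes u_less: "l < k \<Longrightarrow> k \<le> L \<Longrightarrow> u l < u k"
begin

lemma u_less_iff: "l \<le> L \<Longrightarrow> k \<le> L \<Longrightarrow> u l < u k \<longleftrightarrow> l < k"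
  using u_less[of l k] u_less[of k l] by (cases l k rule: linorder_cases) auto

lemma u_le_iff: "l \<le> L \<Longrightarrow> k \<le> L \<Longrightarrow> u l \<le> u k \<longleftrightarrow> l \<le> k"
  using u_less_iff[of k l] by (auto simp: not_less[symmetric])

text \<open>All jump times of the step function are grid points, so none lies inside a cell. The
  right endpoint represents the cell because the intervals of \<open>step\<close> are open on the
  left.\<close>

lemma step_const:
  assumes s: "s ` {..N} \<subseteq> u ` {..L}" and l: "l < L" and r: "u l < r" "r \<le> u (Suc l)"
  shows "step N s x r = step N s x (u (Suc l))"
proof -
  have "s i < r \<longleftrightarrow> s i < u (Suc l)" "r \<le> s i \<longleftrightarrow> u (Suc l) \<le> s i" if i: "i \<le> N" for i
  proof -
    obtain k where k: "k \<le> L" "s i = u k" using s i by (auto simp: image_subset_iff)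
    have "u k < u (Suc l) \<longleftrightarrow> u k \<le> u l" using k l by (simp add: u_less_iff u_le_iff less_Suc_eq_le)
    then show "s i < r \<longleftrightarrow> s i < u (Suc l)" "r \<le> s i \<longleftrightarrow> u (Suc l) \<le> s i"
      using r k by auto
  qed
  then show ?thesis unfolding step_def by (intro sum.cong) (auto simp: indicator_def)
qed

lemma grid_telescope:
  fixes w :: "real \<Rightarrow> real ^ 'm"
  assumes "b \<le> L" "a \<le> L"
  shows "(\<Sum>l<a. indicat_real {..u b} (u (Suc l)) *\<^sub>R (w (u (Suc l)) - w (u l))) = w (min (u b) (u a)) - w (min (u b) (u 0))"
  using assms(2)
proof (induction a)
  case (Suc a)
  then have a: "Suc a \<le> L" "a \<le> L" by auto
  show ?case
  proof (cases "Suc a \<le> b")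
    case True
    then have "u (Suc a) \<le> u b" "u a \<le> u b" using a assms(1) by (auto simp: u_le_iff)
    then show ?thesis using Suc.IH a by (simp add: min_def)
  next
    case False
    then have "\<not> u (Suc a) \<le> u b" "u b \<le> u a" using a assms(1) by (auto simp: u_le_iff)
    then show ?thesis using Suc.IH a by (simp add: min_def)
  qed
qed simp

text \<open>The integral does not change when the partition is refined. The indicator of
  \<open>{s i<..s (Suc i)}\<close> is the difference of two indicators of initial segments, and each
  of those telescopes along the grid.\<close>

lemma sum_step_eq_stopped_integral:
  fixes w :: "real \<Rightarrow> real ^ 'm" and x :: "nat \<Rightarrow> real ^ 'm ^ 'n"
  assumes s: "s ` {..N} \<subseteq> u ` {..L}" "mono_on {..N} s" and a: "a \<le> L"
  shows "(\<Sum>l<a. step N s x (u (Suc l)) *v (w (u (Suc l)) - w (u l))) = stopped_integral N s x w (u a)"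
proof -
  have ind: "(\<Sum>l<a. indicat_real {..s i} (u (Suc l)) *\<^sub>R (w (u (Suc l)) - w (u l))) = w (min (s i) (u a)) - w (u 0)"
    if i: "i \<le> N" for i
  proof -
    obtain k where k: "k \<le> L" "s i = u k" using s i by (auto simp: image_subset_iff)
    have "u 0 \<le> u k" using k by (simp add: u_le_iff)
    then show ?thesis using grid_telescope[OF k(1) a, of w] k by (simp add: min_def)
  qed
  have split: "indicat_real {s i<..s (Suc i)} r = indicat_real {..s (Suc i)} r - indicat_real {..s i} r" if "i < N" for i r
    using mono_onD[OF s(2), of i "Suc i"] that by (auto simp: indicator_def)
  have "(\<Sum>l<a. step N s x (u (Suc l)) *v (w (u (Suc l)) - w (u l))) =
    (\<Sum>l<a. \<Sum>i<N. x i *v (indicat_real {s i<..s (Suc i)} (u (Suc l)) *\<^sub>R (w (u (Suc l)) - w (u l))))"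
    unfolding step_def
    by (simp add: bounded_bilinear.sum_left[OF bounded_bilinear_matrix_vector_mult]
      bounded_bilinear.scaleR_left[OF bounded_bilinear_matrix_vector_mult]
      bounded_bilinear.scaleR_right[OF bounded_bilinear_matrix_vector_mult])
  also have "\<dots> = (\<Sum>i<N. x i *v (\<Sum>l<a. indicat_real {s i<..s (Suc i)} (u (Suc l)) *\<^sub>R (w (u (Suc l)) - w (u l))))"
    by (subst sum.swap) (intro sum.cong refl bounded_bilinear.sum_right[OF bounded_bilinear_matrix_vector_mult, symmetric])
  also have "\<dots> = (\<Sum>i<N. x i *v ((w (min (s (Suc i)) (u a)) - w (u 0)) - (w (min (s i) (u a)) - w (u 0))))"
    using ind by (intro sum.cong refl arg_cong2[where f = "(*v)"])
      (simp add: split scaleR_diff_left sum_subtractf del: diff_diff_eq2)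
  finally show ?thesis by (simp add: stopped_integral_def)
qed

text \<open>The left-hand side is the integral of a step function lying below \<open>g\<close>; this
  comparison asks nothing of \<open>g\<close> but the pointwise bound on the cells.\<close>

lemma grid_sum_le_nn_integral:
  fixes c :: "nat \<Rightarrow> real" and g :: "real \<Rightarrow> ennreal"
  assumes ab: "a \<le> b" "b \<le> L" and c: "\<And>l. 0 \<le> c l"
    and g: "\<And>l r. a \<le> l \<Longrightarrow> l < b \<Longrightarrow> u l < r \<Longrightarrow> r \<le> u (Suc l) \<Longrightarrow> ennreal (c l) \<le> g r"
  shows "ennreal (\<Sum>l\<in>{a..<b}. c l * (u (Suc l) - u l)) \<le> (\<integral>\<^sup>+r\<in>{u a..u b}. g r \<partial>lborel)"
proof -
  have pt: "(\<Sum>l\<in>{a..<k}. ennreal (c l) * indicator {u l<..u (Suc l)} r) \<le> g r * indicator {u a..u k} r"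
    if "a \<le> k" "k \<le> b" for k r
    using that
  proof (induction k rule: dec_induct)
    case (step k)
    then have k: "k < b" "Suc k \<le> L" "k \<le> L" using ab by auto
    have le: "u a \<le> u k" "u k < u (Suc k)" using step k by (auto simp: u_le_iff u_less_iff)
    show ?case
    proof (cases "u k < r \<and> r \<le> u (Suc k)")
      case True
      then have "(\<Sum>l\<in>{a..<k}. ennreal (c l) * indicator {u l<..u (Suc l)} r) \<le> 0"
        using step.IH k by simp
      then show ?thesis using step True g[of k r] k le by simp
    next
      case False
      have "(\<Sum>l\<in>{a..<Suc k}. ennreal (c l) * indicator {u l<..u (Suc l)} r) \<le> g r * indicator {u a..u k} r"
        using step False by simp
      also have "\<dots> \<le> g r * indicator {u a..u (Suc k)} r"
        using le by (auto simp: indicator_def)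
      finally show ?thesis .
    qed
  qed simp
  have "ennreal (\<Sum>l\<in>{a..<b}. c l * (u (Suc l) - u l)) = (\<Sum>l\<in>{a..<b}. ennreal (c l) * ennreal (u (Suc l) - u l))"
    using c ab u_less by (subst sum_ennreal[symmetric]) (auto simp: ennreal_mult less_imp_le)
  also have "\<dots> = (\<Sum>l\<in>{a..<b}. \<integral>\<^sup>+r. ennreal (c l) * indicator {u l<..u (Suc l)} r \<partial>lborel)"
    using ab u_less by (intro sum.cong) (auto simp: nn_integral_cmult_indicator less_imp_le)
  also have "\<dots> = (\<integral>\<^sup>+r. (\<Sum>l\<in>{a..<b}. ennreal (c l) * indicator {u l<..u (Suc l)} r) \<partial>lborel)"
    by (rule nn_integral_sum[symmetric]) simp
  also have "\<dots> \<le> (\<integral>\<^sup>+r\<in>{u a..u b}. g r \<partial>lborel)"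
    using pt ab by (intro nn_integral_mono) auto
  finally show ?thesis .
qed

end

lemma time_grid_exists:
  fixes A :: "real set"
  assumes "finite A" "A \<noteq> {}"
  obtains u L where "time_grid u L" "u ` {..L} = A"
proof -
  define xs where "xs = sorted_list_of_set A"
  have xs: "sorted_wrt (<) xs" "set xs = A" "xs \<noteq> []" using assms by (auto simp: xs_def)
  show ?thesis
  proof (rule that[of "(!) xs" "length xs - 1"])
    show "time_grid ((!) xs) (length xs - 1)"
      using xs by unfold_locales (auto simp: sorted_wrt_iff_nth_less)
    have "{..length xs - 1} = {..<length xs}" using xs by (cases xs) auto
    then show "(!) xs ` {..length xs - 1} = A" using xs by (auto simp: set_conv_nth)
  qed
qed

text \<open>The value is read off at the right end of a cell but known at its left end: a summand
  that does not vanish has \<open>s i < u (Suc l)\<close>, and as \<open>s i\<close> is a grid point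
  this means \<open>s i \<le> u l\<close>.\<close>

lemma (in wiener_process) step_F:
  assumes G: "time_grid u L" "0 \<le> u 0" and s: "s ` {..N} \<subseteq> u ` {..L}" and l: "l < L"
    and \<xi>: "\<And>i. i < N \<Longrightarrow> \<xi> i \<in> borel_measurable (F (s i))"
  shows "(\<lambda>\<omega>. step N s (\<lambda>i. \<xi> i \<omega> :: 'c::euclidean_space) (u (Suc l))) \<in> borel_measurable (F (u l))"
  unfolding step_def
proof (intro borel_measurable_sum)
  interpret time_grid u L by fact
  fix i assume "i \<in> {..<N}"
  then have i: "i < N" "i \<le> N" by auto
  obtain k where k: "k \<le> L" "s i = u k" using s i(2) by (auto simp: image_subset_iff)
  have "0 \<le> u k" using G(2) u_le_iff[of 0 k] k by simp
  show "(\<lambda>\<omega>. indicat_real {s i<..s (Suc i)} (u (Suc l)) *\<^sub>R \<xi> i \<omega>) \<in> borel_measurable (F (u l))"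
  proof (cases "k \<le> l")
    case True
    then have "s i \<le> u l" using k l by (simp add: u_le_iff)
    then have [measurable]: "\<xi> i \<in> borel_measurable (F (u l))"
      using F_measurable_mono[OF \<xi>[OF i(1)]] k \<open>0 \<le> u k\<close> by simp
    show ?thesis by measurable
  next
    case False
    then have "u (Suc l) \<le> s i" using k l by (simp add: u_le_iff)
    then show ?thesis by simp
  qed
qed

section \<open>Convergence in probability\<close>

lemma running_max_le: "(\<And>k. k \<le> n \<Longrightarrow> \<bar>f k\<bar> \<le> B) \<Longrightarrow> running_max f n \<le> B"
  by (induction n) auto

lemma tendsto_running_max:
  "(\<And>n. n \<le> M \<Longrightarrow> ((\<lambda>k. f k n) \<longlongrightarrow> g n) Fl) \<Longrightarrow> ((\<lambda>k. running_max (f k) M) \<longlongrightarrow> running_max g M) Fl"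
  by (induction M) (auto intro!: tendsto_max tendsto_rabs)

lemma norm_add_square_le:
  fixes x y :: "'b::real_normed_vector"
  shows "(norm (x + y))\<^sup>2 \<le> 2 * (norm x)\<^sup>2 + 2 * (norm y)\<^sup>2"
proof -
  have "(norm (x + y))\<^sup>2 \<le> (norm x + norm y)\<^sup>2" by (intro power_mono norm_triangle_ineq) auto
  also have "\<dots> \<le> 2 * (norm x)\<^sup>2 + 2 * (norm y)\<^sup>2"
    using sum_squares_bound[of "norm x" "norm y"] by (simp add: power2_sum)
  finally show ?thesis .
qed

text \<open>Measurability is demanded on \<open>A\<close> only, since a progressively measurable
  integrand is controlled just on its time interval; both functions are extended by zero.\<close>

lemma set_nn_integral_square_add_le:
  fixes f g :: "real \<Rightarrow> 'b::{real_normed_vector, second_countable_topology}"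
  assumes A: "A \<in> sets borel"
    and f: "f \<in> borel_measurable (restrict_space borel A)" and g: "g \<in> borel_measurable (restrict_space borel A)"
  shows "(\<integral>\<^sup>+r\<in>A. ennreal ((norm (f r + g r))\<^sup>2) \<partial>lborel) \<le>
    2 * (\<integral>\<^sup>+r\<in>A. ennreal ((norm (f r))\<^sup>2) \<partial>lborel) + 2 * (\<integral>\<^sup>+r\<in>A. ennreal ((norm (g r))\<^sup>2) \<partial>lborel)"
proof -
  define f' where "f' r = indicat_real A r *\<^sub>R f r" for r
  define g' where "g' r = indicat_real A r *\<^sub>R g r" for r
  have [measurable]: "f' \<in> borel_measurable borel" "g' \<in> borel_measurable borel"
    using f g A unfolding f'_def g'_def by (simp_all add: borel_measurable_restrict_space_iff)
  have "(\<integral>\<^sup>+r\<in>A. ennreal ((norm (f r + g r))\<^sup>2) \<partial>lborel) \<le>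
      (\<integral>\<^sup>+r. 2 * ennreal ((norm (f' r))\<^sup>2) + 2 * ennreal ((norm (g' r))\<^sup>2) \<partial>lborel)"
  proof (rule nn_integral_mono)
    fix r
    have "ennreal ((norm (f r + g r))\<^sup>2) \<le> ennreal (2 * (norm (f r))\<^sup>2 + 2 * (norm (g r))\<^sup>2)"
      by (intro ennreal_leI norm_add_square_le)
    also have "\<dots> = 2 * ennreal ((norm (f r))\<^sup>2) + 2 * ennreal ((norm (g r))\<^sup>2)"
      by (simp add: ennreal_plus ennreal_mult)
    finally show "ennreal ((norm (f r + g r))\<^sup>2) * indicator A r \<le> 2 * ennreal ((norm (f' r))\<^sup>2) + 2 * ennreal ((norm (g' r))\<^sup>2)"
      by (auto simp: f'_def g'_def indicator_def)
  qed
  also have "\<dots> = 2 * (\<integral>\<^sup>+r. ennreal ((norm (f' r))\<^sup>2) \<partial>lborel) + 2 * (\<integral>\<^sup>+r. ennreal ((norm (g' r))\<^sup>2) \<partial>lborel)"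
    by (simp add: nn_integral_add nn_integral_cmult)
  also have "(\<integral>\<^sup>+r. ennreal ((norm (f' r))\<^sup>2) \<partial>lborel) = (\<integral>\<^sup>+r\<in>A. ennreal ((norm (f r))\<^sup>2) \<partial>lborel)"
    by (intro nn_integral_cong) (auto simp: f'_def indicator_def)
  also have "(\<integral>\<^sup>+r. ennreal ((norm (g' r))\<^sup>2) \<partial>lborel) = (\<integral>\<^sup>+r\<in>A. ennreal ((norm (g r))\<^sup>2) \<partial>lborel)"
    by (intro nn_integral_cong) (auto simp: g'_def indicator_def)
  finally show ?thesis .
qed

lemma min_one_add_le: "min 1 (a + b) \<le> min 1 a + min 1 (b :: ennreal)"
  by (auto simp: min_def intro: add_increasing add_increasing2)

lemma min_one_mult_2_le: "min 1 (2 * a) \<le> 2 * min 1 (a :: ennreal)"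
  using min_one_add_le[of a a] by (simp add: mult_2)

lemma min_one_sum_le: "min 1 (\<Sum>i\<in>I. f i) \<le> (\<Sum>i\<in>I. min 1 (f i :: ennreal))"
  by (induction I rule: infinite_finite_induct) (auto intro: order_trans[OF min_one_add_le] add_left_mono)

lemma tendsto_zero_of_min_one:
  fixes f :: "nat \<Rightarrow> ennreal"
  assumes "(\<lambda>k. min 1 (f k)) \<longlonglongrightarrow> 0"
  shows "f \<longlonglongrightarrow> 0"
proof (rule order_tendstoI)
  fix a :: ennreal assume "0 < a"
  then have "0 < min 1 a" by simp
  from order_tendstoD(2)[OF assms this] show "\<forall>\<^sub>F k in sequentially. f k < a"
    by (rule eventually_mono) (auto simp: min_def split: if_splits)
qed simp

text \<open>Convergence in probability is handled through the expectation of \<open>min 1 Z\<close>: it is subadditive in \<open>Z\<close>, and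
  the truncated maximal inequality with \<open>K = 1\<close> bounds it for elementary integrals.\<close>

lemma (in prob_space) tends_to_zero_in_prob_ky_fan:
  assumes "tends_to_zero_in_prob M Z"
  shows "(\<lambda>k. \<integral>\<^sup>+\<omega>. min 1 (Z k \<omega>) \<partial>M) \<longlonglongrightarrow> 0"
proof (rule order_tendstoI)
  have [measurable]: "Z k \<in> borel_measurable M" for k using assms by (simp add: tends_to_zero_in_prob_def)
  fix a :: ennreal assume a: "0 < a"
  obtain e :: real where e: "0 < e" "ennreal (2 * e) \<le> a"
  proof (cases a)
    case (real r) then show ?thesis using a by (intro that[of "r / 2"]) auto
  next
    case top then show ?thesis by (intro that[of 1]) auto
  qed
  define p where "p k = measure M {\<omega> \<in> space M. ennreal e < Z k \<omega>}" for k
  have "p \<longlonglongrightarrow> 0" using assms e(1) by (simp add: tends_to_zero_in_prob_def p_def[abs_def])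
  then have "\<forall>\<^sub>F k in sequentially. p k < e" using e(1) by (rule order_tendstoD)
  then show "\<forall>\<^sub>F k in sequentially. (\<integral>\<^sup>+\<omega>. min 1 (Z k \<omega>) \<partial>M) < a"
  proof (rule eventually_mono)
    fix k assume k: "p k < e"
    have "(\<integral>\<^sup>+\<omega>. min 1 (Z k \<omega>) \<partial>M) \<le> (\<integral>\<^sup>+\<omega>. ennreal e + indicator {\<omega> \<in> space M. ennreal e < Z k \<omega>} \<omega> \<partial>M)"
      by (intro nn_integral_mono) (auto simp: indicator_def not_less intro: min.coboundedI1 min.coboundedI2)
    also have "\<dots> = ennreal e + ennreal (p k)"
      by (subst nn_integral_add) (auto simp: emeasure_space_1 p_def emeasure_eq_measure prob_space)
    also have "\<dots> = ennreal (e + p k)" using e(1) by (simp add: p_def ennreal_plus)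
    also have "\<dots> < ennreal (2 * e)" using k e(1) by (intro ennreal_lessI) auto
    finally show "(\<integral>\<^sup>+\<omega>. min 1 (Z k \<omega>) \<partial>M) < a" using e(2) by (rule less_le_trans)
  qed
qed simp

text \<open>\<open>min 1 (f k)\<close> is bounded, hence a real integrable function converging in
  L1, and a subsequence converges almost everywhere; near 0 the truncation is invisible.\<close>

lemma (in prob_space) ky_fan_AE_subseq:
  assumes [measurable]: "\<And>k. f k \<in> borel_measurable M"
    and lim: "(\<lambda>k. \<integral>\<^sup>+\<omega>. min 1 (f k \<omega>) \<partial>M) \<longlonglongrightarrow> (0 :: ennreal)"
  obtains r :: "nat \<Rightarrow> nat" where "AE \<omega> in M. (\<lambda>k. f (r k) \<omega>) \<longlonglongrightarrow> 0"
proof -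
  define g where "g k \<omega> = enn2real (min 1 (f k \<omega>))" for k \<omega>
  have g: "ennreal (g k \<omega>) = min 1 (f k \<omega>)" for k \<omega>
    by (simp add: g_def ennreal_enn2real_if min_def top_unique)
  have g1: "0 \<le> g k \<omega>" "g k \<omega> \<le> 1" for k \<omega>
  proof -
    show "0 \<le> g k \<omega>" by (simp add: g_def)
    have "ennreal (g k \<omega>) \<le> ennreal 1" unfolding g by simp
    then show "g k \<omega> \<le> 1" by (subst (asm) ennreal_le_iff) auto
  qed
  have [measurable]: "g k \<in> borel_measurable M" for k unfolding g_def by measurable
  have int: "integrable M (g k)" for k
    by (rule integrable_const_bound[where B = 1]) (use g1 in auto)
  have "(\<lambda>k. ennreal (\<integral>\<omega>. g k \<omega> \<partial>M)) \<longlonglongrightarrow> ennreal 0"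
    using lim unfolding g[symmetric] using int g1 by (subst (asm) nn_integral_eq_integral) auto
  then have "(\<lambda>k. \<integral>\<omega>. norm (g k \<omega>) \<partial>M) \<longlonglongrightarrow> 0"
    using g1 by (subst (asm) tendsto_ennreal_iff) (auto intro!: integral_nonneg_AE)
  from tendsto_L1_AE_subseq[OF int this] obtain r where r: "AE \<omega> in M. (\<lambda>k. g (r k) \<omega>) \<longlonglongrightarrow> 0"
    by blast
  show ?thesis
  proof (rule that[of r])
    show "AE \<omega> in M. (\<lambda>k. f (r k) \<omega>) \<longlonglongrightarrow> 0"
      using r
    proof eventually_elim
      case (elim \<omega>)
      then have "(\<lambda>k. ennreal (g (r k) \<omega>)) \<longlonglongrightarrow> ennreal 0" by (rule tendsto_ennrealI)
      then have "(\<lambda>k. min 1 (f (r k) \<omega>)) \<longlonglongrightarrow> 0" by (simp add: g)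
      then show ?case by (rule tendsto_zero_of_min_one)
    qed
  qed
qed

section \<open>Comparison of simple integrals on a common refinement\<close>

lemma simple_process_data_nonneg:
  assumes "simple_process_data F t N s \<xi>" "i \<le> N"
  shows "0 \<le> s i" "s i \<le> t"
  using assms mono_onD[of "{..N}" s 0 i] mono_onD[of "{..N}" s i N]
  by (auto simp: simple_process_data_def)

context wiener_process
begin

text \<open>On a common refinement the difference of the two integrals is the integral of the
  difference of the integrands. The estimate for elementary integrals is scalar, so it is applied to
  each row and summed, which gives the factor \<open>CARD('n)\<close>.\<close>

lemma simple_integral_diff_ky_fan:
  obtains C where "0 \<le> C" "\<And>N s (\<xi> :: nat \<Rightarrow> 'a \<Rightarrow> real ^ 'm ^ 'n) N' s' \<xi>' t T. 0 \<le> t \<Longrightarrow> t \<le> T \<Longrightarrow>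
    simple_process_data F t N s \<xi> \<Longrightarrow> simple_process_data F T N' s' \<xi>' \<Longrightarrow>
    (\<integral>\<^sup>+\<omega>. min 1 (ennreal ((norm (simple_integral W N s \<xi> \<omega> -
      stopped_integral N' s' (\<lambda>i. \<xi>' i \<omega>) (\<lambda>r. W r \<omega>) t))\<^sup>2)) \<partial>P) \<le>
    ennreal C * (\<integral>\<^sup>+\<omega>. min 1 (\<integral>\<^sup>+r\<in>{0..t}.
      ennreal ((norm (simple_process N s \<xi> r \<omega> - simple_process N' s' \<xi>' r \<omega>))\<^sup>2) \<partial>lborel) \<partial>P)"
proof -
  obtain C where C: "0 \<le> C" "\<And>u L V. 0 \<le> u 0 \<Longrightarrow> (\<And>l. l < L \<Longrightarrow> u l < u (Suc l)) \<Longrightarrow>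
    (\<And>l. l < L \<Longrightarrow> V l \<in> borel_measurable (F (u l))) \<Longrightarrow>
    (\<integral>\<^sup>+\<omega>. min 1 (ennreal ((\<Sum>l<L. V l \<omega> \<bullet> (W (u (Suc l)) \<omega> - W (u l) \<omega>))\<^sup>2)) \<partial>P) \<le>
    ennreal C * (\<integral>\<^sup>+\<omega>. min 1 (ennreal (\<Sum>l<L. (norm (V l \<omega>))\<^sup>2 * (u (Suc l) - u l))) \<partial>P)"
    using elementary_integral_ky_fan by blast
  show ?thesis
  proof (rule that[of "real CARD('n) * C"])
    show "0 \<le> real CARD('n) * C" using C(1) by simp
    fix N s N' s' t T and \<xi> \<xi>' :: "nat \<Rightarrow> 'a \<Rightarrow> real ^ 'm ^ 'n"
    assume t: "0 \<le> t" "t \<le> T" and D: "simple_process_data F t N s \<xi>" "simple_process_data F T N' s' \<xi>'"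
    \<comment> \<open>The points 0 and \<open>t\<close> are added so that \<open>{0..t}\<close> is
      exactly covered by the first \<open>a\<close> cells, even if neither partition contains
      them.\<close>
    define A where "A = s ` {..N} \<union> s' ` {..N'} \<union> {0, t}"
    have A0: "0 \<le> x" if "x \<in> A" for x
      using that t simple_process_data_nonneg[OF D(1)] simple_process_data_nonneg[OF D(2)] by (auto simp: A_def)
    obtain u L where G: "time_grid u L" and u: "u ` {..L} = A"
      using time_grid_exists[of A] by (auto simp: A_def)
    interpret G: time_grid u L by fact
    have u0: "0 \<le> u 0" using u A0 by auto
    obtain k0 where k0: "k0 \<le> L" "u k0 = 0" proof -
      have "0 \<in> u ` {..L}" unfolding u A_def by simp
      then show ?thesis using that by auto
    qed
    have u0': "u 0 = 0" using G.u_le_iff[of 0 k0] k0 u0 by simp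
    obtain a where a: "a \<le> L" "u a = t" proof -
      have "t \<in> u ` {..L}" unfolding u A_def by simp
      then show ?thesis using that by auto
    qed
    have s: "s ` {..N} \<subseteq> u ` {..L}" "s' ` {..N'} \<subseteq> u ` {..L}" unfolding u A_def by auto
    have mono: "mono_on {..N} s" "mono_on {..N'} s'" "s N \<le> t" using D by (auto simp: simple_process_data_def)
    define R where "R \<omega> = simple_integral W N s \<xi> \<omega> - stopped_integral N' s' (\<lambda>i. \<xi>' i \<omega>) (\<lambda>r. W r \<omega>) t" for \<omega>
    define E where "E r \<omega> = simple_process N s \<xi> r \<omega> - simple_process N' s' \<xi>' r \<omega>" for r \<omega>
    have E_F: "E (u (Suc l)) \<in> borel_measurable (F (u l))" if "l < L" for l
      unfolding E_def simple_process_eq_step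
      using D that by (intro borel_measurable_diff step_F[OF G u0] s) (auto simp: simple_process_data_def)
    have E_const: "E r \<omega> = E (u (Suc l)) \<omega>" if "l < L" "u l < r" "r \<le> u (Suc l)" for l r \<omega>
      unfolding E_def simple_process_eq_step using G.step_const[OF s(1) that] G.step_const[OF s(2) that] by metis
    have R: "R \<omega> = (\<Sum>l<a. E (u (Suc l)) \<omega> *v (W (u (Suc l)) \<omega> - W (u l) \<omega>))" for \<omega>
      unfolding R_def E_def simple_process_eq_step
      using G.sum_step_eq_stopped_integral[OF s(1) mono(1) a(1), of "\<lambda>i. \<xi> i \<omega>" "\<lambda>r. W r \<omega>"]
        G.sum_step_eq_stopped_integral[OF s(2) mono(2) a(1), of "\<lambda>i. \<xi>' i \<omega>" "\<lambda>r. W r \<omega>"]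
        stopped_integral_eq_simple_integral[OF mono(1,3), of \<xi> \<omega> W] a(2)
      by (simp add: matrix_vector_mult_diff_rdistrib sum_subtractf)
    have comp: "(\<integral>\<^sup>+\<omega>. min 1 (ennreal ((R \<omega> $ i)\<^sup>2)) \<partial>P) \<le>
        ennreal C * (\<integral>\<^sup>+\<omega>. min 1 (\<integral>\<^sup>+r\<in>{0..t}. ennreal ((norm (E r \<omega>))\<^sup>2) \<partial>lborel) \<partial>P)" for i
    proof -
      have "R \<omega> $ i = (\<Sum>l<a. E (u (Suc l)) \<omega> $ i \<bullet> (W (u (Suc l)) \<omega> - W (u l) \<omega>))" for \<omega>
        unfolding R by (simp add: matrix_vector_mul_component)
      then have "(\<integral>\<^sup>+\<omega>. min 1 (ennreal ((R \<omega> $ i)\<^sup>2)) \<partial>P) \<le>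
          ennreal C * (\<integral>\<^sup>+\<omega>. min 1 (ennreal (\<Sum>l<a. (norm (E (u (Suc l)) \<omega> $ i))\<^sup>2 * (u (Suc l) - u l))) \<partial>P)"
        using C(2)[of u a "\<lambda>l \<omega>. E (u (Suc l)) \<omega> $ i"] u0 G.u_less a(1) E_F by simp
      also have "\<dots> \<le> ennreal C * (\<integral>\<^sup>+\<omega>. min 1 (\<integral>\<^sup>+r\<in>{0..t}. ennreal ((norm (E r \<omega>))\<^sup>2) \<partial>lborel) \<partial>P)"
      proof (intro mult_left_mono nn_integral_mono min.mono order_refl)
        fix \<omega>
        show "ennreal (\<Sum>l<a. (norm (E (u (Suc l)) \<omega> $ i))\<^sup>2 * (u (Suc l) - u l)) \<le>
            (\<integral>\<^sup>+r\<in>{0..t}. ennreal ((norm (E r \<omega>))\<^sup>2) \<partial>lborel)"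
          unfolding lessThan_atLeast0 a(2)[symmetric] u0'[symmetric]
        proof (rule G.grid_sum_le_nn_integral)
          fix l r assume "l < a" "u l < r" "r \<le> u (Suc l)"
          then have "E (u (Suc l)) \<omega> = E r \<omega>" using E_const[of l r \<omega>] a(1) by simp
          then show "ennreal ((norm (E (u (Suc l)) \<omega> $ i))\<^sup>2) \<le> ennreal ((norm (E r \<omega>))\<^sup>2)"
            by (simp add: Finite_Cartesian_Product.norm_nth_le power_mono)
        qed (use a in auto)
      qed simp
      finally show ?thesis .
    qed
    have RP[measurable]: "R \<in> borel_measurable P"
      unfolding R
    proof (intro borel_measurable_sum borel_measurable_matrix_vector_mult borel_measurable_diff)
      fix l assume "l \<in> {..<a}"
      then have l: "l < L" "0 \<le> u l" "0 \<le> u (Suc l)" using a(1) G.u_le_iff[of 0 l] G.u_le_iff[of 0 "Suc l"] u0 by auto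
      show "E (u (Suc l)) \<in> borel_measurable P" using F_measurable_P[OF E_F] l by simp
      show "W (u (Suc l)) \<in> borel_measurable P" "W (u l) \<in> borel_measurable P"
        using l by (auto intro: W_measurable_P)
    qed
    have "(\<integral>\<^sup>+\<omega>. min 1 (ennreal ((norm (R \<omega>))\<^sup>2)) \<partial>P) \<le> (\<integral>\<^sup>+\<omega>. (\<Sum>i\<in>UNIV. min 1 (ennreal ((R \<omega> $ i)\<^sup>2))) \<partial>P)"
    proof (rule nn_integral_mono)
      fix \<omega>
      have "ennreal ((norm (R \<omega>))\<^sup>2) = (\<Sum>i\<in>UNIV. ennreal ((R \<omega> $ i)\<^sup>2))"
        by (simp add: norm_vec_def L2_set_def sum_nonneg)
      then show "min 1 (ennreal ((norm (R \<omega>))\<^sup>2)) \<le> (\<Sum>i\<in>UNIV. min 1 (ennreal ((R \<omega> $ i)\<^sup>2)))"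
        by (simp only: min_one_sum_le)
    qed
    also have "\<dots> = (\<Sum>i\<in>UNIV. \<integral>\<^sup>+\<omega>. min 1 (ennreal ((R \<omega> $ i)\<^sup>2)) \<partial>P)"
      by (rule nn_integral_sum) measurable
    also have "\<dots> \<le> (\<Sum>i\<in>(UNIV :: 'n set). ennreal C * (\<integral>\<^sup>+\<omega>. min 1 (\<integral>\<^sup>+r\<in>{0..t}. ennreal ((norm (E r \<omega>))\<^sup>2) \<partial>lborel) \<partial>P))"
      by (intro sum_mono comp)
    also have "\<dots> = ennreal (real CARD('n) * C) * (\<integral>\<^sup>+\<omega>. min 1 (\<integral>\<^sup>+r\<in>{0..t}. ennreal ((norm (E r \<omega>))\<^sup>2) \<partial>lborel) \<partial>P)"
      using C(1) by (simp add: ennreal_mult ennreal_of_nat_eq_real_of_nat mult.assoc)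
    finally show "(\<integral>\<^sup>+\<omega>. min 1 (ennreal ((norm (simple_integral W N s \<xi> \<omega> -
      stopped_integral N' s' (\<lambda>i. \<xi>' i \<omega>) (\<lambda>r. W r \<omega>) t))\<^sup>2)) \<partial>P) \<le>
    ennreal (real CARD('n) * C) * (\<integral>\<^sup>+\<omega>. min 1 (\<integral>\<^sup>+r\<in>{0..t}.
      ennreal ((norm (simple_process N s \<xi> r \<omega> - simple_process N' s' \<xi>' r \<omega>))\<^sup>2) \<partial>lborel) \<partial>P)"
      unfolding R_def E_def .
  qed
qed

end

section \<open>Sums over the blocks of a time grid\<close>

lemma (in time_grid) step_value:
  assumes "j < L" "u j < r" "r \<le> u (Suc j)"
  shows "step L u x r = x j"
proof -
  have "indicat_real {u i<..u (Suc i)} r *\<^sub>R x i = (if i = j then x j else 0)" if i: "i < L" for i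
  proof (cases i j rule: linorder_cases)
    case less
    then have "u (Suc i) \<le> u j" using i assms(1) by (simp add: u_le_iff)
    then show ?thesis using assms less by simp
  next
    case greater
    then have "u (Suc j) \<le> u i" using i assms(1) by (simp add: u_le_iff)
    then show ?thesis using assms greater by simp
  qed (use assms in simp)
  then have "step L u x r = (\<Sum>i<L. if i = j then x j else 0)" unfolding step_def by (intro sum.cong) auto
  then show ?thesis using assms(1) by simp
qed

context wiener_process
begin

text \<open>On the union of the partition and the time grid the block sum is an elementary integral,
  with row vector \<open>x j\<close> times the matrix \<open>H - z j\<close> as integrand.
  \<open>Q\<close> is its quadratic variation; the existential hides the refined grid, of which only
  measurability and the integral bound are needed later.\<close>

lemma simple_integral_block_moment:
  fixes q :: real
  assumes q: "2 \<le> q"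
  obtains C where "0 \<le> C" "\<And>N s (\<xi> :: nat \<Rightarrow> 'a \<Rightarrow> real ^ 'm ^ 'n) t M x z K.
    simple_process_data F (t M) N s \<xi> \<Longrightarrow> time_grid t M \<Longrightarrow> t 0 = 0 \<Longrightarrow>
    (\<And>j. j < M \<Longrightarrow> x j \<in> borel_measurable (F (t j))) \<Longrightarrow> (\<And>j. j < M \<Longrightarrow> z j \<in> borel_measurable (F (t j))) \<Longrightarrow> 0 \<le> K \<Longrightarrow>
    \<exists>Q. Q \<in> borel_measurable P \<and> (\<forall>\<omega>. 0 \<le> Q \<omega> \<and> ennreal (Q \<omega>) \<le> (\<Sum>j<M. \<integral>\<^sup>+r\<in>{t j..t (Suc j)}.
        ennreal ((norm (x j \<omega>) * norm (simple_process N s \<xi> r \<omega> - z j \<omega>))\<^sup>2) \<partial>lborel)) \<and>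
      (\<integral>\<^sup>+\<omega>. (if Q \<omega> \<le> K then ennreal (running_max (\<lambda>n. \<Sum>j<n. x j \<omega> \<bullet>
        (stopped_integral N s (\<lambda>i. \<xi> i \<omega>) (\<lambda>r. W r \<omega>) (t (Suc j)) - stopped_integral N s (\<lambda>i. \<xi> i \<omega>) (\<lambda>r. W r \<omega>) (t j) -
          z j \<omega> *v (W (t (Suc j)) \<omega> - W (t j) \<omega>))) M powr q) else 0) \<partial>P) \<le>
      ennreal C * (\<integral>\<^sup>+\<omega>. ennreal (min (Q \<omega>) K powr (q / 2)) \<partial>P)"
proof -
  obtain C where C: "0 \<le> C" "\<And>u L V K. 0 \<le> K \<Longrightarrow> 0 \<le> u 0 \<Longrightarrow> (\<And>l. l < L \<Longrightarrow> u l < u (Suc l)) \<Longrightarrow>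
    (\<And>l. l < L \<Longrightarrow> V l \<in> borel_measurable (F (u l))) \<Longrightarrow>
    (\<integral>\<^sup>+\<omega>. (if (\<Sum>l<L. (norm (V l \<omega>))\<^sup>2 * (u (Suc l) - u l)) \<le> K
      then ennreal (running_max (\<lambda>n. \<Sum>l<n. V l \<omega> \<bullet> (W (u (Suc l)) \<omega> - W (u l) \<omega>)) L powr q) else 0) \<partial>P) \<le>
    ennreal C * (\<integral>\<^sup>+\<omega>. ennreal (min (\<Sum>l<L. (norm (V l \<omega>))\<^sup>2 * (u (Suc l) - u l)) K powr (q / 2)) \<partial>P)"
    using truncated_max_moment[OF q] by blast
  show ?thesis
  proof (rule that[OF C(1)])
    fix N s and \<xi> :: "nat \<Rightarrow> 'a \<Rightarrow> real ^ 'm ^ 'n" and t :: "nat \<Rightarrow> real" and M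
      and x :: "nat \<Rightarrow> 'a \<Rightarrow> real ^ 'n" and z :: "nat \<Rightarrow> 'a \<Rightarrow> real ^ 'm ^ 'n" and K :: real
    assume D: "simple_process_data F (t M) N s \<xi>" and T: "time_grid t M" and t0: "t 0 = 0"
      and x: "\<And>j. j < M \<Longrightarrow> x j \<in> borel_measurable (F (t j))"
      and z: "\<And>j. j < M \<Longrightarrow> z j \<in> borel_measurable (F (t j))" and K: "0 \<le> K"
    interpret T: time_grid t M by fact
    define A where "A = s ` {..N} \<union> t ` {..M}"
    have A0: "0 \<le> y" if "y \<in> A" for y
      using that simple_process_data_nonneg[OF D] T.u_le_iff[of 0] t0 by (auto simp: A_def)
    obtain u L where G: "time_grid u L" and u: "u ` {..L} = A"
      using time_grid_exists[of A] by (auto simp: A_def)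
    interpret G: time_grid u L by fact
    have u0: "0 \<le> u 0" using u A0 by auto
    have "\<exists>k. k \<le> L \<and> u k = t n" if "n \<le> M" for n
    proof -
      have "t n \<in> u ` {..L}" unfolding u A_def using that by simp
      then show ?thesis by auto
    qed
    \<comment> \<open>\<open>a n\<close> is the position of the \<open>n\<close>-th block boundary
      in the refined grid; \<open>a 0 = 0\<close> because \<open>t 0 = 0\<close> is its smallest
      point.\<close>
    then obtain a where a: "\<And>n. n \<le> M \<Longrightarrow> a n \<le> L \<and> u (a n) = t n" by metis
    have a0: "a 0 = 0" using G.u_le_iff[of "a 0" 0] a[of 0] t0 u0 by simp
    have a_mono: "a n \<le> a k" if "n \<le> k" "k \<le> M" for n k
      using a[of n] a[of k] that T.u_le_iff[of n k] G.u_le_iff[of "a n" "a k"] by simp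
    have s: "s ` {..N} \<subseteq> u ` {..L}" "t ` {..M} \<subseteq> u ` {..L}" unfolding u A_def by auto
    have mono: "mono_on {..N} s" using D by (auto simp: simple_process_data_def)
    define H where "H l \<omega> = step N s (\<lambda>i. \<xi> i \<omega>) (u (Suc l))" for l \<omega>
    define V where "V l \<omega> = step M t (\<lambda>j. x j \<omega>) (u (Suc l)) v* (H l \<omega> - step M t (\<lambda>j. z j \<omega>) (u (Suc l)))" for l \<omega>
    have V_F: "V l \<in> borel_measurable (F (u l))" if "l < L" for l
      unfolding V_def H_def using that D x z
      by (intro borel_measurable_vector_matrix_mult borel_measurable_diff step_F[OF G u0] s)
        (auto simp: simple_process_data_def)
    have blk: "l < L \<and> t j \<le> u l \<and> u l < u (Suc l) \<and> u (Suc l) \<le> t (Suc j)" if "j < M" "a j \<le> l" "l < a (Suc j)" for j l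
      using that a[of j] a[of "Suc j"] G.u_le_iff[of "a j" l] G.u_less_iff[of l "Suc l"] G.u_le_iff[of "Suc l" "a (Suc j)"] by auto
    have V_blk: "V l \<omega> = x j \<omega> v* (H l \<omega> - z j \<omega>)" if "j < M" "a j \<le> l" "l < a (Suc j)" for j l \<omega>
      unfolding V_def using blk[OF that] that(1) by (simp add: T.step_value[of j])
    define I where "I r \<omega> = stopped_integral N s (\<lambda>i. \<xi> i \<omega>) (\<lambda>r. W r \<omega>) r" for r \<omega>
    have I: "(\<Sum>l<b. H l \<omega> *v (W (u (Suc l)) \<omega> - W (u l) \<omega>)) = I (u b) \<omega>" if "b \<le> L" for b \<omega>
      unfolding H_def I_def using G.sum_step_eq_stopped_integral[OF s(1) mono that] .
    have I_blk: "(\<Sum>l\<in>{a j..<a (Suc j)}. H l \<omega> *v (W (u (Suc l)) \<omega> - W (u l) \<omega>)) = I (t (Suc j)) \<omega> - I (t j) \<omega>"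
      if j: "j < M" for j \<omega>
      using I[of "a j" \<omega>] I[of "a (Suc j)" \<omega>] a[of j] a[of "Suc j"] j a_mono[of j "Suc j"]
        sum.atLeastLessThan_concat[of 0 "a j" "a (Suc j)" "\<lambda>l. H l \<omega> *v (W (u (Suc l)) \<omega> - W (u l) \<omega>)"]
      by (simp add: lessThan_atLeast0 algebra_simps)
    define X where "X j \<omega> = x j \<omega> \<bullet> (I (t (Suc j)) \<omega> - I (t j) \<omega> - z j \<omega> *v (W (t (Suc j)) \<omega> - W (t j) \<omega>))" for j \<omega>
    have X_blk: "(\<Sum>l\<in>{a j..<a (Suc j)}. V l \<omega> \<bullet> (W (u (Suc l)) \<omega> - W (u l) \<omega>)) = X j \<omega>" if j: "j < M" for j \<omega>
    proof -
      have "(\<Sum>l\<in>{a j..<a (Suc j)}. W (u (Suc l)) \<omega> - W (u l) \<omega>) = W (t (Suc j)) \<omega> - W (t j) \<omega>"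
        using sum_Suc_diff'[of "a j" "a (Suc j)" "\<lambda>l. W (u l) \<omega>"] a[of j] a[of "Suc j"] j a_mono[of j "Suc j"] by simp
      then have "X j \<omega> = x j \<omega> \<bullet> ((\<Sum>l\<in>{a j..<a (Suc j)}. H l \<omega> *v (W (u (Suc l)) \<omega> - W (u l) \<omega>)) -
          z j \<omega> *v (\<Sum>l\<in>{a j..<a (Suc j)}. W (u (Suc l)) \<omega> - W (u l) \<omega>))"
        unfolding X_def I_blk[OF j] by simp
      also have "\<dots> = (\<Sum>l\<in>{a j..<a (Suc j)}. x j \<omega> \<bullet> ((H l \<omega> - z j \<omega>) *v (W (u (Suc l)) \<omega> - W (u l) \<omega>)))"
      proof -
        have "y \<bullet> ((\<Sum>l\<in>B. A l *v d l) - Z *v (\<Sum>l\<in>B. d l)) = (\<Sum>l\<in>B. y \<bullet> ((A l - Z) *v d l))"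
          for y :: "real ^ 'n" and A Z and d :: "nat \<Rightarrow> real ^ 'm" and B
          by (simp add: bounded_bilinear.sum_right[OF bounded_bilinear_matrix_vector_mult]
            matrix_vector_mult_diff_rdistrib inner_diff_right sum_subtractf inner_sum_right)
        then show ?thesis .
      qed
      also have "\<dots> = (\<Sum>l\<in>{a j..<a (Suc j)}. V l \<omega> \<bullet> (W (u (Suc l)) \<omega> - W (u l) \<omega>))"
        using V_blk[OF j] by (intro sum.cong) (auto simp: dot_lmul_matrix)
      finally show ?thesis by simp
    qed
    define S where "S k \<omega> = (\<Sum>l<k. V l \<omega> \<bullet> (W (u (Suc l)) \<omega> - W (u l) \<omega>))" for k \<omega>
    have SX: "S (a n) \<omega> = (\<Sum>j<n. X j \<omega>)" if "n \<le> M" for n \<omega>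
      using that
    proof (induction n)
      case (Suc n)
      then show ?case
        using X_blk[of n \<omega>] a_mono[of n "Suc n"]
          sum.atLeastLessThan_concat[of 0 "a n" "a (Suc n)" "\<lambda>l. V l \<omega> \<bullet> (W (u (Suc l)) \<omega> - W (u l) \<omega>)"]
        by (simp add: S_def lessThan_atLeast0)
    qed (simp add: S_def a0)
    define Q where "Q \<omega> = (\<Sum>l<a M. (norm (V l \<omega>))\<^sup>2 * (u (Suc l) - u l))" for \<omega>
    have aM: "a M \<le> L" using a by simp
    have un: "0 \<le> u l" if "l \<le> L" for l using G.u_le_iff[of 0 l] that u0 by simp
    have Qle: "ennreal (\<Sum>l<a n. (norm (V l \<omega>))\<^sup>2 * (u (Suc l) - u l)) \<le> (\<Sum>j<n. \<integral>\<^sup>+r\<in>{t j..t (Suc j)}.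
        ennreal ((norm (x j \<omega>) * norm (simple_process N s \<xi> r \<omega> - z j \<omega>))\<^sup>2) \<partial>lborel)" if "n \<le> M" for n \<omega>
      using that
    proof (induction n)
      case (Suc n)
      then have n: "n < M" "n \<le> M" by auto
      let ?v = "\<lambda>l. (norm (V l \<omega>))\<^sup>2 * (u (Suc l) - u l)"
      have nonneg: "0 \<le> ?v l" if "l < a (Suc n)" for l
        using G.u_le_iff[of l "Suc l"] that a[of "Suc n"] Suc.prems by simp
      have "(\<Sum>l<a (Suc n). ?v l) = (\<Sum>l<a n. ?v l) + (\<Sum>l\<in>{a n..<a (Suc n)}. ?v l)"
        using a_mono[of n "Suc n"] n sum.atLeastLessThan_concat[of 0 "a n" "a (Suc n)" ?v]
        by (simp add: lessThan_atLeast0)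
      then have "ennreal (\<Sum>l<a (Suc n). ?v l) = ennreal (\<Sum>l<a n. ?v l) + ennreal (\<Sum>l\<in>{a n..<a (Suc n)}. ?v l)"
      proof -
        have "0 \<le> (\<Sum>l<a n. ?v l)" "0 \<le> (\<Sum>l\<in>{a n..<a (Suc n)}. ?v l)"
          using nonneg a_mono[of n "Suc n"] n by (intro sum_nonneg, simp)+
        then show ?thesis using \<open>(\<Sum>l<a (Suc n). ?v l) = (\<Sum>l<a n. ?v l) + (\<Sum>l\<in>{a n..<a (Suc n)}. ?v l)\<close>
          by (simp only: ennreal_plus)
      qed
      also have "ennreal (\<Sum>l\<in>{a n..<a (Suc n)}. ?v l) \<le> (\<integral>\<^sup>+r\<in>{u (a n)..u (a (Suc n))}.
          ennreal ((norm (x n \<omega>) * norm (simple_process N s \<xi> r \<omega> - z n \<omega>))\<^sup>2) \<partial>lborel)"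
      proof (rule G.grid_sum_le_nn_integral)
        fix l r assume l: "a n \<le> l" "l < a (Suc n)" and r: "u l < r" "r \<le> u (Suc l)"
        have "simple_process N s \<xi> r \<omega> = H l \<omega>"
          unfolding simple_process_eq_step H_def using blk[OF n(1) l] r by (intro G.step_const s) auto
        then have "norm (V l \<omega>) \<le> norm (x n \<omega>) * norm (simple_process N s \<xi> r \<omega> - z n \<omega>)"
          using V_blk[OF n(1) l] norm_vector_matrix_mult_le by metis
        then show "ennreal ((norm (V l \<omega>))\<^sup>2) \<le> ennreal ((norm (x n \<omega>) * norm (simple_process N s \<xi> r \<omega> - z n \<omega>))\<^sup>2)"
          by (intro ennreal_leI power_mono) auto
      qed (use a_mono[of n "Suc n"] a[of "Suc n"] n in auto)
      finally show ?case using Suc a[of n] a[of "Suc n"] by (auto intro: add_mono order_trans)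
    qed (simp add: a0)
    show "\<exists>Q. Q \<in> borel_measurable P \<and> (\<forall>\<omega>. 0 \<le> Q \<omega> \<and> ennreal (Q \<omega>) \<le> (\<Sum>j<M. \<integral>\<^sup>+r\<in>{t j..t (Suc j)}.
        ennreal ((norm (x j \<omega>) * norm (simple_process N s \<xi> r \<omega> - z j \<omega>))\<^sup>2) \<partial>lborel)) \<and>
      (\<integral>\<^sup>+\<omega>. (if Q \<omega> \<le> K then ennreal (running_max (\<lambda>n. \<Sum>j<n. x j \<omega> \<bullet>
        (stopped_integral N s (\<lambda>i. \<xi> i \<omega>) (\<lambda>r. W r \<omega>) (t (Suc j)) - stopped_integral N s (\<lambda>i. \<xi> i \<omega>) (\<lambda>r. W r \<omega>) (t j) -
          z j \<omega> *v (W (t (Suc j)) \<omega> - W (t j) \<omega>))) M powr q) else 0) \<partial>P) \<le>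
      ennreal C * (\<integral>\<^sup>+\<omega>. ennreal (min (Q \<omega>) K powr (q / 2)) \<partial>P)"
    proof (intro exI[of _ Q] conjI allI)
      show "Q \<in> borel_measurable P"
        unfolding Q_def
      proof (rule borel_measurable_sum)
        fix l assume "l \<in> {..<a M}"
        then have [measurable]: "V l \<in> borel_measurable P" using F_measurable_P[OF V_F[of l] un[of l]] aM by simp
        show "(\<lambda>\<omega>. (norm (V l \<omega>))\<^sup>2 * (u (Suc l) - u l)) \<in> borel_measurable P" by measurable
      qed
      show "0 \<le> Q \<omega>" for \<omega>
        unfolding Q_def
      proof (rule sum_nonneg)
        fix l assume "l \<in> {..<a M}"
        then show "0 \<le> (norm (V l \<omega>))\<^sup>2 * (u (Suc l) - u l)" using G.u_le_iff[of l "Suc l"] aM by simp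
      qed
      show "ennreal (Q \<omega>) \<le> (\<Sum>j<M. \<integral>\<^sup>+r\<in>{t j..t (Suc j)}.
        ennreal ((norm (x j \<omega>) * norm (simple_process N s \<xi> r \<omega> - z j \<omega>))\<^sup>2) \<partial>lborel)" for \<omega>
        unfolding Q_def by (rule Qle) simp
      have "(\<integral>\<^sup>+\<omega>. (if Q \<omega> \<le> K then ennreal (running_max (\<lambda>n. \<Sum>j<n. X j \<omega>) M powr q) else 0) \<partial>P) \<le>
          (\<integral>\<^sup>+\<omega>. (if Q \<omega> \<le> K then ennreal (running_max (\<lambda>k. S k \<omega>) (a M) powr q) else 0) \<partial>P)"
      proof (rule nn_integral_mono)
        fix \<omega>
        \<comment> \<open>The partial sums over whole blocks are those partial sums of the refined
          integral that end at some \<open>a n\<close>, so their maximum is smaller.\<close>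
        have "running_max (\<lambda>n. \<Sum>j<n. X j \<omega>) M \<le> running_max (\<lambda>k. S k \<omega>) (a M)"
        proof (rule running_max_le)
          fix n assume n: "n \<le> M"
          show "\<bar>\<Sum>j<n. X j \<omega>\<bar> \<le> running_max (\<lambda>k. S k \<omega>) (a M)"
            using abs_le_running_max[of "a n" "a M" "\<lambda>k. S k \<omega>"] a_mono[OF n] SX[OF n] by simp
        qed
        then show "(if Q \<omega> \<le> K then ennreal (running_max (\<lambda>n. \<Sum>j<n. X j \<omega>) M powr q) else 0) \<le>
            (if Q \<omega> \<le> K then ennreal (running_max (\<lambda>k. S k \<omega>) (a M) powr q) else 0)"
          using q by (auto intro!: ennreal_leI powr_mono2 running_max_nonneg)
      qed
      also have "\<dots> \<le> ennreal C * (\<integral>\<^sup>+\<omega>. ennreal (min (Q \<omega>) K powr (q / 2)) \<partial>P)"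
        unfolding Q_def S_def by (rule C(2)) (use K u0 G.u_less aM V_F in auto)
      finally show "(\<integral>\<^sup>+\<omega>. (if Q \<omega> \<le> K then ennreal (running_max (\<lambda>n. \<Sum>j<n. x j \<omega> \<bullet>
        (stopped_integral N s (\<lambda>i. \<xi> i \<omega>) (\<lambda>r. W r \<omega>) (t (Suc j)) - stopped_integral N s (\<lambda>i. \<xi> i \<omega>) (\<lambda>r. W r \<omega>) (t j) -
          z j \<omega> *v (W (t (Suc j)) \<omega> - W (t j) \<omega>))) M powr q) else 0) \<partial>P) \<le>
      ennreal C * (\<integral>\<^sup>+\<omega>. ennreal (min (Q \<omega>) K powr (q / 2)) \<partial>P)"
        unfolding X_def I_def .
    qed
  qed
qed

end

section \<open>The stochastic integral\<close>

lemma simple_process_measurable: "(\<lambda>r. simple_process N s \<xi> r \<omega>) \<in> borel_measurable borel"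
  unfolding simple_process_def by measurable

text \<open>Replaces \<open>g\<close> by \<open>f\<close> on one block. The error is deliberately
  enlarged to all of \<open>{0..T}\<close>, where the approximation of the integrand is known to
  converge.\<close>

lemma set_nn_integral_block_split:
  fixes f g :: "real \<Rightarrow> 'b::{real_normed_vector, second_countable_topology}"
  assumes f: "f \<in> borel_measurable (restrict_space borel {0..T})" and g: "g \<in> borel_measurable (restrict_space borel {0..T})"
    and A: "A \<subseteq> {0..T}" "A \<in> sets borel" and c: "0 \<le> c"
  shows "(\<integral>\<^sup>+r\<in>A. ennreal ((c * norm (g r - z))\<^sup>2) \<partial>lborel) \<le>
    2 * (\<integral>\<^sup>+r\<in>A. ennreal ((c * norm (f r - z))\<^sup>2) \<partial>lborel) +
    2 * ennreal (c\<^sup>2) * (\<integral>\<^sup>+r\<in>{0..T}. ennreal ((norm (g r - f r))\<^sup>2) \<partial>lborel)"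
proof -
  have [measurable]: "f \<in> borel_measurable (restrict_space borel A)" "g \<in> borel_measurable (restrict_space borel A)"
    using f g A(1) by (auto intro: measurable_restrict_mono)
  have "(\<integral>\<^sup>+r\<in>A. ennreal ((c * norm (g r - z))\<^sup>2) \<partial>lborel) =
      (\<integral>\<^sup>+r\<in>A. ennreal ((norm (c *\<^sub>R (f r - z) + c *\<^sub>R (g r - f r)))\<^sup>2) \<partial>lborel)"
    using c by (simp flip: scaleR_add_right)
  also have "\<dots> \<le> 2 * (\<integral>\<^sup>+r\<in>A. ennreal ((norm (c *\<^sub>R (f r - z)))\<^sup>2) \<partial>lborel) +
      2 * (\<integral>\<^sup>+r\<in>A. ennreal ((norm (c *\<^sub>R (g r - f r)))\<^sup>2) \<partial>lborel)"
    by (intro set_nn_integral_square_add_le A) measurable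
  also have "(\<integral>\<^sup>+r\<in>A. ennreal ((norm (c *\<^sub>R (g r - f r)))\<^sup>2) \<partial>lborel) \<le>
      (\<integral>\<^sup>+r. ennreal (c\<^sup>2) * ennreal ((norm (indicat_real {0..T} r *\<^sub>R (g r - f r)))\<^sup>2) \<partial>lborel)"
    using A c by (intro nn_integral_mono) (auto simp: indicator_def power_mult_distrib ennreal_mult)
  also have "\<dots> = ennreal (c\<^sup>2) * (\<integral>\<^sup>+r. ennreal ((norm (indicat_real {0..T} r *\<^sub>R (g r - f r)))\<^sup>2) \<partial>lborel)"
  proof (rule nn_integral_cmult)
    have "(\<lambda>r. g r - f r) \<in> borel_measurable (restrict_space borel {0..T})" using f g by measurable
    then have [measurable]: "(\<lambda>r. indicat_real {0..T} r *\<^sub>R (g r - f r)) \<in> borel_measurable borel"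
      by (subst (asm) borel_measurable_restrict_space_iff) auto
    show "(\<lambda>r. ennreal ((norm (indicat_real {0..T} r *\<^sub>R (g r - f r)))\<^sup>2)) \<in> borel_measurable lborel" by measurable
  qed
  also have "(\<integral>\<^sup>+r. ennreal ((norm (indicat_real {0..T} r *\<^sub>R (g r - f r)))\<^sup>2) \<partial>lborel) =
      (\<integral>\<^sup>+r\<in>{0..T}. ennreal ((norm (g r - f r))\<^sup>2) \<partial>lborel)"
    by (intro nn_integral_cong) (auto simp: indicator_def)
  finally show ?thesis using c by (simp add: mult.assoc add_left_mono mult_left_mono)
qed

context wiener_process
begin

lemma progressively_measurable_path:
  assumes H: "progressively_measurable F T H" and T: "0 \<le> T" and \<omega>: "\<omega> \<in> space P"
  shows "(\<lambda>r. H r \<omega>) \<in> borel_measurable (restrict_space borel {0..T})"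
proof -
  have "(\<lambda>(r, \<omega>). H r \<omega>) \<in> borel_measurable (restrict_space borel {0..T} \<Otimes>\<^sub>M F T)"
    using H T by (auto simp: progressively_measurable_def)
  moreover have "(\<lambda>r. (r, \<omega>)) \<in> measurable (restrict_space borel {0..T}) (restrict_space borel {0..T} \<Otimes>\<^sub>M F T)"
    using \<omega> space_F[OF T] by (intro measurable_Pair measurable_ident measurable_const) auto
  ultimately have "(\<lambda>r. case (r, \<omega>) of (r, \<omega>) \<Rightarrow> H r \<omega>) \<in> borel_measurable (restrict_space borel {0..T})"
    by (rule measurable_compose[rotated])
  then show ?thesis by simp
qed

lemma stopped_integral_measurable:
  assumes D: "simple_process_data F T N s \<xi>" and t: "0 \<le> t"
  shows "(\<lambda>\<omega>. stopped_integral N s (\<lambda>i. \<xi> i \<omega>) (\<lambda>r. W r \<omega>) t) \<in> borel_measurable P"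
  unfolding stopped_integral_def
proof (intro borel_measurable_sum borel_measurable_matrix_vector_mult borel_measurable_diff)
  fix i assume "i \<in> {..<N}"
  then have i: "i < N" "i \<le> N" "Suc i \<le> N" by auto
  show "\<xi> i \<in> borel_measurable P"
    using D i simple_process_data_nonneg[OF D, of i] F_measurable_P[of "\<xi> i" "s i"] by (auto simp: simple_process_data_def)
  show "W (min (s (Suc i)) t) \<in> borel_measurable P" "W (min (s i) t) \<in> borel_measurable P"
    using simple_process_data_nonneg[OF D, of i] simple_process_data_nonneg[OF D, of "Suc i"] i t
    by (auto intro!: W_measurable_P)
qed

text \<open>\<open>J\<close> is defined through an approximating sequence of its own on
  \<open>{0..t}\<close>, while the maximum over all grid times needs a single sequence on
  \<open>{0..T}\<close>. Both sequences approximate the same \<open>H\<close> on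
  \<open>{0..t}\<close>, so the distance of their integrals tends to zero in probability.\<close>

lemma stopped_integral_tendsto:
  fixes \<xi> :: "nat \<Rightarrow> nat \<Rightarrow> 'a \<Rightarrow> real ^ 'm ^ 'n"
  assumes t: "0 \<le> t" "t \<le> T" and J: "has_ito_integral P F W t H J" and H: "progressively_measurable F T H"
    and D: "\<And>k. simple_process_data F T (N k) (s k) (\<xi> k)"
    and lim: "tends_to_zero_in_prob P (\<lambda>k \<omega>. \<integral>\<^sup>+r\<in>{0..T}.
        ennreal ((norm (simple_process (N k) (s k) (\<xi> k) r \<omega> - H r \<omega>))\<^sup>2) \<partial>lborel)"
  shows "(\<lambda>k. \<integral>\<^sup>+\<omega>. min 1 (ennreal ((norm (stopped_integral (N k) (s k) (\<lambda>i. \<xi> k i \<omega>) (\<lambda>r. W r \<omega>) t - J \<omega>))\<^sup>2)) \<partial>P) \<longlonglongrightarrow> 0"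
proof -
  obtain N' s' and \<xi>' :: "nat \<Rightarrow> nat \<Rightarrow> 'a \<Rightarrow> real ^ 'm ^ 'n" where
      D': "\<And>k. simple_process_data F t (N' k) (s' k) (\<xi>' k)"
    and lim': "tends_to_zero_in_prob P (\<lambda>k \<omega>. \<integral>\<^sup>+r\<in>{0..t}.
        ennreal ((norm (simple_process (N' k) (s' k) (\<xi>' k) r \<omega> - H r \<omega>))\<^sup>2) \<partial>lborel)"
    and limJ: "tends_to_zero_in_prob P (\<lambda>k \<omega>. ennreal (norm (simple_integral W (N' k) (s' k) (\<xi>' k) \<omega> - J \<omega>)))"
    using J unfolding has_ito_integral_def by blast
  have JP[measurable]: "J \<in> borel_measurable P" using J by (simp add: has_ito_integral_def)
  obtain C where C: "0 \<le> C" "\<And>N s (\<xi> :: nat \<Rightarrow> 'a \<Rightarrow> real ^ 'm ^ 'n) N' s' \<xi>' t T. 0 \<le> t \<Longrightarrow> t \<le> T \<Longrightarrow>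
    simple_process_data F t N s \<xi> \<Longrightarrow> simple_process_data F T N' s' \<xi>' \<Longrightarrow>
    (\<integral>\<^sup>+\<omega>. min 1 (ennreal ((norm (simple_integral W N s \<xi> \<omega> -
      stopped_integral N' s' (\<lambda>i. \<xi>' i \<omega>) (\<lambda>r. W r \<omega>) t))\<^sup>2)) \<partial>P) \<le>
    ennreal C * (\<integral>\<^sup>+\<omega>. min 1 (\<integral>\<^sup>+r\<in>{0..t}.
      ennreal ((norm (simple_process N s \<xi> r \<omega> - simple_process N' s' \<xi>' r \<omega>))\<^sup>2) \<partial>lborel) \<partial>P)"
    using simple_integral_diff_ky_fan by blast
  define h where "h k r \<omega> = simple_process (N k) (s k) (\<xi> k) r \<omega>" for k r \<omega>
  define h' where "h' k r \<omega> = simple_process (N' k) (s' k) (\<xi>' k) r \<omega>" for k r \<omega>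
  define I where "I k \<omega> = stopped_integral (N k) (s k) (\<lambda>i. \<xi> k i \<omega>) (\<lambda>r. W r \<omega>) t" for k \<omega>
  define S where "S k \<omega> = simple_integral W (N' k) (s' k) (\<xi>' k) \<omega>" for k \<omega>
  define e where "e k \<omega> = (\<integral>\<^sup>+r\<in>{0..t}. ennreal ((norm (h' k r \<omega> - H r \<omega>))\<^sup>2) \<partial>lborel)" for k \<omega>
  define d where "d k \<omega> = (\<integral>\<^sup>+r\<in>{0..T}. ennreal ((norm (h k r \<omega> - H r \<omega>))\<^sup>2) \<partial>lborel)" for k \<omega>
  have lims: "(\<lambda>k. \<integral>\<^sup>+\<omega>. min 1 (e k \<omega>) \<partial>P) \<longlonglongrightarrow> 0" "(\<lambda>k. \<integral>\<^sup>+\<omega>. min 1 (d k \<omega>) \<partial>P) \<longlonglongrightarrow> 0"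
      "(\<lambda>k. \<integral>\<^sup>+\<omega>. min 1 (ennreal (norm (S k \<omega> - J \<omega>))) \<partial>P) \<longlonglongrightarrow> 0"
    using tends_to_zero_in_prob_ky_fan[OF lim] tends_to_zero_in_prob_ky_fan[OF lim'] tends_to_zero_in_prob_ky_fan[OF limJ]
    unfolding e_def d_def h_def h'_def S_def by blast+
  have [measurable]: "e k \<in> borel_measurable P" "d k \<in> borel_measurable P" for k
    using lim lim' unfolding h_def h'_def e_def d_def tends_to_zero_in_prob_def by blast+
  have IP[measurable]: "I k \<in> borel_measurable P" for k
    unfolding I_def by (rule stopped_integral_measurable[OF D t(1)])
  have SP[measurable]: "S k \<in> borel_measurable P" for k
  proof -
    have "mono_on {..N' k} (s' k)" "s' k (N' k) \<le> t" using D'[of k] by (auto simp: simple_process_data_def)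
    from stopped_integral_eq_simple_integral[OF this, of "\<xi>' k" _ W] stopped_integral_measurable[OF D' t(1), of k]
    show ?thesis unfolding S_def by simp
  qed
  have t_sub: "{0..t} \<subseteq> {0..T}" using t by auto
  have hh: "(\<integral>\<^sup>+r\<in>{0..t}. ennreal ((norm (h' k r \<omega> - h k r \<omega>))\<^sup>2) \<partial>lborel) \<le> 2 * e k \<omega> + 2 * d k \<omega>"
    if \<omega>: "\<omega> \<in> space P" for k \<omega>
  proof -
    have Hp[measurable]: "(\<lambda>r. H r \<omega>) \<in> borel_measurable (restrict_space borel {0..t})"
      using J t(1) \<omega> by (auto intro: progressively_measurable_path simp: has_ito_integral_def)
    have [measurable]: "(\<lambda>r. h k r \<omega>) \<in> borel_measurable (restrict_space borel {0..t})" "(\<lambda>r. h' k r \<omega>) \<in> borel_measurable (restrict_space borel {0..t})"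
      unfolding h_def h'_def by (intro measurable_restrict_space1 simple_process_measurable)+
    have "(\<integral>\<^sup>+r\<in>{0..t}. ennreal ((norm ((h' k r \<omega> - H r \<omega>) + (H r \<omega> - h k r \<omega>)))\<^sup>2) \<partial>lborel) \<le>
       2 * (\<integral>\<^sup>+r\<in>{0..t}. ennreal ((norm (h' k r \<omega> - H r \<omega>))\<^sup>2) \<partial>lborel) +
       2 * (\<integral>\<^sup>+r\<in>{0..t}. ennreal ((norm (H r \<omega> - h k r \<omega>))\<^sup>2) \<partial>lborel)"
      by (intro set_nn_integral_square_add_le borel_measurable_diff Hp) auto
    moreover have "(\<integral>\<^sup>+r\<in>{0..t}. ennreal ((norm (H r \<omega> - h k r \<omega>))\<^sup>2) \<partial>lborel) \<le> d k \<omega>"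
      unfolding d_def using t_sub by (intro nn_integral_mono) (auto simp: indicator_def norm_minus_commute)
    ultimately show ?thesis unfolding e_def
      by (simp add: order_trans[OF _ add_left_mono[OF mult_left_mono]])
  qed
  have bound: "(\<integral>\<^sup>+\<omega>. min 1 (ennreal ((norm (I k \<omega> - J \<omega>))\<^sup>2)) \<partial>P) \<le>
     2 * (ennreal C * (2 * (\<integral>\<^sup>+\<omega>. min 1 (e k \<omega>) \<partial>P) + 2 * (\<integral>\<^sup>+\<omega>. min 1 (d k \<omega>) \<partial>P))) +
     2 * (\<integral>\<^sup>+\<omega>. min 1 (ennreal (norm (S k \<omega> - J \<omega>))) \<partial>P)" for k
  proof -
    have "(\<integral>\<^sup>+\<omega>. min 1 (ennreal ((norm (I k \<omega> - J \<omega>))\<^sup>2)) \<partial>P) \<le>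
        (\<integral>\<^sup>+\<omega>. 2 * min 1 (ennreal ((norm (S k \<omega> - I k \<omega>))\<^sup>2)) + 2 * min 1 (ennreal (norm (S k \<omega> - J \<omega>))) \<partial>P)"
    proof (rule nn_integral_mono)
      fix \<omega>
      let ?x = "norm (S k \<omega> - J \<omega>)"
      have "ennreal ((norm (I k \<omega> - J \<omega>))\<^sup>2) \<le> ennreal (2 * (norm (S k \<omega> - I k \<omega>))\<^sup>2 + 2 * ?x\<^sup>2)"
        using norm_add_square_le[of "I k \<omega> - S k \<omega>" "S k \<omega> - J \<omega>"] by (intro ennreal_leI) (simp add: norm_minus_commute)
      also have "\<dots> = 2 * ennreal ((norm (S k \<omega> - I k \<omega>))\<^sup>2) + 2 * ennreal (?x\<^sup>2)"
        by (simp add: ennreal_plus ennreal_mult)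
      finally have "min 1 (ennreal ((norm (I k \<omega> - J \<omega>))\<^sup>2)) \<le> min 1 (2 * ennreal ((norm (S k \<omega> - I k \<omega>))\<^sup>2) + 2 * ennreal (?x\<^sup>2))"
        by (intro min.mono order_refl)
      also have "\<dots> \<le> 2 * min 1 (ennreal ((norm (S k \<omega> - I k \<omega>))\<^sup>2)) + 2 * min 1 (ennreal (?x\<^sup>2))"
        by (rule order_trans[OF min_one_add_le]) (intro add_mono min_one_mult_2_le)
      \<comment> \<open>The estimates produce squared norms, whereas the definition of the integral
        speaks of norms; under the truncation at 1 a square is the smaller of the two.\<close>
      also have "min 1 (ennreal (?x\<^sup>2)) \<le> min 1 (ennreal ?x)"
      proof (cases "?x \<le> 1")
        case True
        then have "?x\<^sup>2 \<le> ?x" by (simp add: power2_eq_square mult_left_le)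
        then show ?thesis by (intro min.mono order_refl ennreal_leI)
      next
        case False
        then have "min 1 (ennreal ?x) = 1" by (simp add: min_def)
        then show ?thesis by simp
      qed
      finally show "min 1 (ennreal ((norm (I k \<omega> - J \<omega>))\<^sup>2)) \<le> 2 * min 1 (ennreal ((norm (S k \<omega> - I k \<omega>))\<^sup>2)) + 2 * min 1 (ennreal ?x)"
        by (simp add: add_left_mono mult_left_mono)
    qed
    also have "\<dots> = 2 * (\<integral>\<^sup>+\<omega>. min 1 (ennreal ((norm (S k \<omega> - I k \<omega>))\<^sup>2)) \<partial>P) + 2 * (\<integral>\<^sup>+\<omega>. min 1 (ennreal (norm (S k \<omega> - J \<omega>))) \<partial>P)"
      by (simp add: nn_integral_add nn_integral_cmult)
    also have "(\<integral>\<^sup>+\<omega>. min 1 (ennreal ((norm (S k \<omega> - I k \<omega>))\<^sup>2)) \<partial>P) \<le>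
        ennreal C * (\<integral>\<^sup>+\<omega>. min 1 (\<integral>\<^sup>+r\<in>{0..t}. ennreal ((norm (h' k r \<omega> - h k r \<omega>))\<^sup>2) \<partial>lborel) \<partial>P)"
      unfolding S_def I_def h_def h'_def by (rule C(2)[OF t D' D])
    also have "(\<integral>\<^sup>+\<omega>. min 1 (\<integral>\<^sup>+r\<in>{0..t}. ennreal ((norm (h' k r \<omega> - h k r \<omega>))\<^sup>2) \<partial>lborel) \<partial>P) \<le>
        (\<integral>\<^sup>+\<omega>. 2 * min 1 (e k \<omega>) + 2 * min 1 (d k \<omega>) \<partial>P)"
    proof (rule nn_integral_mono)
      fix \<omega> assume "\<omega> \<in> space P"
      from hh[OF this, of k] have "min 1 (\<integral>\<^sup>+r\<in>{0..t}. ennreal ((norm (h' k r \<omega> - h k r \<omega>))\<^sup>2) \<partial>lborel) \<le> min 1 (2 * e k \<omega> + 2 * d k \<omega>)"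
        by (intro min.mono order_refl)
      also have "\<dots> \<le> 2 * min 1 (e k \<omega>) + 2 * min 1 (d k \<omega>)"
        by (rule order_trans[OF min_one_add_le]) (intro add_mono min_one_mult_2_le)
      finally show "min 1 (\<integral>\<^sup>+r\<in>{0..t}. ennreal ((norm (h' k r \<omega> - h k r \<omega>))\<^sup>2) \<partial>lborel) \<le> 2 * min 1 (e k \<omega>) + 2 * min 1 (d k \<omega>)" .
    qed
    also have "\<dots> = 2 * (\<integral>\<^sup>+\<omega>. min 1 (e k \<omega>) \<partial>P) + 2 * (\<integral>\<^sup>+\<omega>. min 1 (d k \<omega>) \<partial>P)"
      by (simp add: nn_integral_add nn_integral_cmult)
    finally show ?thesis by (simp add: add_right_mono mult_left_mono)
  qed
  have two: "(2::ennreal) < top" by simp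
  have "(\<lambda>k. 2 * (ennreal C * (2 * (\<integral>\<^sup>+\<omega>. min 1 (e k \<omega>) \<partial>P) + 2 * (\<integral>\<^sup>+\<omega>. min 1 (d k \<omega>) \<partial>P))) +
     2 * (\<integral>\<^sup>+\<omega>. min 1 (ennreal (norm (S k \<omega> - J \<omega>))) \<partial>P)) \<longlonglongrightarrow> 2 * (ennreal C * (2 * 0 + 2 * 0)) + 2 * 0"
    by (intro tendsto_add ennreal_tendsto_cmult lims two ennreal_less_top)
  then have lim0: "(\<lambda>k. 2 * (ennreal C * (2 * (\<integral>\<^sup>+\<omega>. min 1 (e k \<omega>) \<partial>P) + 2 * (\<integral>\<^sup>+\<omega>. min 1 (d k \<omega>) \<partial>P))) +
     2 * (\<integral>\<^sup>+\<omega>. min 1 (ennreal (norm (S k \<omega> - J \<omega>))) \<partial>P)) \<longlonglongrightarrow> 0" by simp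
  have "(\<lambda>k. \<integral>\<^sup>+\<omega>. min 1 (ennreal ((norm (I k \<omega> - J \<omega>))\<^sup>2)) \<partial>P) \<longlonglongrightarrow> 0"
    by (rule tendsto_sandwich[OF _ always_eventually[OF allI[OF bound]] tendsto_const lim0]) simp
  then show ?thesis unfolding I_def .
qed

end

text \<open>\<open>G\<close> is any measurable bound for the power \<open>q / 2\<close> of the quadratic variation; stating the bound through
  the real numbers \<open>K\<close> below the quadratic variation avoids real powers in \<open>[0, \<infinity>]\<close>.\<close>

lemma (in wiener_process) ito_integral_block_moment:
  fixes q :: real
  assumes q: "2 \<le> q"
  obtains C where "0 \<le> C" "\<And>(H :: real \<Rightarrow> 'a \<Rightarrow> real ^ 'm ^ 'n) J t M x z G.
    time_grid t M \<Longrightarrow> t 0 = 0 \<Longrightarrow> (\<And>n. n \<le> M \<Longrightarrow> has_ito_integral P F W (t n) H (J n)) \<Longrightarrow>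
    (\<And>j. j < M \<Longrightarrow> x j \<in> borel_measurable (F (t j))) \<Longrightarrow> (\<And>j. j < M \<Longrightarrow> z j \<in> borel_measurable (F (t j))) \<Longrightarrow>
    G \<in> borel_measurable P \<Longrightarrow>
    (\<And>\<omega> K. \<omega> \<in> space P \<Longrightarrow> 0 \<le> K \<Longrightarrow> ennreal K \<le> (\<Sum>j<M. \<integral>\<^sup>+r\<in>{t j..t (Suc j)}.
        ennreal ((norm (x j \<omega>) * norm (H r \<omega> - z j \<omega>))\<^sup>2) \<partial>lborel) \<Longrightarrow> ennreal (K powr (q / 2)) \<le> G \<omega>) \<Longrightarrow>
    (\<integral>\<^sup>+\<omega>. ennreal (running_max (\<lambda>n. \<Sum>j<n. x j \<omega> \<bullet>
        (J (Suc j) \<omega> - J j \<omega> - z j \<omega> *v (W (t (Suc j)) \<omega> - W (t j) \<omega>))) M powr q) \<partial>P) \<le>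
    ennreal C * (\<integral>\<^sup>+\<omega>. G \<omega> \<partial>P)"
proof -
  obtain C where C: "0 \<le> C" "\<And>N s (\<xi> :: nat \<Rightarrow> 'a \<Rightarrow> real ^ 'm ^ 'n) t M x z K.
    simple_process_data F (t M) N s \<xi> \<Longrightarrow> time_grid t M \<Longrightarrow> t 0 = 0 \<Longrightarrow>
    (\<And>j. j < M \<Longrightarrow> x j \<in> borel_measurable (F (t j))) \<Longrightarrow> (\<And>j. j < M \<Longrightarrow> z j \<in> borel_measurable (F (t j))) \<Longrightarrow> 0 \<le> K \<Longrightarrow>
    \<exists>Q. Q \<in> borel_measurable P \<and> (\<forall>\<omega>. 0 \<le> Q \<omega> \<and> ennreal (Q \<omega>) \<le> (\<Sum>j<M. \<integral>\<^sup>+r\<in>{t j..t (Suc j)}.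
        ennreal ((norm (x j \<omega>) * norm (simple_process N s \<xi> r \<omega> - z j \<omega>))\<^sup>2) \<partial>lborel)) \<and>
      (\<integral>\<^sup>+\<omega>. (if Q \<omega> \<le> K then ennreal (running_max (\<lambda>n. \<Sum>j<n. x j \<omega> \<bullet>
        (stopped_integral N s (\<lambda>i. \<xi> i \<omega>) (\<lambda>r. W r \<omega>) (t (Suc j)) - stopped_integral N s (\<lambda>i. \<xi> i \<omega>) (\<lambda>r. W r \<omega>) (t j) -
          z j \<omega> *v (W (t (Suc j)) \<omega> - W (t j) \<omega>))) M powr q) else 0) \<partial>P) \<le>
      ennreal C * (\<integral>\<^sup>+\<omega>. ennreal (min (Q \<omega>) K powr (q / 2)) \<partial>P)"
    using simple_integral_block_moment[OF q] by blast
  \<comment> \<open>\<open>4 powr (q / 2)\<close> is the loss of comparing the quadratic variation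
    of the approximations with that of the limit. The summand 1 makes \<open>C'\<close> positive, so
    that the claim is trivial when the integral of \<open>G\<close> is infinite.\<close>
  define C' where "C' = C * 4 powr (q / 2) + 1"
  have C': "0 < C'" using C(1) unfolding C'_def by (intro add_nonneg_pos mult_nonneg_nonneg) auto
  show ?thesis
  proof (rule that[of C'])
    show "0 \<le> C'" using C' by simp
    fix H :: "real \<Rightarrow> 'a \<Rightarrow> real ^ 'm ^ 'n" and J and t :: "nat \<Rightarrow> real" and M
      and x :: "nat \<Rightarrow> 'a \<Rightarrow> real ^ 'n" and z :: "nat \<Rightarrow> 'a \<Rightarrow> real ^ 'm ^ 'n" and G :: "'a \<Rightarrow> ennreal"
    assume T: "time_grid t M" and t0: "t 0 = 0"
      and J: "\<And>n. n \<le> M \<Longrightarrow> has_ito_integral P F W (t n) H (J n)"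
      and x: "\<And>j. j < M \<Longrightarrow> x j \<in> borel_measurable (F (t j))"
      and z: "\<And>j. j < M \<Longrightarrow> z j \<in> borel_measurable (F (t j))"
      and G[measurable]: "G \<in> borel_measurable P"
      and QG: "\<And>\<omega> K. \<omega> \<in> space P \<Longrightarrow> 0 \<le> K \<Longrightarrow> ennreal K \<le> (\<Sum>j<M. \<integral>\<^sup>+r\<in>{t j..t (Suc j)}.
        ennreal ((norm (x j \<omega>) * norm (H r \<omega> - z j \<omega>))\<^sup>2) \<partial>lborel) \<Longrightarrow> ennreal (K powr (q / 2)) \<le> G \<omega>"
    interpret T: time_grid t M by fact
    have tn: "0 \<le> t n" "t n \<le> t M" if "n \<le> M" for n
      using T.u_le_iff[of 0 n] T.u_le_iff[of n M] that t0 by auto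
    have xP: "x j \<in> borel_measurable P" and zP: "z j \<in> borel_measurable P" if "j < M" for j
      using x[OF that] z[OF that] tn[of j] that by (auto intro: F_measurable_P)
    have JP: "J n \<in> borel_measurable P" if "n \<le> M" for n
      using J[OF that] by (simp add: has_ito_integral_def)
    have WP: "W (t n) \<in> borel_measurable P" if "n \<le> M" for n
      using tn[OF that] by (intro W_measurable_P)
    have prog: "progressively_measurable F (t M) H" using J[of M] by (simp add: has_ito_integral_def)
    obtain N s and \<xi> :: "nat \<Rightarrow> nat \<Rightarrow> 'a \<Rightarrow> real ^ 'm ^ 'n" where
      D: "\<And>k. simple_process_data F (t M) (N k) (s k) (\<xi> k)"
      and lim: "tends_to_zero_in_prob P (\<lambda>k \<omega>. \<integral>\<^sup>+r\<in>{0..t M}.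
        ennreal ((norm (simple_process (N k) (s k) (\<xi> k) r \<omega> - H r \<omega>))\<^sup>2) \<partial>lborel)"
      using J[of M] unfolding has_ito_integral_def by blast
    define I where "I k n \<omega> = stopped_integral (N k) (s k) (\<lambda>i. \<xi> k i \<omega>) (\<lambda>r. W r \<omega>) (t n)" for k n \<omega>
    define d where "d k \<omega> = (\<integral>\<^sup>+r\<in>{0..t M}. ennreal ((norm (simple_process (N k) (s k) (\<xi> k) r \<omega> - H r \<omega>))\<^sup>2) \<partial>lborel)" for k \<omega>
    have dP[measurable]: "d k \<in> borel_measurable P" for k
      using lim unfolding d_def tends_to_zero_in_prob_def by blast
    have IP: "I k n \<in> borel_measurable P" if "n \<le> M" for k n
      unfolding I_def by (rule stopped_integral_measurable[OF D]) (use tn[OF that] in simp)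
    \<comment> \<open>The error of the integrand and the errors of all \<open>M + 1\<close>
      integrals are added up, so that one almost surely convergent subsequence serves them
      all.\<close>
    define f where "f k \<omega> = d k \<omega> + (\<Sum>n\<le>M. ennreal ((norm (I k n \<omega> - J n \<omega>))\<^sup>2))" for k \<omega>
    have normP: "(\<lambda>\<omega>. ennreal ((norm (I k n \<omega> - J n \<omega>))\<^sup>2)) \<in> borel_measurable P" if "n \<le> M" for k n
    proof -
      have [measurable]: "I k n \<in> borel_measurable P" "J n \<in> borel_measurable P" using IP JP that by auto
      show ?thesis by measurable
    qed
    have fP: "f k \<in> borel_measurable P" for k
      unfolding f_def using normP by (intro borel_measurable_add dP borel_measurable_sum) auto
    have "(\<lambda>k. \<integral>\<^sup>+\<omega>. min 1 (f k \<omega>) \<partial>P) \<longlonglongrightarrow> 0"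
    proof (rule tendsto_sandwich[OF _ _ tendsto_const])
      show "\<forall>\<^sub>F k in sequentially. (\<integral>\<^sup>+\<omega>. min 1 (f k \<omega>) \<partial>P) \<le> (\<integral>\<^sup>+\<omega>. min 1 (d k \<omega>) \<partial>P) +
          (\<Sum>n\<le>M. \<integral>\<^sup>+\<omega>. min 1 (ennreal ((norm (I k n \<omega> - J n \<omega>))\<^sup>2)) \<partial>P)"
      proof (intro always_eventually allI)
        fix k
        have "(\<integral>\<^sup>+\<omega>. min 1 (f k \<omega>) \<partial>P) \<le> (\<integral>\<^sup>+\<omega>. min 1 (d k \<omega>) + (\<Sum>n\<le>M. min 1 (ennreal ((norm (I k n \<omega> - J n \<omega>))\<^sup>2))) \<partial>P)"
          unfolding f_def
          by (intro nn_integral_mono order_trans[OF min_one_add_le] add_left_mono min_one_sum_le)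
        also have "\<dots> = (\<integral>\<^sup>+\<omega>. min 1 (d k \<omega>) \<partial>P) + (\<integral>\<^sup>+\<omega>. (\<Sum>n\<le>M. min 1 (ennreal ((norm (I k n \<omega> - J n \<omega>))\<^sup>2))) \<partial>P)"
          using normP by (intro nn_integral_add borel_measurable_sum borel_measurable_min) auto
        also have "(\<integral>\<^sup>+\<omega>. (\<Sum>n\<le>M. min 1 (ennreal ((norm (I k n \<omega> - J n \<omega>))\<^sup>2))) \<partial>P) =
            (\<Sum>n\<le>M. \<integral>\<^sup>+\<omega>. min 1 (ennreal ((norm (I k n \<omega> - J n \<omega>))\<^sup>2)) \<partial>P)"
          using normP by (intro nn_integral_sum borel_measurable_min) auto
        finally show "(\<integral>\<^sup>+\<omega>. min 1 (f k \<omega>) \<partial>P) \<le> (\<integral>\<^sup>+\<omega>. min 1 (d k \<omega>) \<partial>P) +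
          (\<Sum>n\<le>M. \<integral>\<^sup>+\<omega>. min 1 (ennreal ((norm (I k n \<omega> - J n \<omega>))\<^sup>2)) \<partial>P)" .
      qed
      have "(\<lambda>k. (\<integral>\<^sup>+\<omega>. min 1 (d k \<omega>) \<partial>P) + (\<Sum>n\<le>M. \<integral>\<^sup>+\<omega>. min 1 (ennreal ((norm (I k n \<omega> - J n \<omega>))\<^sup>2)) \<partial>P))
          \<longlonglongrightarrow> 0 + (\<Sum>n\<le>M. 0)"
      proof (intro tendsto_add tendsto_sum)
        show "(\<lambda>k. \<integral>\<^sup>+\<omega>. min 1 (d k \<omega>) \<partial>P) \<longlonglongrightarrow> 0"
          unfolding d_def by (rule tends_to_zero_in_prob_ky_fan[OF lim])
        fix n assume "n \<in> {..M}"
        then show "(\<lambda>k. \<integral>\<^sup>+\<omega>. min 1 (ennreal ((norm (I k n \<omega> - J n \<omega>))\<^sup>2)) \<partial>P) \<longlonglongrightarrow> 0"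
          unfolding I_def using tn by (intro stopped_integral_tendsto[OF _ _ J prog D lim]) auto
      qed
      then show "(\<lambda>k. (\<integral>\<^sup>+\<omega>. min 1 (d k \<omega>) \<partial>P) + (\<Sum>n\<le>M. \<integral>\<^sup>+\<omega>. min 1 (ennreal ((norm (I k n \<omega> - J n \<omega>))\<^sup>2)) \<partial>P))
          \<longlonglongrightarrow> 0" by simp
    qed simp
    from ky_fan_AE_subseq[OF fP this] obtain \<rho> where \<rho>: "AE \<omega> in P. (\<lambda>k. f (\<rho> k) \<omega>) \<longlonglongrightarrow> 0" by blast
    have AE_lim: "AE \<omega> in P. (\<lambda>k. d (\<rho> k) \<omega>) \<longlonglongrightarrow> 0 \<and> (\<forall>n\<le>M. (\<lambda>k. I (\<rho> k) n \<omega>) \<longlonglongrightarrow> J n \<omega>)"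
      using \<rho>
    proof eventually_elim
      case (elim \<omega>)
      have "(\<lambda>k. d (\<rho> k) \<omega>) \<longlonglongrightarrow> 0"
        by (rule tendsto_sandwich[OF _ _ tendsto_const elim]) (auto simp: f_def)
      moreover have "(\<lambda>k. I (\<rho> k) n \<omega>) \<longlonglongrightarrow> J n \<omega>" if n: "n \<le> M" for n
      proof -
        have "(\<lambda>k. ennreal ((norm (I (\<rho> k) n \<omega> - J n \<omega>))\<^sup>2)) \<longlonglongrightarrow> ennreal 0"
        proof (rule tendsto_sandwich[OF _ _ tendsto_const])
          show "(\<lambda>k. f (\<rho> k) \<omega>) \<longlonglongrightarrow> ennreal 0" using elim by simp
          show "\<forall>\<^sub>F k in sequentially. ennreal ((norm (I (\<rho> k) n \<omega> - J n \<omega>))\<^sup>2) \<le> f (\<rho> k) \<omega>"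
            unfolding f_def using n
            by (intro always_eventually allI add_increasing member_le_sum) auto
        qed simp
        then have "(\<lambda>k. (norm (I (\<rho> k) n \<omega> - J n \<omega>))\<^sup>2) \<longlonglongrightarrow> 0" by (subst (asm) tendsto_ennreal_iff) auto
        then have "(\<lambda>k. norm (I (\<rho> k) n \<omega> - J n \<omega>)) \<longlonglongrightarrow> 0"
          using tendsto_real_sqrt[of _ 0] by fastforce
        then show ?thesis using LIM_zero_cancel tendsto_norm_zero_iff by blast
      qed
      ultimately show ?case by blast
    qed
    define Y where "Y (J' :: nat \<Rightarrow> 'a \<Rightarrow> real ^ 'n) \<omega> = running_max (\<lambda>n. \<Sum>j<n. x j \<omega> \<bullet>
        (J' (Suc j) \<omega> - J' j \<omega> - z j \<omega> *v (W (t (Suc j)) \<omega> - W (t j) \<omega>))) M powr q" for J' \<omega>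
    have YP: "Y J' \<in> borel_measurable P" if "\<And>n. n \<le> M \<Longrightarrow> J' n \<in> borel_measurable P" for J'
    proof -
      have [measurable]: "(\<lambda>\<omega>. running_max (\<lambda>n. \<Sum>j<n. x j \<omega> \<bullet>
        (J' (Suc j) \<omega> - J' j \<omega> - z j \<omega> *v (W (t (Suc j)) \<omega> - W (t j) \<omega>))) M) \<in> borel_measurable P"
      proof (intro running_max_measurable borel_measurable_sum)
        fix k j assume "k \<le> M" "j \<in> {..<k}"
        then have [measurable]: "x j \<in> borel_measurable P" "z j \<in> borel_measurable P" "J' (Suc j) \<in> borel_measurable P" "J' j \<in> borel_measurable P"
          "W (t (Suc j)) \<in> borel_measurable P" "W (t j) \<in> borel_measurable P" using xP zP that WP by auto
        show "(\<lambda>\<omega>. x j \<omega> \<bullet> (J' (Suc j) \<omega> - J' j \<omega> - z j \<omega> *v (W (t (Suc j)) \<omega> - W (t j) \<omega>))) \<in> borel_measurable P"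
          by measurable
      qed
      show ?thesis unfolding Y_def by measurable
    qed
    have YJ[measurable]: "Y J \<in> borel_measurable P" and YI[measurable]: "\<And>k. Y (I k) \<in> borel_measurable P"
      using YP JP IP by auto
    define B where "B \<omega> = (\<Sum>j<M. (norm (x j \<omega>))\<^sup>2)" for \<omega>
    have B0: "0 \<le> B \<omega>" for \<omega> unfolding B_def by (intro sum_nonneg) simp
    have BP[measurable]: "B \<in> borel_measurable P"
      unfolding B_def using xP by (intro borel_measurable_sum borel_measurable_power borel_measurable_norm) auto
    define QH where "QH \<omega> = (\<Sum>j<M. \<integral>\<^sup>+r\<in>{t j..t (Suc j)}.
        ennreal ((norm (x j \<omega>) * norm (H r \<omega> - z j \<omega>))\<^sup>2) \<partial>lborel)" for \<omega>
    have Qk: "(\<Sum>j<M. \<integral>\<^sup>+r\<in>{t j..t (Suc j)}.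
        ennreal ((norm (x j \<omega>) * norm (simple_process (N k) (s k) (\<xi> k) r \<omega> - z j \<omega>))\<^sup>2) \<partial>lborel) \<le>
        2 * QH \<omega> + 2 * ennreal (B \<omega>) * d k \<omega>" if \<omega>: "\<omega> \<in> space P" for k \<omega>
    proof -
      have "(\<Sum>j<M. \<integral>\<^sup>+r\<in>{t j..t (Suc j)}.
        ennreal ((norm (x j \<omega>) * norm (simple_process (N k) (s k) (\<xi> k) r \<omega> - z j \<omega>))\<^sup>2) \<partial>lborel) \<le>
        (\<Sum>j<M. 2 * (\<integral>\<^sup>+r\<in>{t j..t (Suc j)}. ennreal ((norm (x j \<omega>) * norm (H r \<omega> - z j \<omega>))\<^sup>2) \<partial>lborel) +
          2 * ennreal ((norm (x j \<omega>))\<^sup>2) * d k \<omega>)"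
        unfolding d_def
      proof (intro sum_mono set_nn_integral_block_split progressively_measurable_path[OF prog] \<omega>)
        fix j assume "j \<in> {..<M}"
        then show "{t j..t (Suc j)} \<subseteq> {0..t M}" using tn[of j] tn[of "Suc j"] by auto
      qed (auto intro: measurable_restrict_space1 simple_process_measurable tn)
      also have "\<dots> = 2 * QH \<omega> + 2 * ennreal (B \<omega>) * d k \<omega>"
        unfolding QH_def B_def by (simp add: sum.distrib sum_distrib_left sum_distrib_right flip: sum_ennreal)
      finally show ?thesis .
    qed
    \<comment> \<open>Fatou's lemma on the event \<open>G < (K / 4) powr (q / 2)\<close>, where the truncation at \<open>K\<close> is eventually inactive.\<close>
    have main: "(\<integral>\<^sup>+\<omega>. (if G \<omega> < ennreal ((K / 4) powr (q / 2)) then ennreal (Y J \<omega>) else 0) \<partial>P) \<le>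
        ennreal C * (ennreal (4 powr (q / 2)) * (\<integral>\<^sup>+\<omega>. G \<omega> \<partial>P))" if K: "0 < K" for K :: real
    proof -
      let ?R = "\<lambda>k \<omega>. \<Sum>j<M. \<integral>\<^sup>+r\<in>{t j..t (Suc j)}.
        ennreal ((norm (x j \<omega>) * norm (simple_process (N (\<rho> k)) (s (\<rho> k)) (\<xi> (\<rho> k)) r \<omega> - z j \<omega>))\<^sup>2) \<partial>lborel"
      have "\<exists>Q. Q \<in> borel_measurable P \<and> (\<forall>\<omega>. 0 \<le> Q \<omega> \<and> ennreal (Q \<omega>) \<le> ?R k \<omega>) \<and>
        (\<integral>\<^sup>+\<omega>. (if Q \<omega> \<le> K then ennreal (Y (I (\<rho> k)) \<omega>) else 0) \<partial>P) \<le>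
        ennreal C * (\<integral>\<^sup>+\<omega>. ennreal (min (Q \<omega>) K powr (q / 2)) \<partial>P)" for k
        unfolding Y_def I_def by (rule C(2)[OF D T t0 x z less_imp_le[OF K]])
      from choice[OF allI[OF this]] obtain Q where Q_all: "\<forall>k. Q k \<in> borel_measurable P \<and>
        (\<forall>\<omega>. 0 \<le> Q k \<omega> \<and> ennreal (Q k \<omega>) \<le> ?R k \<omega>) \<and>
        (\<integral>\<^sup>+\<omega>. (if Q k \<omega> \<le> K then ennreal (Y (I (\<rho> k)) \<omega>) else 0) \<partial>P) \<le>
        ennreal C * (\<integral>\<^sup>+\<omega>. ennreal (min (Q k \<omega>) K powr (q / 2)) \<partial>P)" ..
      then have Q[measurable]: "\<And>k. Q k \<in> borel_measurable P"
        and Q0: "\<And>k \<omega>. 0 \<le> Q k \<omega>"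
        and Q1: "\<And>k \<omega>. ennreal (Q k \<omega>) \<le> ?R k \<omega>"
        and Q2: "\<And>k. (\<integral>\<^sup>+\<omega>. (if Q k \<omega> \<le> K then ennreal (Y (I (\<rho> k)) \<omega>) else 0) \<partial>P) \<le>
        ennreal C * (\<integral>\<^sup>+\<omega>. ennreal (min (Q k \<omega>) K powr (q / 2)) \<partial>P)"
        by blast+
      have Qle: "ennreal (Q k \<omega>) \<le> 2 * QH \<omega> + 2 * ennreal (B \<omega>) * d (\<rho> k) \<omega>" if "\<omega> \<in> space P" for k \<omega>
        using Q1 Qk[OF that] by (rule order_trans)
      \<comment> \<open>A bound for the truncated variation where the approximation error dominates.
        It is at most \<open>K powr (q / 2)\<close>, as dominated convergence requires; the case of
        infinite \<open>d\<close> is separate because \<open>enn2real\<close> would turn it into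
        0.\<close>
      define h where "h k \<omega> = (if d (\<rho> k) \<omega> < top then min (K powr (q / 2)) ((4 * (B \<omega> * enn2real (d (\<rho> k) \<omega>))) powr (q / 2))
          else K powr (q / 2))" for k \<omega>
      have hP[measurable]: "h k \<in> borel_measurable P" for k unfolding h_def by measurable
      \<comment> \<open>Either the truncated variation is at most \<open>4 * B * d\<close>, and
        \<open>h\<close> bounds its power, or the error \<open>2 * B * d\<close> is less than half
        of it. In the second case a quarter of it lies below \<open>QH\<close>, and \<open>G\<close>
        bounds its power.\<close>
      have pt: "ennreal (min (Q k \<omega>) K powr (q / 2)) \<le> ennreal (4 powr (q / 2)) * G \<omega> + ennreal (h k \<omega>)"
        if \<omega>: "\<omega> \<in> space P" for k \<omega>
      proof (cases "d (\<rho> k) \<omega> < top \<and> 4 * (B \<omega> * enn2real (d (\<rho> k) \<omega>)) < min (Q k \<omega>) K")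
        case False
        have "min (Q k \<omega>) K powr (q / 2) \<le> h k \<omega>"
          using False Q0[of k \<omega>] K q by (auto simp: h_def not_less intro!: powr_mono2)
        then show ?thesis by (intro add_increasing) (auto intro: ennreal_leI)
      next
        case True
        define e where "e = enn2real (d (\<rho> k) \<omega>)"
        have e: "d (\<rho> k) \<omega> = ennreal e" "0 \<le> e" using True by (auto simp: e_def)
        define m where "m = min (Q k \<omega>) K"
        have m: "0 \<le> m" "4 * (B \<omega> * e) < m" using True Q0[of k \<omega>] K by (auto simp: m_def e_def)
        have "ennreal m \<le> 2 * QH \<omega> + ennreal (2 * (B \<omega> * e))"
        proof -
          have "ennreal m \<le> ennreal (Q k \<omega>)" by (intro ennreal_leI) (simp add: m_def)
          also have "\<dots> \<le> 2 * QH \<omega> + 2 * ennreal (B \<omega>) * ennreal e" using Qle[OF \<omega>, of k] by (simp add: e)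
          also have "2 * ennreal (B \<omega>) * ennreal e = ennreal (2 * (B \<omega> * e))"
            using B0[of \<omega>] e(2) by (simp add: ennreal_mult mult.assoc)
          finally show ?thesis .
        qed
        then have "ennreal (m / 4) \<le> QH \<omega>"
        proof (cases "QH \<omega>")
          case (real y)
          then have "ennreal m \<le> ennreal (2 * y + 2 * (B \<omega> * e))"
            using \<open>ennreal m \<le> _\<close> B0[of \<omega>] e(2) by (simp add: ennreal_plus ennreal_mult)
          then have "m \<le> 2 * y + 2 * (B \<omega> * e)" using real B0[of \<omega>] e(2) by (subst (asm) ennreal_le_iff) auto
          then show ?thesis using m real by (simp add: ennreal_leI)
        qed simp
        then have "ennreal ((m / 4) powr (q / 2)) \<le> G \<omega>"
          using m unfolding QH_def by (intro QG[OF \<omega>]) auto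
        then have "ennreal (4 powr (q / 2)) * ennreal ((m / 4) powr (q / 2)) \<le> ennreal (4 powr (q / 2)) * G \<omega>"
          by (rule mult_left_mono) simp
        moreover have "ennreal (4 powr (q / 2)) * ennreal ((m / 4) powr (q / 2)) = ennreal (m powr (q / 2))"
          using m by (simp add: powr_divide flip: ennreal_mult)
        ultimately show ?thesis unfolding m_def by (intro add_increasing2) auto
      qed
      have "(\<lambda>k. \<integral>\<^sup>+\<omega>. ennreal (h k \<omega>) \<partial>P) \<longlonglongrightarrow> (\<integral>\<^sup>+\<omega>. 0 \<partial>P)"
      proof (rule nn_integral_dominated_convergence[where w = "\<lambda>_. ennreal (K powr (q / 2))"])
        show "AE \<omega> in P. ennreal (h k \<omega>) \<le> ennreal (K powr (q / 2))" for k
          by (auto simp: h_def intro!: ennreal_leI)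
        show "(\<integral>\<^sup>+\<omega>. ennreal (K powr (q / 2)) \<partial>P) < \<infinity>" by (simp add: emeasure_space_1)
        show "AE \<omega> in P. (\<lambda>k. ennreal (h k \<omega>)) \<longlonglongrightarrow> 0"
          using AE_lim
        proof eventually_elim
          case (elim \<omega>)
          then have d: "(\<lambda>k. d (\<rho> k) \<omega>) \<longlonglongrightarrow> ennreal 0" by simp
          then have ev: "\<forall>\<^sub>F k in sequentially. d (\<rho> k) \<omega> < top" by (rule order_tendstoD) simp
          have "(\<lambda>k. enn2real (d (\<rho> k) \<omega>)) \<longlonglongrightarrow> 0" by (rule tendsto_enn2real[OF d order_refl])
          then have "(\<lambda>k. 4 * (B \<omega> * enn2real (d (\<rho> k) \<omega>))) \<longlonglongrightarrow> 4 * (B \<omega> * 0)" by (intro tendsto_mult tendsto_const)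
          then have "(\<lambda>k. (4 * (B \<omega> * enn2real (d (\<rho> k) \<omega>))) powr (q / 2)) \<longlonglongrightarrow> (4 * (B \<omega> * 0)) powr (q / 2)"
            using q B0[of \<omega>] by (intro tendsto_powr2 tendsto_const) auto
          then have "(\<lambda>k. min (K powr (q / 2)) ((4 * (B \<omega> * enn2real (d (\<rho> k) \<omega>))) powr (q / 2))) \<longlonglongrightarrow>
              min (K powr (q / 2)) ((4 * (B \<omega> * 0)) powr (q / 2))"
            by (intro tendsto_min tendsto_const)
          then have "(\<lambda>k. h k \<omega>) \<longlonglongrightarrow> 0"
            using ev by (subst tendsto_cong) (auto simp: h_def elim!: eventually_mono)
          then have "(\<lambda>k. ennreal (h k \<omega>)) \<longlonglongrightarrow> ennreal 0" by (rule tendsto_ennrealI)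
          then show ?case by simp
        qed
      qed auto
      then have h_lim: "(\<lambda>k. \<integral>\<^sup>+\<omega>. ennreal (h k \<omega>) \<partial>P) \<longlonglongrightarrow> 0" by simp
      have "(\<integral>\<^sup>+\<omega>. (if G \<omega> < ennreal ((K / 4) powr (q / 2)) then ennreal (Y J \<omega>) else 0) \<partial>P) \<le>
          (\<integral>\<^sup>+\<omega>. liminf (\<lambda>k. if Q k \<omega> \<le> K then ennreal (Y (I (\<rho> k)) \<omega>) else 0) \<partial>P)"
      proof (rule nn_integral_mono_AE)
        show "AE \<omega> in P. (if G \<omega> < ennreal ((K / 4) powr (q / 2)) then ennreal (Y J \<omega>) else 0) \<le>
            liminf (\<lambda>k. if Q k \<omega> \<le> K then ennreal (Y (I (\<rho> k)) \<omega>) else 0)"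
          using AE_lim AE_space
        proof eventually_elim
          case (elim \<omega>)
          show ?case
          proof (cases "G \<omega> < ennreal ((K / 4) powr (q / 2))")
            case True
            \<comment> \<open>Contrapositive of \<open>QG\<close>: smallness of \<open>G\<close>
              forces \<open>QH\<close> below \<open>K / 4\<close>. Doubling leaves a margin of
              \<open>K / 2\<close>, which the vanishing error eventually respects.\<close>
            have "\<not> ennreal (K / 4) \<le> QH \<omega>"
            proof
              assume "ennreal (K / 4) \<le> QH \<omega>"
              then have "ennreal ((K / 4) powr (q / 2)) \<le> G \<omega>"
                unfolding QH_def using K by (intro QG[OF elim(2)]) auto
              with True show False by simp
            qed
            then have "2 * QH \<omega> \<le> 2 * ennreal (K / 4)" by (intro mult_left_mono) auto
            also have "\<dots> = ennreal (K / 2)" using K by (simp add: ennreal_mult[symmetric] flip: ennreal_numeral)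
            finally have QH2: "2 * QH \<omega> \<le> ennreal (K / 2)" .
            have "(\<lambda>k. 2 * ennreal (B \<omega>) * d (\<rho> k) \<omega>) \<longlonglongrightarrow> 2 * ennreal (B \<omega>) * 0"
              using elim by (intro ennreal_tendsto_cmult) (auto simp: ennreal_mult_less_top)
            then have "\<forall>\<^sub>F k in sequentially. 2 * ennreal (B \<omega>) * d (\<rho> k) \<omega> < ennreal (K / 2)"
              by (rule order_tendstoD) (use K in simp)
            then have ev: "\<forall>\<^sub>F k in sequentially. Q k \<omega> \<le> K"
            proof (rule eventually_mono)
              fix k assume k: "2 * ennreal (B \<omega>) * d (\<rho> k) \<omega> < ennreal (K / 2)"
              have "ennreal (Q k \<omega>) \<le> ennreal (K / 2) + ennreal (K / 2)"
                using Qle[OF elim(2), of k] QH2 k by (meson add_mono less_imp_le order_trans)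
              also have "\<dots> = ennreal K" using K by (simp flip: ennreal_plus)
              finally show "Q k \<omega> \<le> K" using K by (subst (asm) ennreal_le_iff) auto
            qed
            have "(\<lambda>k. Y (I (\<rho> k)) \<omega>) \<longlonglongrightarrow> Y J \<omega>"
              unfolding Y_def using elim q
              by (intro tendsto_powr2 tendsto_running_max tendsto_sum tendsto_inner tendsto_diff tendsto_const)
                (auto simp: running_max_nonneg)
            then have "(\<lambda>k. ennreal (Y (I (\<rho> k)) \<omega>)) \<longlonglongrightarrow> ennreal (Y J \<omega>)" by (rule tendsto_ennrealI)
            then have "(\<lambda>k. if Q k \<omega> \<le> K then ennreal (Y (I (\<rho> k)) \<omega>) else 0) \<longlonglongrightarrow> ennreal (Y J \<omega>)"
              using ev by (subst tendsto_cong) (auto elim!: eventually_mono)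
            then show ?thesis using True by (subst lim_imp_Liminf) auto
          qed simp
        qed
      qed
      also have "\<dots> \<le> liminf (\<lambda>k. \<integral>\<^sup>+\<omega>. (if Q k \<omega> \<le> K then ennreal (Y (I (\<rho> k)) \<omega>) else 0) \<partial>P)"
        by (rule nn_integral_liminf) measurable
      also have "\<dots> \<le> liminf (\<lambda>k. ennreal C * (ennreal (4 powr (q / 2)) * (\<integral>\<^sup>+\<omega>. G \<omega> \<partial>P) + (\<integral>\<^sup>+\<omega>. ennreal (h k \<omega>) \<partial>P)))"
      proof (intro Liminf_mono always_eventually allI)
        fix k
        have "(\<integral>\<^sup>+\<omega>. ennreal (min (Q k \<omega>) K powr (q / 2)) \<partial>P) \<le> (\<integral>\<^sup>+\<omega>. ennreal (4 powr (q / 2)) * G \<omega> + ennreal (h k \<omega>) \<partial>P)"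
          using pt by (intro nn_integral_mono)
        also have "\<dots> = ennreal (4 powr (q / 2)) * (\<integral>\<^sup>+\<omega>. G \<omega> \<partial>P) + (\<integral>\<^sup>+\<omega>. ennreal (h k \<omega>) \<partial>P)"
          by (simp add: nn_integral_add nn_integral_cmult)
        finally have "ennreal C * (\<integral>\<^sup>+\<omega>. ennreal (min (Q k \<omega>) K powr (q / 2)) \<partial>P) \<le>
            ennreal C * (ennreal (4 powr (q / 2)) * (\<integral>\<^sup>+\<omega>. G \<omega> \<partial>P) + (\<integral>\<^sup>+\<omega>. ennreal (h k \<omega>) \<partial>P))"
          by (rule mult_left_mono) simp
        with Q2[of k] show "(\<integral>\<^sup>+\<omega>. (if Q k \<omega> \<le> K then ennreal (Y (I (\<rho> k)) \<omega>) else 0) \<partial>P) \<le>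
            ennreal C * (ennreal (4 powr (q / 2)) * (\<integral>\<^sup>+\<omega>. G \<omega> \<partial>P) + (\<integral>\<^sup>+\<omega>. ennreal (h k \<omega>) \<partial>P))"
          by (rule order_trans)
      qed
      also have "\<dots> = ennreal C * (ennreal (4 powr (q / 2)) * (\<integral>\<^sup>+\<omega>. G \<omega> \<partial>P) + 0)"
        by (intro lim_imp_Liminf ennreal_tendsto_cmult tendsto_add tendsto_const h_lim) auto
      finally show ?thesis by simp
    qed
    have "(\<integral>\<^sup>+\<omega>. ennreal (Y J \<omega>) \<partial>P) \<le> ennreal C' * (\<integral>\<^sup>+\<omega>. G \<omega> \<partial>P)"
    proof (cases "(\<integral>\<^sup>+\<omega>. G \<omega> \<partial>P) = top")
      case True
      then show ?thesis using C' by (simp add: ennreal_mult_top)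
    next
      case False
      then have fin: "AE \<omega> in P. G \<omega> \<noteq> \<infinity>" by (intro nn_integral_PInf_AE) auto
      \<comment> \<open>Here \<open>Kn n / 4\<close> is \<open>n + 1\<close>, at least 1, hence at
        most its own power \<open>q / 2\<close>; the events exhaust the set where \<open>G\<close>
        is finite, and Fatou's lemma removes the restriction.\<close>
      define Kn where "Kn n = 4 * (real n + 1)" for n :: nat
      have "(\<integral>\<^sup>+\<omega>. ennreal (Y J \<omega>) \<partial>P) \<le>
          (\<integral>\<^sup>+\<omega>. liminf (\<lambda>n. if G \<omega> < ennreal ((Kn n / 4) powr (q / 2)) then ennreal (Y J \<omega>) else 0) \<partial>P)"
      proof (rule nn_integral_mono_AE)
        show "AE \<omega> in P. ennreal (Y J \<omega>) \<le> liminf (\<lambda>n. if G \<omega> < ennreal ((Kn n / 4) powr (q / 2)) then ennreal (Y J \<omega>) else 0)"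
          using fin
        proof eventually_elim
          case (elim \<omega>)
          then obtain g where g: "G \<omega> = ennreal g" "0 \<le> g" by (cases "G \<omega>") auto
          have "\<forall>\<^sub>F n in sequentially. G \<omega> < ennreal ((Kn n / 4) powr (q / 2))"
          proof (rule eventually_mono[OF eventually_ge_at_top[of "nat \<lceil>g\<rceil>"]])
            fix n assume n: "nat \<lceil>g\<rceil> \<le> n"
            have "g < real n + 1" using n by linarith
            also have "\<dots> \<le> (real n + 1) powr (q / 2)" using powr_mono[of 1 "q / 2" "real n + 1"] q by simp
            finally have "g < (real n + 1) powr (q / 2)" .
            moreover have "Kn n / 4 = real n + 1" by (simp add: Kn_def)
            ultimately show "G \<omega> < ennreal ((Kn n / 4) powr (q / 2))" using g by (simp only: ennreal_less_iff)
          qed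
          then have "\<forall>\<^sub>F n in sequentially. (if G \<omega> < ennreal ((Kn n / 4) powr (q / 2)) then ennreal (Y J \<omega>) else 0) = ennreal (Y J \<omega>)"
            by (rule eventually_mono) simp
          then have "(\<lambda>n. if G \<omega> < ennreal ((Kn n / 4) powr (q / 2)) then ennreal (Y J \<omega>) else 0) \<longlonglongrightarrow> ennreal (Y J \<omega>)"
            by (rule tendsto_eventually)
          then show ?case by (subst lim_imp_Liminf) auto
        qed
      qed
      also have "\<dots> \<le> liminf (\<lambda>n. \<integral>\<^sup>+\<omega>. (if G \<omega> < ennreal ((Kn n / 4) powr (q / 2)) then ennreal (Y J \<omega>) else 0) \<partial>P)"
        by (rule nn_integral_liminf) measurable
      also have "\<dots> \<le> liminf (\<lambda>n::nat. ennreal C * (ennreal (4 powr (q / 2)) * (\<integral>\<^sup>+\<omega>. G \<omega> \<partial>P)))"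
        by (intro Liminf_mono always_eventually allI main) (simp add: Kn_def)
      also have "\<dots> = ennreal (C * 4 powr (q / 2)) * (\<integral>\<^sup>+\<omega>. G \<omega> \<partial>P)"
        using C(1) by (simp add: Liminf_const ennreal_mult mult.assoc)
      also have "\<dots> \<le> ennreal C' * (\<integral>\<^sup>+\<omega>. G \<omega> \<partial>P)"
        by (intro mult_right_mono ennreal_leI) (auto simp: C'_def)
      finally show ?thesis .
    qed
    then show "(\<integral>\<^sup>+\<omega>. ennreal (running_max (\<lambda>n. \<Sum>j<n. x j \<omega> \<bullet>
        (J (Suc j) \<omega> - J j \<omega> - z j \<omega> *v (W (t (Suc j)) \<omega> - W (t j) \<omega>))) M powr q) \<partial>P) \<le>
      ennreal C' * (\<integral>\<^sup>+\<omega>. G \<omega> \<partial>P)"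
      unfolding Y_def .
  qed
qed

section \<open>The implicit step\<close>

text \<open>The one-sided condition makes \<open>y - \<tau> *\<^sub>R b y\<close> expand distances
  by at least \<open>1 - L * \<tau>\<close>, so it is injective with a Lipschitz inverse on its
  range. Outside the range \<open>\<psi>\<close> is set to 0, which yields a Borel function on the
  whole space.\<close>

lemma implicit_step_inverse:
  fixes b :: "'b::euclidean_space \<Rightarrow> 'b"
  assumes b: "continuous_on UNIV b" "\<And>x y. (b x - b y) \<bullet> (x - y) \<le> L * (norm (x - y))\<^sup>2"
    and \<tau>: "0 \<le> \<tau>" "L * \<tau> < 1"
  obtains \<psi> where "\<psi> \<in> borel_measurable borel" "\<And>y. \<psi> (y - \<tau> *\<^sub>R b y) = y"
proof -
  define \<phi> where "\<phi> y = y - \<tau> *\<^sub>R b y" for y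
  define c where "c = 1 - L * \<tau>"
  have c: "0 < c" using \<tau> by (simp add: c_def)
  have cont: "continuous_on UNIV \<phi>" unfolding \<phi>_def by (intro continuous_intros b)
  have expand: "c * norm (x - y) \<le> norm (\<phi> x - \<phi> y)" for x y
  proof (cases "x = y")
    case False
    have "c * (norm (x - y))\<^sup>2 \<le> (norm (x - y))\<^sup>2 - \<tau> * ((b x - b y) \<bullet> (x - y))"
      using mult_left_mono[OF b(2)[of x y] \<tau>(1)] by (simp add: c_def algebra_simps)
    also have "\<dots> = (\<phi> x - \<phi> y) \<bullet> (x - y)"
      by (simp add: \<phi>_def power2_norm_eq_inner inner_diff_left algebra_simps)
    also have "\<dots> \<le> norm (\<phi> x - \<phi> y) * norm (x - y)" by (rule norm_cauchy_schwarz)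
    finally have "c * norm (x - y) * norm (x - y) \<le> norm (\<phi> x - \<phi> y) * norm (x - y)"
      by (simp add: power2_eq_square mult.assoc)
    then show ?thesis using False by simp
  qed simp
  have inj: "inj \<phi>"   proof (rule injI)
    fix x y assume "\<phi> x = \<phi> y"
    then have "c * norm (x - y) \<le> 0" using expand[of x y] by simp
    then show "x = y" using c by (simp add: mult_le_0_iff)
  qed
  \<comment> \<open>The range is a Borel set because it is \<open>\<sigma>\<close>-compact, so surjectivity of \<open>\<phi>\<close> need not be established.\<close>
  have range_eq: "range \<phi> = (\<Union>n::nat. \<phi> ` cball 0 (real n))"
    using real_arch_simple by (force simp: image_iff)
  have [measurable]: "range \<phi> \<in> sets borel"
    unfolding range_eq
    by (intro sets.countable_UN image_subsetI borel_closed compact_imp_closed compact_continuous_image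
      continuous_on_subset[OF cont] compact_cball) auto
  have "continuous_on (range \<phi>) (inv \<phi>)"
  proof (rule lipschitz_on_continuous_on[OF lipschitz_onI])
    fix u v assume "u \<in> range \<phi>" "v \<in> range \<phi>"
    then obtain x y where "u = \<phi> x" "v = \<phi> y" by auto
    then show "dist (inv \<phi> u) (inv \<phi> v) \<le> inverse c * dist u v"
      using expand[of x y] c inj by (simp add: dist_norm field_simps)
  qed (use c in simp)
  then have "(\<lambda>v. indicat_real (range \<phi>) v *\<^sub>R inv \<phi> v) \<in> borel_measurable borel"
    by (intro borel_measurable_continuous_on_indicator) auto
  moreover have "indicat_real (range \<phi>) (y - \<tau> *\<^sub>R b y) *\<^sub>R inv \<phi> (y - \<tau> *\<^sub>R b y) = y" for y
    using inj unfolding \<phi>_def[symmetric] by simp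
  ultimately show ?thesis by (rule that)
qed

text \<open>Adaptedness cannot be inferred from almost sure equations in a filtration that need not
  contain the null sets. \<open>Z\<close> solves the step explicitly by \<open>\<psi>\<close> for
  every outcome, hence is adapted; it agrees with \<open>Y\<close> almost surely because
  \<open>\<psi>\<close> recovers \<open>Y (Suc k)\<close> from
  \<open>Y (Suc k) - \<tau> *\<^sub>R b (Y (Suc k))\<close>.\<close>

lemma (in wiener_process) backward_euler_adapted_version:
  fixes \<sigma> :: "real ^ 'n \<Rightarrow> real ^ 'm ^ 'n"
  assumes b: "continuous_on UNIV b" "\<And>x y. (b x - b y) \<bullet> (x - y) \<le> L * (norm (x - y))\<^sup>2"
    and \<tau>: "0 \<le> \<tau>" "L * \<tau> < 1" and \<sigma>: "continuous_on UNIV \<sigma>"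
    and X0: "X0 \<in> borel_measurable (F 0)" and Y: "backward_euler P W b \<sigma> X0 \<tau> M Y"
  obtains Z where "\<And>k. k \<le> M \<Longrightarrow> Z k \<in> borel_measurable (F (real k * \<tau>))"
    "AE \<omega> in P. \<forall>k\<le>M. Y k \<omega> = Z k \<omega>"
proof -
  obtain \<psi> where \<psi>[measurable]: "\<psi> \<in> borel_measurable borel" and \<psi>_eq: "\<And>y. \<psi> (y - \<tau> *\<^sub>R b y) = y"
    using implicit_step_inverse[OF b \<tau>] by blast
  have [measurable]: "\<sigma> \<in> borel_measurable borel" using \<sigma> by (rule borel_measurable_continuous_onI)
  define Z where "Z = rec_nat X0 (\<lambda>k z \<omega>. \<psi> (z \<omega> + \<sigma> (z \<omega>) *v (W (real (Suc k) * \<tau>) \<omega> - W (real k * \<tau>) \<omega>)))"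
  have Z_0: "Z 0 = X0"
    and Z_Suc: "Z (Suc k) = (\<lambda>\<omega>. \<psi> (Z k \<omega> + \<sigma> (Z k \<omega>) *v (W (real (Suc k) * \<tau>) \<omega> - W (real k * \<tau>) \<omega>)))" for k
    by (simp_all add: Z_def)
  show ?thesis
  proof (rule that[of Z])
    show "Z k \<in> borel_measurable (F (real k * \<tau>))" if "k \<le> M" for k
    proof (induction k)
      case (Suc k)
      have le: "0 \<le> real k * \<tau>" "0 \<le> real (Suc k) * \<tau>" "real k * \<tau> \<le> real (Suc k) * \<tau>" using \<tau>(1) by (auto simp: distrib_right)
      have [measurable]: "Z k \<in> borel_measurable (F (real (Suc k) * \<tau>))"
        using F_measurable_mono[OF Suc le(1,3)] .
      have [measurable]: "W (real (Suc k) * \<tau>) \<in> borel_measurable (F (real (Suc k) * \<tau>))" "W (real k * \<tau>) \<in> borel_measurable (F (real (Suc k) * \<tau>))"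
        using W_measurable_F[OF le(1,3)] W_measurable_F[OF le(2) order_refl] by auto
      show ?case unfolding Z_Suc by measurable
    qed (use X0 Z_0 in simp)
    have "AE \<omega> in P. \<forall>k\<in>{..<M}. Y (Suc k) \<omega> = Y k \<omega> + \<tau> *\<^sub>R b (Y (Suc k) \<omega>) +
      \<sigma> (Y k \<omega>) *v (W (real (Suc k) * \<tau>) \<omega> - W (real k * \<tau>) \<omega>)"
      using Y by (subst AE_ball_countable) (auto simp: backward_euler_def)
    moreover have "AE \<omega> in P. Y 0 \<omega> = X0 \<omega>" using Y by (simp add: backward_euler_def)
    ultimately show "AE \<omega> in P. \<forall>k\<le>M. Y k \<omega> = Z k \<omega>"
    proof eventually_elim
      case (elim \<omega>)
      have "Y k \<omega> = Z k \<omega>" if "k \<le> M" for k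
        using that
      proof (induction k)
        case (Suc k)
        then have "Y (Suc k) \<omega> - \<tau> *\<^sub>R b (Y (Suc k) \<omega>) = Z k \<omega> + \<sigma> (Z k \<omega>) *v (W (real (Suc k) * \<tau>) \<omega> - W (real k * \<tau>) \<omega>)"
          using elim(1)[rule_format, of k] by (simp add: algebra_simps)
        then show ?case unfolding Z_Suc using \<psi>_eq[of "Y (Suc k) \<omega>"] by metis
      qed (use elim Z_0 in simp)
      then show ?case by blast
    qed
  qed
qed

section \<open>The error recursion\<close>

text \<open>Pairing with \<open>e'\<close> produces \<open>(norm (e' - e))\<^sup>2\<close> on the
  left. It is spent on \<open>N \<bullet> (e' - e)\<close>, so that the noise is left paired with
  \<open>e\<close>, which is known before the increment. Young's inequality for
  \<open>R \<bullet> e'\<close> costs the additional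
  \<open>\<epsilon> * \<tau> * (norm e')\<^sup>2\<close>.\<close>

lemma implicit_error_step:
  fixes e e' \<beta> R N :: "'b::real_inner"
  assumes step: "e' = e + \<tau> *\<^sub>R \<beta> + R + N" and \<beta>: "\<beta> \<bullet> e' \<le> L * (norm e')\<^sup>2"
    and pos: "0 < \<tau>" "0 < \<epsilon>"
  shows "(norm e')\<^sup>2 \<le> (norm e)\<^sup>2 + (2 * L + \<epsilon>) * \<tau> * (norm e')\<^sup>2 + (norm R)\<^sup>2 / (\<epsilon> * \<tau>) + 2 * (e \<bullet> N) + (norm N)\<^sup>2"
proof -
  have 1: "(norm e')\<^sup>2 - (norm e)\<^sup>2 + (norm (e' - e))\<^sup>2 = 2 * ((e' - e) \<bullet> e')"
    by (simp add: power2_norm_eq_inner inner_diff_left inner_diff_right inner_commute)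
  have 2: "(e' - e) \<bullet> e' = \<tau> * (\<beta> \<bullet> e') + R \<bullet> e' + e \<bullet> N + N \<bullet> (e' - e)"
    unfolding step by (simp add: inner_add_left inner_add_right inner_diff_right inner_commute algebra_simps)
  have 3: "\<tau> * (\<beta> \<bullet> e') \<le> \<tau> * (L * (norm e')\<^sup>2)" using \<beta> pos by (intro mult_left_mono) auto
  have 4: "2 * (R \<bullet> e') \<le> (norm R)\<^sup>2 / (\<epsilon> * \<tau>) + \<epsilon> * \<tau> * (norm e')\<^sup>2"
  proof -
    define s where "s = sqrt (\<epsilon> * \<tau>)"
    have s: "0 < s" "s\<^sup>2 = \<epsilon> * \<tau>" using pos by (auto simp: s_def)
    have "2 * (R \<bullet> e') \<le> 2 * (norm R / s) * (s * norm e')"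
      using norm_cauchy_schwarz[of R e'] s by simp
    also have "\<dots> \<le> (norm R / s)\<^sup>2 + (s * norm e')\<^sup>2" by (rule sum_squares_bound)
    finally show ?thesis by (simp add: power_divide power_mult_distrib s)
  qed
  have 5: "2 * (N \<bullet> (e' - e)) \<le> (norm N)\<^sup>2 + (norm (e' - e))\<^sup>2"
    using norm_cauchy_schwarz[of N "e' - e"] sum_squares_bound[of "norm N" "norm (e' - e)"] by linarith
  have "(norm e')\<^sup>2 - (norm e)\<^sup>2 + (norm (e' - e))\<^sup>2 =
      2 * (\<tau> * (\<beta> \<bullet> e')) + 2 * (R \<bullet> e') + 2 * (e \<bullet> N) + 2 * (N \<bullet> (e' - e))"
    unfolding 1 2 by (simp add: algebra_simps)
  then have "(norm e')\<^sup>2 - (norm e)\<^sup>2 \<le>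
      2 * (\<tau> * (L * (norm e')\<^sup>2)) + ((norm R)\<^sup>2 / (\<epsilon> * \<tau>) + \<epsilon> * \<tau> * (norm e')\<^sup>2) + 2 * (e \<bullet> N) + (norm N)\<^sup>2"
    using 3 4 5 by linarith
  then show ?thesis by (simp add: algebra_simps)
qed

lemma sum4_powr_le:
  fixes q :: real
  assumes "0 \<le> q" "0 \<le> a" "0 \<le> b" "0 \<le> c" "0 \<le> d"
  shows "(a + b + c + d) powr q \<le> 4 powr q * (a powr q + b powr q + c powr q + d powr q)"
proof -
  define m where "m = max (max a b) (max c d)"
  have "(a + b + c + d) powr q \<le> (4 * m) powr q" using assms by (intro powr_mono2) (auto simp: m_def)
  also have "\<dots> = 4 powr q * m powr q" using assms by (simp add: m_def powr_mult)
  also have "m powr q \<le> a powr q + b powr q + c powr q + d powr q"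
    by (auto simp: m_def max_def)
  finally show ?thesis by (simp add: mult_left_mono)
qed

lemma powr_square: "0 \<le> (x::real) \<Longrightarrow> (x\<^sup>2) powr q = x powr (2 * q)"
  by (cases "x = 0") (auto simp: powr_powr simp flip: powr_numeral)

text \<open>Telescoped and raised to the power \<open>q\<close>, which stands for
  \<open>p / 2\<close>. Each sum of at most \<open>T / \<tau>\<close> terms costs
  \<open>\<tau> powr (1 - q)\<close>; with the prefactors \<open>\<tau>\<close> and
  \<open>1 / \<tau>\<close> this explains the different powers of the step in the three
  sums.\<close>

lemma error_recursion_bound:
  fixes e R N :: "nat \<Rightarrow> 'b::real_inner"
  assumes e0: "e 0 = 0"
    and step: "\<And>j. j < m \<Longrightarrow> (norm (e (Suc j)))\<^sup>2 \<le> (norm (e j))\<^sup>2 + K * \<tau> * (norm (e (Suc j)))\<^sup>2 +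
      (norm (R j))\<^sup>2 / (\<epsilon> * \<tau>) + 2 * (e j \<bullet> N j) + (norm (N j))\<^sup>2"
    and pos: "0 < \<tau>" "0 < \<epsilon>" "0 \<le> K" and K: "K * \<tau> \<le> \<kappa>" "\<kappa> < 1" and T: "real m * \<tau> \<le> T" "0 < T"
    and q: "1 \<le> q"
  shows "(1 - \<kappa>) powr q * running_max (\<lambda>n. norm (e n)) m powr (2 * q) \<le>
    4 powr q * (K powr q * (2 powr q * T powr (q - 1)) * \<tau> * (\<Sum>j<m. norm (e j) powr (2 * q)) +
      \<epsilon> powr (- q) * (2 powr q * T powr (q - 1)) * \<tau> powr (1 - 2 * q) * (\<Sum>j<m. norm (R j) powr (2 * q)) +
      2 powr q * running_max (\<lambda>n. \<Sum>j<n. e j \<bullet> N j) m powr q +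
      2 powr q * T powr (q - 1) * \<tau> powr (1 - q) * (\<Sum>j<m. norm (N j) powr (2 * q)))"
proof (cases "m = 0")
  case True then show ?thesis using e0 q pos by simp
next
  case False
  then have m: "0 < real m" by simp
  define A where "A = K * \<tau> * (\<Sum>j<m. (norm (e j))\<^sup>2)"
  define B where "B = (\<Sum>j<m. (norm (R j))\<^sup>2) / (\<epsilon> * \<tau>)"
  define S where "S = running_max (\<lambda>n. \<Sum>j<n. e j \<bullet> N j) m"
  define D where "D = (\<Sum>j<m. (norm (N j))\<^sup>2)"
  have nonneg: "0 \<le> A" "0 \<le> B" "0 \<le> S" "0 \<le> D"
    using pos by (auto simp: A_def B_def S_def D_def sum_nonneg running_max_nonneg)
  have pt: "(1 - \<kappa>) * (norm (e n))\<^sup>2 \<le> A + B + 2 * S + D" if n: "n \<le> m" for n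
  proof -
    have "(norm (e n))\<^sup>2 \<le> (\<Sum>j<n. K * \<tau> * (norm (e (Suc j)))\<^sup>2) + (\<Sum>j<n. (norm (R j))\<^sup>2 / (\<epsilon> * \<tau>)) +
        2 * (\<Sum>j<n. e j \<bullet> N j) + (\<Sum>j<n. (norm (N j))\<^sup>2)"
      using n
    proof (induction n)
      case (Suc n) then show ?case using step[of n] by simp
    qed (simp add: e0)
    \<comment> \<open>Index shift, using \<open>e 0 = 0\<close>: only the last term is implicit, and
      \<open>\<kappa>\<close> bounds its coefficient so that it can be moved to the left.\<close>
    also have "(\<Sum>j<n. K * \<tau> * (norm (e (Suc j)))\<^sup>2) = K * \<tau> * (\<Sum>j<n. (norm (e j))\<^sup>2) + K * \<tau> * (norm (e n))\<^sup>2"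
    proof -
      have "(\<Sum>j<n. (norm (e (Suc j)))\<^sup>2) = (\<Sum>j<n. (norm (e j))\<^sup>2) + (norm (e n))\<^sup>2"
        by (induction n) (auto simp: e0)
      then show ?thesis by (simp add: distrib_left flip: sum_distrib_left)
    qed
    also have "K * \<tau> * (norm (e n))\<^sup>2 \<le> \<kappa> * (norm (e n))\<^sup>2" using K by (intro mult_right_mono) auto
    also have "K * \<tau> * (\<Sum>j<n. (norm (e j))\<^sup>2) \<le> A"
      unfolding A_def using pos n by (intro mult_left_mono sum_mono2) auto
    also have "(\<Sum>j<n. (norm (R j))\<^sup>2 / (\<epsilon> * \<tau>)) \<le> B"
      unfolding B_def sum_divide_distrib using pos n by (intro sum_mono2) auto
    also have "(\<Sum>j<n. e j \<bullet> N j) \<le> S"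
      using abs_le_running_max[OF n, of "\<lambda>n. \<Sum>j<n. e j \<bullet> N j"] by (simp add: S_def)
    also have "(\<Sum>j<n. (norm (N j))\<^sup>2) \<le> D"
      unfolding D_def using n by (intro sum_mono2) auto
    finally show ?thesis by (simp add: algebra_simps)
  qed
  define E where "E = running_max (\<lambda>n. norm (e n)) m"
  have E0: "0 \<le> E" by (simp add: E_def running_max_nonneg)
  \<comment> \<open>The maximum is attained at some index, so the bound for each single
    \<open>n\<close> passes to it before powers are taken.\<close>
  have "\<exists>n\<le>m. E = norm (e n)"
  proof -
    have "\<exists>n\<le>k. running_max (\<lambda>n. norm (e n)) k = norm (e n)" for k
    proof (induction k)
      case (Suc k)
      then show ?case by (auto simp: max_def intro: le_SucI)
    qed simp
    then show ?thesis by (simp add: E_def)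
  qed
  then have "(1 - \<kappa>) * E\<^sup>2 \<le> A + B + 2 * S + D" using pt by auto
  then have "((1 - \<kappa>) * E\<^sup>2) powr q \<le> (A + B + 2 * S + D) powr q"
    using K(2) q by (intro powr_mono2) auto
  also have "\<dots> \<le> 4 powr q * (A powr q + B powr q + (2 * S) powr q + D powr q)"
    using nonneg q by (intro sum4_powr_le) auto
  finally have main: "(1 - \<kappa>) powr q * E powr (2 * q) \<le> 4 powr q * (A powr q + B powr q + 2 powr q * S powr q + D powr q)"
    using K(2) E0 nonneg by (simp add: powr_mult powr_square)
  have pw: "(\<Sum>j<m. x j) powr q \<le> 2 powr q * T powr (q - 1) * \<tau> powr (1 - q) * (\<Sum>j<m. x j powr q)"
    if "\<And>j. 0 \<le> x j" for x :: "nat \<Rightarrow> real"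
  proof -
    have "(\<Sum>j<m. x j) powr q \<le> 2 powr q * real m powr (q - 1) * (\<Sum>j<m. x j powr q)"
      using sum_powr_le[of "{..<m}" x q] that q by simp
    also have "\<dots> \<le> 2 powr q * (T powr (q - 1) * \<tau> powr (1 - q)) * (\<Sum>j<m. x j powr q)"
    proof (intro mult_right_mono mult_left_mono)
      have "real m powr (q - 1) \<le> (T / \<tau>) powr (q - 1)"
        using T pos q by (intro powr_mono2) (auto simp: field_simps)
      also have "\<dots> = T powr (q - 1) * \<tau> powr (1 - q)"
        using T pos powr_minus_divide[of \<tau> "q - 1"] by (simp add: powr_divide)
      finally show "real m powr (q - 1) \<le> T powr (q - 1) * \<tau> powr (1 - q)" .
    qed (auto simp: sum_nonneg)
    finally show ?thesis by (simp add: mult.assoc)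
  qed
  have \<tau>q: "\<tau> powr q * \<tau> powr (1 - q) = \<tau>" "\<tau> powr (- q) * \<tau> powr (1 - q) = \<tau> powr (1 - 2 * q)"
    using pos by (simp_all flip: powr_add)
  have "A powr q \<le> K powr q * \<tau> powr q * (2 powr q * T powr (q - 1) * \<tau> powr (1 - q) * (\<Sum>j<m. ((norm (e j))\<^sup>2) powr q))"
    unfolding A_def using pos by (simp add: powr_mult sum_nonneg mult_left_mono pw)
  also have "\<dots> = K powr q * (2 powr q * T powr (q - 1)) * (\<tau> powr q * \<tau> powr (1 - q)) * (\<Sum>j<m. norm (e j) powr (2 * q))"
    by (simp add: powr_square mult_ac)
  finally have A: "A powr q \<le> K powr q * (2 powr q * T powr (q - 1)) * \<tau> * (\<Sum>j<m. norm (e j) powr (2 * q))"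
    unfolding \<tau>q .
  have "B powr q = \<epsilon> powr (- q) * \<tau> powr (- q) * (\<Sum>j<m. (norm (R j))\<^sup>2) powr q"
    unfolding B_def using pos by (simp add: powr_divide powr_mult sum_nonneg powr_minus field_simps)
  also have "\<dots> \<le> \<epsilon> powr (- q) * \<tau> powr (- q) * (2 powr q * T powr (q - 1) * \<tau> powr (1 - q) * (\<Sum>j<m. ((norm (R j))\<^sup>2) powr q))"
    by (intro mult_left_mono pw) auto
  also have "\<dots> = \<epsilon> powr (- q) * (2 powr q * T powr (q - 1)) * (\<tau> powr (- q) * \<tau> powr (1 - q)) * (\<Sum>j<m. norm (R j) powr (2 * q))"
    by (simp add: powr_square mult_ac)
  finally have B: "B powr q \<le> \<epsilon> powr (- q) * (2 powr q * T powr (q - 1)) * \<tau> powr (1 - 2 * q) * (\<Sum>j<m. norm (R j) powr (2 * q))"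
    unfolding \<tau>q .
  have D: "D powr q \<le> 2 powr q * T powr (q - 1) * \<tau> powr (1 - q) * (\<Sum>j<m. norm (N j) powr (2 * q))"
    unfolding D_def using pw[of "\<lambda>j. (norm (N j))\<^sup>2"] by (simp add: powr_square)
  show ?thesis
    unfolding S_def[symmetric] E_def[symmetric]
    by (rule order_trans[OF main]) (intro mult_left_mono add_mono A B D order_refl, simp)
qed

section \<open>Integrals along paths\<close>

lemma set_nn_integral_powr_le:
  fixes f :: "real \<Rightarrow> real"
  assumes f: "f \<in> borel_measurable (restrict_space borel {a..c})" and f0: "\<And>r. 0 \<le> f r"
    and p: "1 \<le> p" and K: "0 \<le> K" "ennreal K \<le> (\<integral>\<^sup>+r\<in>{a..c}. ennreal (f r) \<partial>lborel)" and ac: "a < c"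
  shows "ennreal (K powr p) \<le> ennreal (2 powr p * (c - a) powr (p - 1)) * (\<integral>\<^sup>+r\<in>{a..c}. ennreal (f r powr p) \<partial>lborel)"
proof -
  have eq: "(\<integral>\<^sup>+r. g r \<partial>restrict_space lborel {a..c}) = (\<integral>\<^sup>+r\<in>{a..c}. g r \<partial>lborel)" for g :: "real \<Rightarrow> ennreal"
    by (subst nn_integral_restrict_space) auto
  have "ennreal (K powr p) \<le> ennreal (2 powr p * (c - a) powr (p - 1)) * (\<integral>\<^sup>+r. ennreal (f r powr p) \<partial>restrict_space lborel {a..c})"
  proof (rule powr_le_nn_integral_powr)
    show "f \<in> borel_measurable (restrict_space lborel {a..c})"
      using f by (simp cong: measurable_cong_sets add: sets_restrict_space)
    show "emeasure (restrict_space lborel {a..c}) (space (restrict_space lborel {a..c})) \<le> ennreal (c - a)"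
      using ac by (simp add: space_restrict_space emeasure_restrict_space)
  qed (use f0 p K ac eq in auto)
  then show ?thesis unfolding eq .
qed

text \<open>The path is sampled at the last multiple of \<open>1 / (k + 1)\<close> before
  \<open>t\<close>. For each \<open>k\<close> there are only countably many sampling times, hence
  joint measurability; continuity gives convergence.\<close>

lemma continuous_paths_measurable:
  fixes X :: "real \<Rightarrow> 'a \<Rightarrow> 'b::{metric_space, second_countable_topology}"
  assumes X: "\<And>t. X t \<in> borel_measurable M" and cont: "\<And>\<omega>. \<omega> \<in> space M \<Longrightarrow> continuous_on UNIV (\<lambda>t. X t \<omega>)"
  shows "(\<lambda>(t, \<omega>). X t \<omega>) \<in> borel_measurable (borel \<Otimes>\<^sub>M M)"
proof (rule borel_measurable_LIMSEQ_metric)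
  fix k :: nat
  define g where "g i x = X (real_of_int i / real (Suc k)) (snd x)" for i :: int and x :: "real \<times> 'a"
  have "(\<lambda>x. g \<lfloor>real (Suc k) * fst x\<rfloor> x) \<in> borel_measurable (borel \<Otimes>\<^sub>M M)"
  proof (rule measurable_compose_countable)
    show "g i \<in> borel_measurable (borel \<Otimes>\<^sub>M M)" for i
      unfolding g_def using measurable_compose[OF measurable_snd X] .
  qed measurable
  then show "(\<lambda>x. X (real_of_int \<lfloor>real (Suc k) * fst x\<rfloor> / real (Suc k)) (snd x)) \<in> borel_measurable (borel \<Otimes>\<^sub>M M)"
    by (simp add: g_def)
next
  fix x :: "real \<times> 'a" assume "x \<in> space (borel \<Otimes>\<^sub>M M)"
  then obtain t \<omega> where x: "x = (t, \<omega>)" "\<omega> \<in> space M" by (auto simp: space_pair_measure)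
  have "(\<lambda>k. real_of_int \<lfloor>real (Suc k) * t\<rfloor> / real (Suc k)) \<longlonglongrightarrow> t"
  proof (rule tendsto_sandwich[OF always_eventually always_eventually])
    have "(\<lambda>k. t - 1 / real (Suc k)) \<longlonglongrightarrow> t - 0"
      by (intro tendsto_diff tendsto_const LIMSEQ_Suc[OF lim_1_over_n])
    then show "(\<lambda>k. t - 1 / real (Suc k)) \<longlonglongrightarrow> t" by simp
    show "\<forall>k. t - 1 / real (Suc k) \<le> real_of_int \<lfloor>real (Suc k) * t\<rfloor> / real (Suc k)"
    proof
      fix k
      have "real (Suc k) * t - 1 \<le> real_of_int \<lfloor>real (Suc k) * t\<rfloor>" by linarith
      then have "(real (Suc k) * t - 1) / real (Suc k) \<le> real_of_int \<lfloor>real (Suc k) * t\<rfloor> / real (Suc k)"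
        by (rule divide_right_mono) simp
      moreover have "(real (Suc k) * t - 1) / real (Suc k) = t - 1 / real (Suc k)"
        by (simp add: diff_divide_distrib del: of_nat_Suc)
      ultimately show "t - 1 / real (Suc k) \<le> real_of_int \<lfloor>real (Suc k) * t\<rfloor> / real (Suc k)" by simp
    qed
    show "\<forall>k. real_of_int \<lfloor>real (Suc k) * t\<rfloor> / real (Suc k) \<le> t"
    proof
      fix k
      have "real_of_int \<lfloor>real (Suc k) * t\<rfloor> \<le> t * real (Suc k)" by (simp add: mult.commute)
      then show "real_of_int \<lfloor>real (Suc k) * t\<rfloor> / real (Suc k) \<le> t"
        by (simp add: pos_divide_le_eq del: of_nat_Suc)
    qed
  qed simp
  from continuous_on_tendsto_compose[OF cont[OF x(2)] this]
  show "(\<lambda>k. X (real_of_int \<lfloor>real (Suc k) * fst x\<rfloor> / real (Suc k)) (snd x)) \<longlonglongrightarrow> (case x of (t, \<omega>) \<Rightarrow> X t \<omega>)"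
    by (simp add: x)
qed

text \<open>Tonelli's theorem for a path known on \<open>{0..T}\<close> only. The third claim is
  kept because splitting the time integral of a sum of two expectations needs measurability in
  \<open>r\<close>.\<close>

lemma (in prob_space) path_integral_fubini:
  fixes X :: "real \<Rightarrow> 'a \<Rightarrow> 'b::{metric_space, second_countable_topology}" and g :: "'b \<Rightarrow> 'b \<Rightarrow> ennreal"
  assumes X: "\<And>t. t \<in> {0..T} \<Longrightarrow> X t \<in> borel_measurable M"
    and cont: "\<And>\<omega>. \<omega> \<in> space M \<Longrightarrow> continuous_on {0..T} (\<lambda>t. X t \<omega>)"
    and T: "0 \<le> T" and ac: "{a..c} \<subseteq> {0..T}" "s \<in> {0..T}"
    and g: "(\<lambda>(x, y). g x y) \<in> borel_measurable (borel \<Otimes>\<^sub>M borel)"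
  shows "(\<lambda>\<omega>. \<integral>\<^sup>+r\<in>{a..c}. g (X r \<omega>) (X s \<omega>) \<partial>lborel) \<in> borel_measurable M"
    and "(\<integral>\<^sup>+\<omega>. (\<integral>\<^sup>+r\<in>{a..c}. g (X r \<omega>) (X s \<omega>) \<partial>lborel) \<partial>M) = (\<integral>\<^sup>+r\<in>{a..c}. (\<integral>\<^sup>+\<omega>. g (X r \<omega>) (X s \<omega>) \<partial>M) \<partial>lborel)"
    and "(\<lambda>r. (\<integral>\<^sup>+\<omega>. g (X r \<omega>) (X s \<omega>) \<partial>M) * indicator {a..c} r) \<in> borel_measurable lborel"
proof -
  \<comment> \<open>Clamping time to \<open>{0..T}\<close> extends the paths continuously to the
    whole line without changing them where they are integrated.\<close>
  define cl where "cl r = max 0 (min r T)" for r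
  have cl: "cl r \<in> {0..T}" "r \<in> {0..T} \<Longrightarrow> cl r = r" for r using T by (auto simp: cl_def)
  define X' where "X' r \<omega> = X (cl r) \<omega>" for r \<omega>
  have [measurable]: "X s \<in> borel_measurable M" using X ac by simp
  have "(\<lambda>(t, \<omega>). X' t \<omega>) \<in> borel_measurable (borel \<Otimes>\<^sub>M M)"
  proof (rule continuous_paths_measurable)
    show "X' t \<in> borel_measurable M" for t unfolding X'_def using X cl by simp
    fix \<omega> assume "\<omega> \<in> space M"
    then show "continuous_on UNIV (\<lambda>t. X' t \<omega>)"
      unfolding X'_def using cl(1)
      by (intro continuous_on_compose2[OF cont]) (auto simp: cl_def intro!: continuous_intros)
  qed
  then have X'[measurable]: "(\<lambda>x. X' (fst x) (snd x)) \<in> borel_measurable (borel \<Otimes>\<^sub>M M)"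
    by (simp add: case_prod_beta')
  have g': "(\<lambda>x. g (X' (fst x) (snd x)) (X s (snd x))) \<in> borel_measurable (borel \<Otimes>\<^sub>M M)"
    using measurable_compose[OF measurable_Pair[OF X' measurable_compose[OF measurable_snd \<open>X s \<in> borel_measurable M\<close>]] g] by simp
  define h where "h r \<omega> = g (X' r \<omega>) (X s \<omega>) * indicator {a..c} r" for r \<omega>
  have h: "(\<lambda>(r, \<omega>). h r \<omega>) \<in> borel_measurable (lborel \<Otimes>\<^sub>M M)"
  proof -
    have "(\<lambda>x. g (X' (fst x) (snd x)) (X s (snd x)) * indicator {a..c} (fst x)) \<in> borel_measurable (borel \<Otimes>\<^sub>M M)"
      using g' by measurable
    then show ?thesis by (simp add: h_def case_prod_beta' cong: measurable_cong_sets sets_pair_measure_cong)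
  qed
  have eq: "(\<integral>\<^sup>+r\<in>{a..c}. g (X r \<omega>) (X s \<omega>) \<partial>lborel) = (\<integral>\<^sup>+r. h r \<omega> \<partial>lborel)" for \<omega>
    using ac cl(2) by (intro nn_integral_cong) (auto simp: h_def X'_def indicator_def)
  interpret PS: pair_sigma_finite lborel M ..
  show "(\<lambda>\<omega>. \<integral>\<^sup>+r\<in>{a..c}. g (X r \<omega>) (X s \<omega>) \<partial>lborel) \<in> borel_measurable M"
    unfolding eq
    by (intro lborel.borel_measurable_nn_integral) (use measurable_pair_swap[OF h] in \<open>simp add: case_prod_beta'\<close>)
  have "(\<integral>\<^sup>+\<omega>. (\<integral>\<^sup>+r. h r \<omega> \<partial>lborel) \<partial>M) = (\<integral>\<^sup>+r. (\<integral>\<^sup>+\<omega>. h r \<omega> \<partial>M) \<partial>lborel)"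
    by (rule PS.Fubini'[OF h])
  also have slice: "(\<lambda>r. \<integral>\<^sup>+\<omega>. h r \<omega> \<partial>M) = (\<lambda>r. (\<integral>\<^sup>+\<omega>. g (X r \<omega>) (X s \<omega>) \<partial>M) * indicator {a..c} r)"
    using ac cl(2) by (auto simp: h_def X'_def indicator_def fun_eq_iff)
  finally show "(\<integral>\<^sup>+\<omega>. (\<integral>\<^sup>+r\<in>{a..c}. g (X r \<omega>) (X s \<omega>) \<partial>lborel) \<partial>M) = (\<integral>\<^sup>+r\<in>{a..c}. (\<integral>\<^sup>+\<omega>. g (X r \<omega>) (X s \<omega>) \<partial>M) \<partial>lborel)"
    unfolding eq .
  show "(\<lambda>r. (\<integral>\<^sup>+\<omega>. g (X r \<omega>) (X s \<omega>) \<partial>M) * indicator {a..c} r) \<in> borel_measurable lborel"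
    unfolding slice[symmetric] using h by (rule borel_measurable_nn_integral)
qed

section \<open>Error of the backward Euler scheme\<close>

text \<open>Distributes a real number below a possibly infinite sum among the summands, so that real
  powers can be taken termwise; an infinite summand can carry all of \<open>K\<close>.\<close>

lemma ennreal_le_sumE:
  fixes f :: "nat \<Rightarrow> ennreal"
  assumes "0 \<le> K" "ennreal K \<le> (\<Sum>j<m. f j)"
  obtains y where "\<And>j. 0 \<le> y j" "\<And>j. j < m \<Longrightarrow> ennreal (y j) \<le> f j" "K \<le> (\<Sum>j<m. y j)"
proof (cases "\<exists>i<m. f i = top")
  case True
  then obtain i where i: "i < m" "f i = top" by blast
  show ?thesis
    by (rule that[of "\<lambda>j. if j = i then K else 0"]) (use i assms in auto)
next
  case False
  have eq: "ennreal (enn2real (f j)) = f j" if "j < m" for j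
    using False that by (simp add: less_top)
  have "ennreal K \<le> ennreal (\<Sum>j<m. enn2real (f j))"
    using assms(2) eq by (simp flip: sum_ennreal)
  then have "K \<le> (\<Sum>j<m. enn2real (f j))" by (subst (asm) ennreal_le_iff) (auto simp: sum_nonneg)
  then show ?thesis using eq by (intro that[of "\<lambda>j. enn2real (f j)"]) auto
qed

text \<open>The one-sided constant is nonnegative here, so that the coefficient
  \<open>2 * L + \<epsilon>\<close> of the implicit term is positive; a negative constant is
  replaced by 0 when the locale is interpreted.\<close>

locale one_sided_sde = wiener_process P F W
  for P :: "'a measure" and F and W :: "real \<Rightarrow> 'a \<Rightarrow> real ^ 'm" +
  fixes b :: "real ^ 'n \<Rightarrow> real ^ 'n" and \<sigma> :: "real ^ 'n \<Rightarrow> real ^ 'm ^ 'n"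
    and X0 :: "'a \<Rightarrow> real ^ 'n" and X :: "real \<Rightarrow> 'a \<Rightarrow> real ^ 'n" and T L \<Lambda> p :: real
  assumes T_pos: "0 < T" and b_cont: "continuous_on UNIV b" and \<sigma>_cont: "continuous_on UNIV \<sigma>"
    and b_one_sided: "(b x - b y) \<bullet> (x - y) \<le> L * (norm (x - y))\<^sup>2" and L_nonneg: "0 \<le> L"
    and \<sigma>_lipschitz: "norm (\<sigma> x - \<sigma> y) \<le> \<Lambda> * norm (x - y)" and \<Lambda>_nonneg: "0 \<le> \<Lambda>"
    and X0_F: "X0 \<in> borel_measurable (F 0)"
    and X_solution: "sde_solution P F W T b \<sigma> X0 X" and p_ge: "4 \<le> p"
begin

lemma X_F: "0 \<le> s \<Longrightarrow> s \<le> T \<Longrightarrow> X s \<in> borel_measurable (F s)"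
  using X_solution by (simp add: sde_solution_def)

lemma X_P: "0 \<le> s \<Longrightarrow> s \<le> T \<Longrightarrow> X s \<in> borel_measurable P"
  using X_F F_measurable_P by blast

lemma X_continuous: "\<omega> \<in> space P \<Longrightarrow> continuous_on {0..T} (\<lambda>s. X s \<omega>)"
  using X_solution by (simp add: sde_solution_def)

lemma b_borel: "b \<in> borel_measurable borel" and \<sigma>_borel: "\<sigma> \<in> borel_measurable borel"
  using b_cont \<sigma>_cont by (auto intro: borel_measurable_continuous_onI)

lemma path_measurable:
  assumes \<omega>: "\<omega> \<in> space P" and ac: "{a..c} \<subseteq> {0..T}" and g: "continuous_on UNIV g"
  shows "(\<lambda>r. g (X r \<omega>)) \<in> borel_measurable (restrict_space borel {a..c})"
  by (intro borel_measurable_continuous_on_restrict continuous_on_compose2[OF g] continuous_on_subset[OF X_continuous[OF \<omega>] ac]) auto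

text \<open>The two oscillations on the right-hand side of the theorem, before expectations are
  taken. \<open>osc\<close> is used with the left endpoint of a block, where the scheme evaluates
  \<sigma>, and \<open>b_osc\<close> with the right one, where it evaluates b.\<close>

definition "osc a c s \<omega> = (\<integral>\<^sup>+r\<in>{a..c}. ennreal (norm (X r \<omega> - X s \<omega>) powr p) \<partial>lborel)"
definition "b_osc a c s \<omega> = (\<integral>\<^sup>+r\<in>{a..c}. ennreal (norm (b (X r \<omega>) - b (X s \<omega>)) powr p) \<partial>lborel)"

lemma osc:
  assumes "{a..c} \<subseteq> {0..T}" "s \<in> {0..T}"
  shows "osc a c s \<in> borel_measurable P"
    and "(\<integral>\<^sup>+\<omega>. osc a c s \<omega> \<partial>P) = (\<integral>\<^sup>+r\<in>{a..c}. (\<integral>\<^sup>+\<omega>. ennreal (norm (X r \<omega> - X s \<omega>) powr p) \<partial>P) \<partial>lborel)"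
    and "(\<lambda>r. (\<integral>\<^sup>+\<omega>. ennreal (norm (X r \<omega> - X s \<omega>) powr p) \<partial>P) * indicator {a..c} r) \<in> borel_measurable lborel"
proof -
  have g: "(\<lambda>(x, y). ennreal (norm (x - y) powr p)) \<in> borel_measurable ((borel :: (real ^ 'n) measure) \<Otimes>\<^sub>M borel)"
    by (simp add: case_prod_beta')
  note * = path_integral_fubini[OF X_P X_continuous less_imp_le[OF T_pos] assms g]
  show "osc a c s \<in> borel_measurable P"
    unfolding osc_def[abs_def] by (rule *(1)) auto
  show "(\<integral>\<^sup>+\<omega>. osc a c s \<omega> \<partial>P) = (\<integral>\<^sup>+r\<in>{a..c}. (\<integral>\<^sup>+\<omega>. ennreal (norm (X r \<omega> - X s \<omega>) powr p) \<partial>P) \<partial>lborel)"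
    unfolding osc_def by (rule *(2)) auto
  show "(\<lambda>r. (\<integral>\<^sup>+\<omega>. ennreal (norm (X r \<omega> - X s \<omega>) powr p) \<partial>P) * indicator {a..c} r) \<in> borel_measurable lborel"
    by (rule *(3)) auto
qed

lemma b_osc:
  assumes "{a..c} \<subseteq> {0..T}" "s \<in> {0..T}"
  shows "b_osc a c s \<in> borel_measurable P"
    and "(\<integral>\<^sup>+\<omega>. b_osc a c s \<omega> \<partial>P) = (\<integral>\<^sup>+r\<in>{a..c}. (\<integral>\<^sup>+\<omega>. ennreal (norm (b (X r \<omega>) - b (X s \<omega>)) powr p) \<partial>P) \<partial>lborel)"
    and "(\<lambda>r. (\<integral>\<^sup>+\<omega>. ennreal (norm (b (X r \<omega>) - b (X s \<omega>)) powr p) \<partial>P) * indicator {a..c} r) \<in> borel_measurable lborel"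
proof -
  note [measurable] = b_borel
  have g: "(\<lambda>(x, y). ennreal (norm (b x - b y) powr p)) \<in> borel_measurable ((borel :: (real ^ 'n) measure) \<Otimes>\<^sub>M borel)"
    unfolding case_prod_beta' by measurable
  note * = path_integral_fubini[OF X_P X_continuous less_imp_le[OF T_pos] assms g]
  show "b_osc a c s \<in> borel_measurable P"
    unfolding b_osc_def[abs_def] by (rule *(1)) auto
  show "(\<integral>\<^sup>+\<omega>. b_osc a c s \<omega> \<partial>P) = (\<integral>\<^sup>+r\<in>{a..c}. (\<integral>\<^sup>+\<omega>. ennreal (norm (b (X r \<omega>) - b (X s \<omega>)) powr p) \<partial>P) \<partial>lborel)"
    unfolding b_osc_def by (rule *(2)) auto
  show "(\<lambda>r. (\<integral>\<^sup>+\<omega>. ennreal (norm (b (X r \<omega>) - b (X s \<omega>)) powr p) \<partial>P) * indicator {a..c} r) \<in> borel_measurable lborel"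
    by (rule *(3)) auto
qed

text \<open>Hoelder's inequality on one block, in the form shared by both noise estimates:
  \<open>y\<close> is the error at the left endpoint, and \<open>s\<close> is \<open>p / 4\<close>
  for the martingale and \<open>p / 2\<close> for a single noise increment.\<close>

lemma block_powr_le:
  fixes f :: "real \<Rightarrow> real"
  assumes \<omega>: "\<omega> \<in> space P" and ac: "{a..c} \<subseteq> {0..T}" "a < c"
    and f: "f \<in> borel_measurable (restrict_space borel {a..c})" "\<And>r. 0 \<le> f r"
    and s: "1 \<le> s" and D: "0 \<le> D" and y: "0 \<le> y"
    and fD: "\<And>r. f r powr s \<le> D * (y powr p + norm (X r \<omega> - X a \<omega>) powr p)"
    and K: "0 \<le> K" "ennreal K \<le> (\<integral>\<^sup>+r\<in>{a..c}. ennreal (f r) \<partial>lborel)"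
  shows "ennreal (K powr s) \<le> ennreal (2 powr s * (c - a) powr (s - 1) * D) * (ennreal ((c - a) * y powr p) + osc a c a \<omega>)"
proof -
  have meas: "(\<lambda>r. ennreal (norm (X r \<omega> - X a \<omega>) powr p) * indicator {a..c} r) \<in> borel_measurable lborel"
  proof -
    have "(\<lambda>r. X r \<omega> - X a \<omega>) \<in> borel_measurable (restrict_space borel {a..c})"
      using path_measurable[OF \<omega> ac(1), of "\<lambda>x. x"] by (simp add: continuous_on_id)
    then have [measurable]: "(\<lambda>r. indicat_real {a..c} r *\<^sub>R (X r \<omega> - X a \<omega>)) \<in> borel_measurable borel"
      by (subst (asm) borel_measurable_restrict_space_iff) auto
    have "(\<lambda>r. ennreal (norm (indicat_real {a..c} r *\<^sub>R (X r \<omega> - X a \<omega>)) powr p)) \<in> borel_measurable lborel"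
      by measurable
    moreover have "(\<lambda>r. ennreal (norm (indicat_real {a..c} r *\<^sub>R (X r \<omega> - X a \<omega>)) powr p)) =
        (\<lambda>r. ennreal (norm (X r \<omega> - X a \<omega>) powr p) * indicator {a..c} r)"
      using p_ge by (auto simp: indicator_def)
    ultimately show ?thesis by (simp only:)
  qed
  have "ennreal (K powr s) \<le> ennreal (2 powr s * (c - a) powr (s - 1)) * (\<integral>\<^sup>+r\<in>{a..c}. ennreal (f r powr s) \<partial>lborel)"
    by (rule set_nn_integral_powr_le[OF f s K ac(2)])
  also have "(\<integral>\<^sup>+r\<in>{a..c}. ennreal (f r powr s) \<partial>lborel) \<le>
      (\<integral>\<^sup>+r. ennreal D * (ennreal (y powr p) * indicator {a..c} r + ennreal (norm (X r \<omega> - X a \<omega>) powr p) * indicator {a..c} r) \<partial>lborel)"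
  proof (rule nn_integral_mono)
    fix r
    show "ennreal (f r powr s) * indicator {a..c} r \<le>
        ennreal D * (ennreal (y powr p) * indicator {a..c} r + ennreal (norm (X r \<omega> - X a \<omega>) powr p) * indicator {a..c} r)"
      using ennreal_leI[OF fD[of r]] D by (auto simp: indicator_def ennreal_mult ennreal_plus)
  qed
  also have "\<dots> = ennreal D * (ennreal ((c - a) * y powr p) + osc a c a \<omega>)"
    using meas ac by (simp add: nn_integral_cmult nn_integral_add osc_def nn_integral_cmult_indicator ennreal_mult mult.commute)
  finally show ?thesis using D by (simp add: ennreal_mult mult.assoc mult_left_mono)
qed

lemma sigma_diff_le: "norm (\<sigma> (X r \<omega>) - \<sigma> z) \<le> \<Lambda> * (norm (X a \<omega> - z) + norm (X r \<omega> - X a \<omega>))"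
proof -
  have "norm (X r \<omega> - z) \<le> norm (X a \<omega> - z) + norm (X r \<omega> - X a \<omega>)"
    using norm_triangle_ineq[of "X a \<omega> - z" "X r \<omega> - X a \<omega>"] by simp
  then show ?thesis using \<Lambda>_nonneg by (intro order_trans[OF \<sigma>_lipschitz] mult_left_mono)
qed

text \<open>Error and diffusion difference are both at most a multiple of \<open>y + x\<close>, so
  their product is quadratic in it and its power \<open>p / 2\<close> is of order
  \<open>p\<close>.\<close>

lemma weighted_sigma_powr_le:
  fixes a r \<omega> z
  defines "y \<equiv> norm (X a \<omega> - z)"
  shows "((y * norm (\<sigma> (X r \<omega>) - \<sigma> z))\<^sup>2) powr (p / 4) \<le> \<Lambda> powr (p / 2) * 2 powr p * (y powr p + norm (X r \<omega> - X a \<omega>) powr p)"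
proof -
  define x where "x = norm (X r \<omega> - X a \<omega>)"
  have nn: "0 \<le> y" "0 \<le> x" by (auto simp: y_def x_def)
  have "y * norm (\<sigma> (X r \<omega>) - \<sigma> z) \<le> (y + x) * (\<Lambda> * (y + x))"
    using sigma_diff_le[of r \<omega> z a] nn \<Lambda>_nonneg by (intro mult_mono) (auto simp: y_def x_def)
  also have "\<dots> = \<Lambda> * (y + x)\<^sup>2" by (simp add: power2_eq_square)
  finally have "(y * norm (\<sigma> (X r \<omega>) - \<sigma> z)) powr (p / 2) \<le> (\<Lambda> * (y + x)\<^sup>2) powr (p / 2)"
    using nn p_ge by (intro powr_mono2) auto
  also have "\<dots> = \<Lambda> powr (p / 2) * (y + x) powr p"
    using \<Lambda>_nonneg nn by (simp add: powr_mult powr_square)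
  also have "\<dots> \<le> \<Lambda> powr (p / 2) * (2 powr p * (y powr p + x powr p))"
    using nn p_ge by (intro mult_left_mono powr_add_le) auto
  finally show ?thesis using nn by (simp add: powr_square x_def mult.assoc)
qed

lemma sigma_powr_le:
  "((norm (\<sigma> (X r \<omega>) - \<sigma> z))\<^sup>2) powr (p / 2) \<le> \<Lambda> powr p * 2 powr p * (norm (X a \<omega> - z) powr p + norm (X r \<omega> - X a \<omega>) powr p)"
proof -
  define x where "x = norm (X r \<omega> - X a \<omega>)"
  define y where "y = norm (X a \<omega> - z)"
  have nn: "0 \<le> y" "0 \<le> x" by (auto simp: y_def x_def)
  have "norm (\<sigma> (X r \<omega>) - \<sigma> z) powr p \<le> (\<Lambda> * (y + x)) powr p"
    using sigma_diff_le[of r \<omega> z a] p_ge by (intro powr_mono2) (auto simp: y_def x_def)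
  also have "\<dots> = \<Lambda> powr p * (y + x) powr p" using nn \<Lambda>_nonneg by (simp add: powr_mult)
  also have "\<dots> \<le> \<Lambda> powr p * (2 powr p * (y powr p + x powr p))"
    using nn p_ge by (intro mult_left_mono powr_add_le) auto
  finally show ?thesis by (simp add: powr_square x_def y_def mult.assoc)
qed

section \<open>Moments of the martingale and of the noise increments\<close>

lemma grid_subset:
  assumes "0 < \<tau>" "real m * \<tau> \<le> T" "j < m"
  shows "{real j * \<tau>..real (Suc j) * \<tau>} \<subseteq> {0..T}" "real j * \<tau> \<in> {0..T}" "real (Suc j) * \<tau> \<in> {0..T}"
proof -
  have "real (Suc j) * \<tau> \<le> real m * \<tau>" using assms by (intro mult_right_mono) auto
  then have 1: "real (Suc j) * \<tau> \<le> T" using assms(2) by (rule order_trans)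
  have 2: "real j * \<tau> \<le> real (Suc j) * \<tau>" using assms by (intro mult_right_mono) auto
  have 3: "0 \<le> real j * \<tau>" using assms by simp
  show "{real j * \<tau>..real (Suc j) * \<tau>} \<subseteq> {0..T}" "real j * \<tau> \<in> {0..T}" "real (Suc j) * \<tau> \<in> {0..T}"
    using order_trans[OF 2 1] order_trans[OF 3 2] 1 3 by (auto simp del: of_nat_Suc)
qed

lemma uniform_time_grid: "0 < \<tau> \<Longrightarrow> time_grid (\<lambda>j. real j * \<tau>) m"
  by unfold_locales simp

text \<open>The block inequality with exponent \<open>p / 2\<close>, weights \<open>e j\<close> and
  frozen values \<open>\<sigma> (Z j)\<close>. Summing \<open>m\<close> blocks costs
  \<open>m powr (s - 1)\<close> and Hoelder on each gains \<open>\<tau> powr (s - 1)\<close>; as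
  \<open>m * \<tau> \<le> T\<close>, the constant does not see the step size.\<close>

lemma error_martingale_moment:
  obtains C where "0 \<le> C" "\<And>\<tau> m Z J. 0 < \<tau> \<Longrightarrow> real m * \<tau> \<le> T \<Longrightarrow>
    (\<And>j. j < m \<Longrightarrow> Z j \<in> borel_measurable (F (real j * \<tau>))) \<Longrightarrow>
    (\<And>n. n \<le> m \<Longrightarrow> has_ito_integral P F W (real n * \<tau>) (\<lambda>r \<omega>. \<sigma> (X r \<omega>)) (J n)) \<Longrightarrow>
    (\<integral>\<^sup>+\<omega>. ennreal (running_max (\<lambda>n. \<Sum>j<n. (X (real j * \<tau>) \<omega> - Z j \<omega>) \<bullet>
      (J (Suc j) \<omega> - J j \<omega> - \<sigma> (Z j \<omega>) *v (W (real (Suc j) * \<tau>) \<omega> - W (real j * \<tau>) \<omega>))) m powr (p / 2)) \<partial>P) \<le>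
    ennreal C * (\<Sum>j<m. ennreal \<tau> * (\<integral>\<^sup>+\<omega>. ennreal (norm (X (real j * \<tau>) \<omega> - Z j \<omega>) powr p) \<partial>P) +
      (\<integral>\<^sup>+\<omega>. osc (real j * \<tau>) (real (Suc j) * \<tau>) (real j * \<tau>) \<omega> \<partial>P))"
proof -
  have q: "2 \<le> p / 2" using p_ge by simp
  obtain C where C: "0 \<le> C" "\<And>(H :: real \<Rightarrow> 'a \<Rightarrow> real ^ 'm ^ 'n) J t M x z G.
    time_grid t M \<Longrightarrow> t 0 = 0 \<Longrightarrow> (\<And>n. n \<le> M \<Longrightarrow> has_ito_integral P F W (t n) H (J n)) \<Longrightarrow>
    (\<And>j. j < M \<Longrightarrow> x j \<in> borel_measurable (F (t j))) \<Longrightarrow> (\<And>j. j < M \<Longrightarrow> z j \<in> borel_measurable (F (t j))) \<Longrightarrow>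
    G \<in> borel_measurable P \<Longrightarrow>
    (\<And>\<omega> K. \<omega> \<in> space P \<Longrightarrow> 0 \<le> K \<Longrightarrow> ennreal K \<le> (\<Sum>j<M. \<integral>\<^sup>+r\<in>{t j..t (Suc j)}.
        ennreal ((norm (x j \<omega>) * norm (H r \<omega> - z j \<omega>))\<^sup>2) \<partial>lborel) \<Longrightarrow> ennreal (K powr (p / 2 / 2)) \<le> G \<omega>) \<Longrightarrow>
    (\<integral>\<^sup>+\<omega>. ennreal (running_max (\<lambda>n. \<Sum>j<n. x j \<omega> \<bullet>
        (J (Suc j) \<omega> - J j \<omega> - z j \<omega> *v (W (t (Suc j)) \<omega> - W (t j) \<omega>))) M powr (p / 2)) \<partial>P) \<le>
    ennreal C * (\<integral>\<^sup>+\<omega>. G \<omega> \<partial>P)"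
    proof (rule ito_integral_block_moment[OF q, where ?'n = 'n], goal_cases)
      case (1 C)
      show ?case by (rule 1(1)[OF 1(2,3)])
    qed
  define s where "s = p / 4"
  have s: "1 \<le> s" "p / 2 / 2 = s" using p_ge by (auto simp: s_def)
  define D where "D = \<Lambda> powr (p / 2) * 2 powr p"
  have D: "0 \<le> D" by (simp add: D_def)
  define c where "c = 2 powr s * T powr (s - 1) * (2 powr s * D)"
  have c: "0 \<le> c" using D by (simp add: c_def)
  show ?thesis
  proof (rule that[of "C * c"])
    show "0 \<le> C * c" using C(1) c by simp
    fix \<tau> :: real and m :: nat and Z J :: "nat \<Rightarrow> 'a \<Rightarrow> real ^ 'n"
    assume \<tau>: "0 < \<tau>" and m: "real m * \<tau> \<le> T"
      and Z: "\<And>j. j < m \<Longrightarrow> Z j \<in> borel_measurable (F (real j * \<tau>))"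
      and J: "\<And>n. n \<le> m \<Longrightarrow> has_ito_integral P F W (real n * \<tau>) (\<lambda>r \<omega>. \<sigma> (X r \<omega>)) (J n)"
    define t where "t j = real j * \<tau>" for j
    have grid: "time_grid t m" unfolding t_def using \<tau> by (rule uniform_time_grid)
    have t0: "t 0 = 0" by (simp add: t_def)
    have J': "has_ito_integral P F W (t n) (\<lambda>r \<omega>. \<sigma> (X r \<omega>)) (J n)" if "n \<le> m" for n
      using J[OF that] by (simp add: t_def)
    have td: "t (Suc j) - t j = \<tau>" "t j < t (Suc j)" for j using \<tau> by (auto simp: t_def distrib_right)
    have sub: "{t j..t (Suc j)} \<subseteq> {0..T}" "t j \<in> {0..T}" if "j < m" for j
      using grid_subset[OF \<tau> m that] by (auto simp: t_def)
    define e where "e j \<omega> = X (t j) \<omega> - Z j \<omega>" for j \<omega>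
    have eF: "e j \<in> borel_measurable (F (t j))" if "j < m" for j
      unfolding e_def using X_F[of "t j"] Z[OF that] sub(2)[OF that] by (intro borel_measurable_diff) (auto simp: t_def)
    have eP: "e j \<in> borel_measurable P" if "j < m" for j
      using F_measurable_P[OF eF[OF that]] sub(2)[OF that] by simp
    have ZF: "(\<lambda>\<omega>. \<sigma> (Z j \<omega>)) \<in> borel_measurable (F (t j))" if "j < m" for j
      unfolding t_def by (rule measurable_compose[OF Z[OF that] \<sigma>_borel])
    define A where "A j \<omega> = ennreal (\<tau> * norm (e j \<omega>) powr p) + osc (t j) (t (Suc j)) (t j) \<omega>" for j \<omega>
    have oscP: "osc (t j) (t (Suc j)) (t j) \<in> borel_measurable P" if "j < m" for j
      using osc(1)[OF sub[OF that]] .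
    have AP: "A j \<in> borel_measurable P" if "j < m" for j
    proof -
      note [measurable] = eP[OF that] oscP[OF that]
      show ?thesis unfolding A_def by measurable
    qed
    have AI: "(\<integral>\<^sup>+\<omega>. A j \<omega> \<partial>P) = ennreal \<tau> * (\<integral>\<^sup>+\<omega>. ennreal (norm (e j \<omega>) powr p) \<partial>P) + (\<integral>\<^sup>+\<omega>. osc (t j) (t (Suc j)) (t j) \<omega> \<partial>P)"
      if "j < m" for j
    proof -
      note [measurable] = eP[OF that] oscP[OF that]
      show ?thesis unfolding A_def using \<tau> by (simp add: nn_integral_add nn_integral_cmult ennreal_mult)
    qed
    define G where "G \<omega> = ennreal c * (\<Sum>j<m. A j \<omega>)" for \<omega>
    have "(\<integral>\<^sup>+\<omega>. ennreal (running_max (\<lambda>n. \<Sum>j<n. e j \<omega> \<bullet>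
      (J (Suc j) \<omega> - J j \<omega> - \<sigma> (Z j \<omega>) *v (W (t (Suc j)) \<omega> - W (t j) \<omega>))) m powr (p / 2)) \<partial>P) \<le> ennreal C * (\<integral>\<^sup>+\<omega>. G \<omega> \<partial>P)"
    proof (rule C(2)[OF grid t0 J'])
      show "G \<in> borel_measurable P"
      proof -
        have [measurable]: "(\<lambda>\<omega>. \<Sum>j<m. A j \<omega>) \<in> borel_measurable P"
          using AP by (intro borel_measurable_sum) auto
        show ?thesis unfolding G_def by measurable
      qed
      fix \<omega> K assume \<omega>: "\<omega> \<in> space P" and K: "0 \<le> K"
        and le: "ennreal K \<le> (\<Sum>j<m. \<integral>\<^sup>+r\<in>{t j..t (Suc j)}. ennreal ((norm (e j \<omega>) * norm (\<sigma> (X r \<omega>) - \<sigma> (Z j \<omega>)))\<^sup>2) \<partial>lborel)"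
      obtain y where y: "\<And>j. 0 \<le> y j" "\<And>j. j < m \<Longrightarrow> ennreal (y j) \<le>
          (\<integral>\<^sup>+r\<in>{t j..t (Suc j)}. ennreal ((norm (e j \<omega>) * norm (\<sigma> (X r \<omega>) - \<sigma> (Z j \<omega>)))\<^sup>2) \<partial>lborel)" "K \<le> (\<Sum>j<m. y j)"
        using ennreal_le_sumE[OF K le] by blast
      have y_le: "ennreal (y j powr s) \<le> ennreal (2 powr s * \<tau> powr (s - 1) * D) * A j \<omega>" if j: "j < m" for j
      proof -
        have "(\<lambda>r. (norm (e j \<omega>) * norm (\<sigma> (X r \<omega>) - \<sigma> (Z j \<omega>)))\<^sup>2) \<in> borel_measurable (restrict_space borel {t j..t (Suc j)})"
          using path_measurable[OF \<omega> sub(1)[OF j] \<sigma>_cont] by simp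
        from block_powr_le[OF \<omega> sub(1)[OF j] td(2) this _ s(1) D norm_ge_zero _ y(1) y(2)[OF j], of "e j \<omega>"]
        show ?thesis
          using weighted_sigma_powr_le[of "t j" \<omega> "Z j \<omega>"] unfolding e_def td A_def D_def s_def by simp
      qed
      have "K powr s \<le> (\<Sum>j<m. y j) powr s" using K y(3) s by (intro powr_mono2) auto
      also have "\<dots> \<le> 2 powr s * real m powr (s - 1) * (\<Sum>j<m. y j powr s)"
        using sum_powr_le[of "{..<m}" y s] y(1) s by simp
      finally have "ennreal (K powr s) \<le> ennreal (2 powr s * real m powr (s - 1)) * (\<Sum>j<m. ennreal (y j powr s))"
        by (simp add: ennreal_leI sum_nonneg flip: ennreal_mult)
      also have "\<dots> \<le> ennreal (2 powr s * real m powr (s - 1)) * (\<Sum>j<m. ennreal (2 powr s * \<tau> powr (s - 1) * D) * A j \<omega>)"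
        using y_le by (intro mult_left_mono sum_mono) auto
      also have "\<dots> = ennreal (2 powr s * real m powr (s - 1) * (2 powr s * \<tau> powr (s - 1) * D)) * (\<Sum>j<m. A j \<omega>)"
        using D by (simp add: ennreal_mult mult.assoc flip: sum_distrib_left)
      also have "\<dots> \<le> ennreal c * (\<Sum>j<m. A j \<omega>)"
      proof (intro mult_right_mono ennreal_leI)
        have "real m powr (s - 1) * \<tau> powr (s - 1) \<le> T powr (s - 1)"
          using m \<tau> s powr_mono2[of "s - 1" "real m * \<tau>" T] by (simp add: powr_mult)
        then have "2 powr s * (2 powr s * D) * (real m powr (s - 1) * \<tau> powr (s - 1)) \<le> 2 powr s * (2 powr s * D) * T powr (s - 1)"
          using D by (intro mult_left_mono) auto
        then show "2 powr s * real m powr (s - 1) * (2 powr s * \<tau> powr (s - 1) * D) \<le> c"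
          by (simp add: c_def mult_ac)
      qed simp
      finally show "ennreal (K powr (p / 2 / 2)) \<le> G \<omega>" unfolding s(2) G_def .
    qed (use J eF ZF in \<open>auto simp: t_def\<close>)
    also have "(\<integral>\<^sup>+\<omega>. G \<omega> \<partial>P) = ennreal c * (\<Sum>j<m. \<integral>\<^sup>+\<omega>. A j \<omega> \<partial>P)"
      unfolding G_def using AP by (subst nn_integral_cmult, simp) (subst nn_integral_sum, auto)
    also have "(\<Sum>j<m. \<integral>\<^sup>+\<omega>. A j \<omega> \<partial>P) = (\<Sum>j<m. ennreal \<tau> * (\<integral>\<^sup>+\<omega>. ennreal (norm (e j \<omega>) powr p) \<partial>P) + (\<integral>\<^sup>+\<omega>. osc (t j) (t (Suc j)) (t j) \<omega> \<partial>P))"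
      using AI by (intro sum.cong) auto
    finally show "(\<integral>\<^sup>+\<omega>. ennreal (running_max (\<lambda>n. \<Sum>j<n. (X (real j * \<tau>) \<omega> - Z j \<omega>) \<bullet>
      (J (Suc j) \<omega> - J j \<omega> - \<sigma> (Z j \<omega>) *v (W (real (Suc j) * \<tau>) \<omega> - W (real j * \<tau>) \<omega>))) m powr (p / 2)) \<partial>P) \<le>
    ennreal (C * c) * (\<Sum>j<m. ennreal \<tau> * (\<integral>\<^sup>+\<omega>. ennreal (norm (X (real j * \<tau>) \<omega> - Z j \<omega>) powr p) \<partial>P) +
      (\<integral>\<^sup>+\<omega>. osc (real j * \<tau>) (real (Suc j) * \<tau>) (real j * \<tau>) \<omega> \<partial>P))"
      using C(1) c unfolding e_def t_def by (simp add: ennreal_mult mult.assoc)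
  qed
qed

lemma noise_increment_moment:
  obtains C where "0 \<le> C" "\<And>\<tau> j Z J. 0 < \<tau> \<Longrightarrow> real (Suc j) * \<tau> \<le> T \<Longrightarrow>
    (\<And>k. k \<le> j \<Longrightarrow> Z k \<in> borel_measurable (F (real k * \<tau>))) \<Longrightarrow>
    (\<And>n. n \<le> Suc j \<Longrightarrow> has_ito_integral P F W (real n * \<tau>) (\<lambda>r \<omega>. \<sigma> (X r \<omega>)) (J n)) \<Longrightarrow>
    (\<integral>\<^sup>+\<omega>. ennreal (norm (J (Suc j) \<omega> - J j \<omega> - \<sigma> (Z j \<omega>) *v (W (real (Suc j) * \<tau>) \<omega> - W (real j * \<tau>) \<omega>)) powr p) \<partial>P) \<le>
    ennreal (C * \<tau> powr (p / 2 - 1)) * (ennreal \<tau> * (\<integral>\<^sup>+\<omega>. ennreal (norm (X (real j * \<tau>) \<omega> - Z j \<omega>) powr p) \<partial>P) +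
      (\<integral>\<^sup>+\<omega>. osc (real j * \<tau>) (real (Suc j) * \<tau>) (real j * \<tau>) \<omega> \<partial>P))"
proof -
  have q: "2 \<le> p" using p_ge by simp
  obtain C where C: "0 \<le> C" "\<And>(H :: real \<Rightarrow> 'a \<Rightarrow> real ^ 'm ^ 'n) J t M x z G.
    time_grid t M \<Longrightarrow> t 0 = 0 \<Longrightarrow> (\<And>n. n \<le> M \<Longrightarrow> has_ito_integral P F W (t n) H (J n)) \<Longrightarrow>
    (\<And>j. j < M \<Longrightarrow> x j \<in> borel_measurable (F (t j))) \<Longrightarrow> (\<And>j. j < M \<Longrightarrow> z j \<in> borel_measurable (F (t j))) \<Longrightarrow>
    G \<in> borel_measurable P \<Longrightarrow>
    (\<And>\<omega> K. \<omega> \<in> space P \<Longrightarrow> 0 \<le> K \<Longrightarrow> ennreal K \<le> (\<Sum>j<M. \<integral>\<^sup>+r\<in>{t j..t (Suc j)}.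
        ennreal ((norm (x j \<omega>) * norm (H r \<omega> - z j \<omega>))\<^sup>2) \<partial>lborel) \<Longrightarrow> ennreal (K powr (p / 2)) \<le> G \<omega>) \<Longrightarrow>
    (\<integral>\<^sup>+\<omega>. ennreal (running_max (\<lambda>n. \<Sum>j<n. x j \<omega> \<bullet>
        (J (Suc j) \<omega> - J j \<omega> - z j \<omega> *v (W (t (Suc j)) \<omega> - W (t j) \<omega>))) M powr p) \<partial>P) \<le>
    ennreal C * (\<integral>\<^sup>+\<omega>. G \<omega> \<partial>P)"
    proof (rule ito_integral_block_moment[OF q, where ?'n = 'n], goal_cases)
      case (1 C)
      show ?case by (rule 1(1)[OF 1(2,3)])
    qed
  define D where "D = \<Lambda> powr p * 2 powr p"
  have D: "0 \<le> D" by (simp add: D_def)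
  define d where "d = 2 powr p * real CARD('n) powr (p - 1) * real CARD('n)"
  have d: "0 \<le> d" by (simp add: d_def)
  show ?thesis
  proof (rule that[of "d * (C * (2 powr (p / 2) * D))"])
    show "0 \<le> d * (C * (2 powr (p / 2) * D))" using C(1) d D by simp
    fix \<tau> :: real and j :: nat and Z J :: "nat \<Rightarrow> 'a \<Rightarrow> real ^ 'n"
    assume \<tau>: "0 < \<tau>" and m: "real (Suc j) * \<tau> \<le> T"
      and Z: "\<And>k. k \<le> j \<Longrightarrow> Z k \<in> borel_measurable (F (real k * \<tau>))"
      and J: "\<And>n. n \<le> Suc j \<Longrightarrow> has_ito_integral P F W (real n * \<tau>) (\<lambda>r \<omega>. \<sigma> (X r \<omega>)) (J n)"
    define t where "t j = real j * \<tau>" for j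
    have grid: "time_grid t (Suc j)" unfolding t_def using \<tau> by (rule uniform_time_grid)
    have t0: "t 0 = 0" by (simp add: t_def)
    have J': "has_ito_integral P F W (t n) (\<lambda>r \<omega>. \<sigma> (X r \<omega>)) (J n)" if "n \<le> Suc j" for n
      using J[OF that] by (simp add: t_def)
    have td: "t (Suc j) - t j = \<tau>" "t j < t (Suc j)" using \<tau> by (auto simp: t_def distrib_right)
    have sub: "{t j..t (Suc j)} \<subseteq> {0..T}" "t j \<in> {0..T}"
      using grid_subset[OF \<tau> m, of j] by (auto simp: t_def)
    define e where "e \<omega> = X (t j) \<omega> - Z j \<omega>" for \<omega>
    have ZP[measurable]: "Z j \<in> borel_measurable P" using F_measurable_P[OF Z[of j]] \<tau> by simp
    have [measurable]: "X (t j) \<in> borel_measurable P" using X_P sub(2) by simp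
    have eP[measurable]: "e \<in> borel_measurable P" unfolding e_def by measurable
    have ZF: "(\<lambda>\<omega>. \<sigma> (Z k \<omega>)) \<in> borel_measurable (F (t k))" if "k < Suc j" for k
      unfolding t_def using that by (intro measurable_compose[OF Z \<sigma>_borel]) simp
    define A where "A \<omega> = ennreal (\<tau> * norm (e \<omega>) powr p) + osc (t j) (t (Suc j)) (t j) \<omega>" for \<omega>
    have [measurable]: "osc (t j) (t (Suc j)) (t j) \<in> borel_measurable P"
      using osc(1)[OF sub] .
    have AP[measurable]: "A \<in> borel_measurable P" unfolding A_def by measurable
    have AI: "(\<integral>\<^sup>+\<omega>. A \<omega> \<partial>P) = ennreal \<tau> * (\<integral>\<^sup>+\<omega>. ennreal (norm (e \<omega>) powr p) \<partial>P) + (\<integral>\<^sup>+\<omega>. osc (t j) (t (Suc j)) (t j) \<omega> \<partial>P)"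
      unfolding A_def using \<tau> by (simp add: nn_integral_add nn_integral_cmult ennreal_mult)
    define g where "g = 2 powr (p / 2) * \<tau> powr (p / 2 - 1) * D"
    have g: "0 \<le> g" using D by (simp add: g_def)
    define N where "N k \<omega> = J (Suc k) \<omega> - J k \<omega> - \<sigma> (Z k \<omega>) *v (W (t (Suc k)) \<omega> - W (t k) \<omega>)" for k \<omega>
    have NP[measurable]: "N j \<in> borel_measurable P"
    proof -
      have [measurable]: "J (Suc j) \<in> borel_measurable P" "J j \<in> borel_measurable P"
        using J[of j] J[of "Suc j"] by (simp_all add: has_ito_integral_def)
      have [measurable]: "W (t (Suc j)) \<in> borel_measurable P" "W (t j) \<in> borel_measurable P"
        using \<tau> by (auto intro!: W_measurable_P simp: t_def)
      note [measurable] = \<sigma>_borel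
      show ?thesis unfolding N_def by measurable
    qed
    have comp: "(\<integral>\<^sup>+\<omega>. ennreal (\<bar>N j \<omega> $ i\<bar> powr p) \<partial>P) \<le> ennreal C * (ennreal g * (\<integral>\<^sup>+\<omega>. A \<omega> \<partial>P))" for i
    proof -
      \<comment> \<open>This weight singles out coordinate \<open>i\<close> of the last block, so
        that the inequality for scalar block sums yields the increment itself.\<close>
      define x where "x k \<omega> = (if k = j then axis i 1 else 0 :: real ^ 'n)" for k :: nat and \<omega> :: 'a
      have "(\<integral>\<^sup>+\<omega>. ennreal (\<bar>N j \<omega> $ i\<bar> powr p) \<partial>P) \<le> (\<integral>\<^sup>+\<omega>. ennreal (running_max (\<lambda>n. \<Sum>k<n. x k \<omega> \<bullet> N k \<omega>) (Suc j) powr p) \<partial>P)"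
      proof (intro nn_integral_mono ennreal_leI powr_mono2)
        fix \<omega>
        have "(\<Sum>k<Suc j. x k \<omega> \<bullet> N k \<omega>) = N j \<omega> $ i" by (simp add: x_def inner_axis')
        then show "\<bar>N j \<omega> $ i\<bar> \<le> running_max (\<lambda>n. \<Sum>k<n. x k \<omega> \<bullet> N k \<omega>) (Suc j)"
          using abs_le_running_max[of "Suc j" "Suc j" "\<lambda>n. \<Sum>k<n. x k \<omega> \<bullet> N k \<omega>"] by simp
      qed (use q in auto)
      also have "\<dots> \<le> ennreal C * (\<integral>\<^sup>+\<omega>. ennreal g * A \<omega> \<partial>P)"
        unfolding N_def
      proof (rule C(2)[OF grid t0 J'])
        show "x k \<in> borel_measurable (F (t k))" for k unfolding x_def by simp
        fix \<omega> K assume \<omega>: "\<omega> \<in> space P" and K: "0 \<le> K"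
          and "ennreal K \<le> (\<Sum>k<Suc j. \<integral>\<^sup>+r\<in>{t k..t (Suc k)}. ennreal ((norm (x k \<omega>) * norm (\<sigma> (X r \<omega>) - \<sigma> (Z k \<omega>)))\<^sup>2) \<partial>lborel)"
        then have le: "ennreal K \<le> (\<integral>\<^sup>+r\<in>{t j..t (Suc j)}. ennreal ((norm (\<sigma> (X r \<omega>) - \<sigma> (Z j \<omega>)))\<^sup>2) \<partial>lborel)"
          by (simp add: x_def)
        have "(\<lambda>r. (norm (\<sigma> (X r \<omega>) - \<sigma> (Z j \<omega>)))\<^sup>2) \<in> borel_measurable (restrict_space borel {t j..t (Suc j)})"
          using path_measurable[OF \<omega> sub(1) \<sigma>_cont] by simp
        from block_powr_le[OF \<omega> sub(1) td(2) this _ _ D norm_ge_zero _ K le, of "p / 2" "e \<omega>"]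
        show "ennreal (K powr (p / 2)) \<le> ennreal g * A \<omega>"
          using sigma_powr_le[of _ \<omega> "Z j \<omega>" "t j"] q unfolding e_def td A_def D_def g_def by simp
      qed (use J ZF in \<open>auto simp: t_def\<close>)
      also have "(\<integral>\<^sup>+\<omega>. ennreal g * A \<omega> \<partial>P) = ennreal g * (\<integral>\<^sup>+\<omega>. A \<omega> \<partial>P)" by (simp add: nn_integral_cmult)
      finally show ?thesis .
    qed
    have "(\<integral>\<^sup>+\<omega>. ennreal (norm (N j \<omega>) powr p) \<partial>P) \<le>
        (\<integral>\<^sup>+\<omega>. ennreal (2 powr p * real CARD('n) powr (p - 1)) * (\<Sum>i\<in>UNIV. ennreal (\<bar>N j \<omega> $ i\<bar> powr p)) \<partial>P)"
    proof (rule nn_integral_mono)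
      fix \<omega>
      have "norm (N j \<omega>) powr p \<le> (\<Sum>i\<in>UNIV. \<bar>N j \<omega> $ i\<bar>) powr p"
        using q by (intro powr_mono2 norm_le_l1_cart) auto
      also have "\<dots> \<le> 2 powr p * real CARD('n) powr (p - 1) * (\<Sum>i\<in>UNIV. \<bar>N j \<omega> $ i\<bar> powr p)"
        using q by (intro sum_powr_le) auto
      finally show "ennreal (norm (N j \<omega>) powr p) \<le> ennreal (2 powr p * real CARD('n) powr (p - 1)) * (\<Sum>i\<in>UNIV. ennreal (\<bar>N j \<omega> $ i\<bar> powr p))"
        by (simp add: ennreal_leI sum_nonneg flip: ennreal_mult)
    qed
    also have "\<dots> = ennreal (2 powr p * real CARD('n) powr (p - 1)) * (\<Sum>i\<in>UNIV. \<integral>\<^sup>+\<omega>. ennreal (\<bar>N j \<omega> $ i\<bar> powr p) \<partial>P)"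
      by (subst nn_integral_cmult nn_integral_sum; measurable)+
    also have "\<dots> \<le> ennreal (2 powr p * real CARD('n) powr (p - 1)) * (\<Sum>i\<in>(UNIV :: 'n set). ennreal C * (ennreal g * (\<integral>\<^sup>+\<omega>. A \<omega> \<partial>P)))"
      by (intro mult_left_mono sum_mono comp) auto
    also have "\<dots> = ennreal (d * (C * g)) * (\<integral>\<^sup>+\<omega>. A \<omega> \<partial>P)"
      using C(1) g by (simp add: d_def ennreal_mult mult.assoc ennreal_of_nat_eq_real_of_nat)
    also have "d * (C * g) = d * (C * (2 powr (p / 2) * D)) * \<tau> powr (p / 2 - 1)" by (simp add: g_def mult_ac)
    finally show "(\<integral>\<^sup>+\<omega>. ennreal (norm (J (Suc j) \<omega> - J j \<omega> - \<sigma> (Z j \<omega>) *v (W (real (Suc j) * \<tau>) \<omega> - W (real j * \<tau>) \<omega>)) powr p) \<partial>P) \<le>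
    ennreal (d * (C * (2 powr (p / 2) * D)) * \<tau> powr (p / 2 - 1)) * (ennreal \<tau> * (\<integral>\<^sup>+\<omega>. ennreal (norm (X (real j * \<tau>) \<omega> - Z j \<omega>) powr p) \<partial>P) +
      (\<integral>\<^sup>+\<omega>. osc (real j * \<tau>) (real (Suc j) * \<tau>) (real j * \<tau>) \<omega> \<partial>P))"
      unfolding AI unfolding N_def e_def t_def .
  qed
qed

text \<open>Hoelder over a block gains \<open>(c - a) powr (p - 1)\<close>, exactly what compensates
  the negative power of the step with which the remainder enters the error recursion.\<close>

lemma drift_remainder_powr_le:
  assumes \<omega>: "\<omega> \<in> space P" and ac: "{a..c} \<subseteq> {0..T}" "a < c"
  shows "ennreal (norm (integral {a..c} (\<lambda>r. b (X r \<omega>) - b (X c \<omega>))) powr p) \<le>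
    ennreal (2 powr p * (c - a) powr (p - 1)) * b_osc a c c \<omega>"
proof -
  have cont: "continuous_on {a..c} (\<lambda>r. b (X r \<omega>) - b (X c \<omega>))"
    by (intro continuous_intros continuous_on_compose2[OF b_cont] continuous_on_subset[OF X_continuous[OF \<omega>] ac(1)]) auto
  then have int: "set_integrable lborel {a..c} (\<lambda>r. b (X r \<omega>) - b (X c \<omega>))"
    by (rule borel_integrable_atLeastAtMost')
  have "ennreal (norm (integral {a..c} (\<lambda>r. b (X r \<omega>) - b (X c \<omega>)))) =
      ennreal (norm (\<integral>r. indicat_real {a..c} r *\<^sub>R (b (X r \<omega>) - b (X c \<omega>)) \<partial>lborel))"
    using set_borel_integral_eq_integral(2)[OF int] by (simp add: set_lebesgue_integral_def)
  also have "\<dots> \<le> (\<integral>\<^sup>+r. ennreal (norm (indicat_real {a..c} r *\<^sub>R (b (X r \<omega>) - b (X c \<omega>)))) \<partial>lborel)"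
    using int unfolding set_integrable_def by (rule integral_norm_bound_ennreal)
  also have "\<dots> = (\<integral>\<^sup>+r\<in>{a..c}. ennreal (norm (b (X r \<omega>) - b (X c \<omega>))) \<partial>lborel)"
    by (intro nn_integral_cong) (auto simp: indicator_def)
  finally have le: "ennreal (norm (integral {a..c} (\<lambda>r. b (X r \<omega>) - b (X c \<omega>)))) \<le>
      (\<integral>\<^sup>+r\<in>{a..c}. ennreal (norm (b (X r \<omega>) - b (X c \<omega>))) \<partial>lborel)" .
  show ?thesis
    unfolding b_osc_def
  proof (rule set_nn_integral_powr_le[OF _ _ _ norm_ge_zero le ac(2)])
    show "(\<lambda>r. norm (b (X r \<omega>) - b (X c \<omega>))) \<in> borel_measurable (restrict_space borel {a..c})"
      using path_measurable[OF \<omega> ac(1) b_cont] by simp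
  qed (use p_ge in auto)
qed

text \<open>\<open>b\<close> is frozen at the right endpoint to match the implicit scheme.
  Continuity of the path identifies the Lebesgue integral with \<open>integral\<close>, for which
  adjacent closed intervals combine.\<close>

lemma drift_integral_split:
  assumes \<omega>: "\<omega> \<in> space P" and ac: "0 \<le> a" "a \<le> c" "c \<le> T"
  shows "(LINT r:{0..c}|lborel. b (X r \<omega>)) = (LINT r:{0..a}|lborel. b (X r \<omega>)) + (c - a) *\<^sub>R b (X c \<omega>) +
    integral {a..c} (\<lambda>r. b (X r \<omega>) - b (X c \<omega>))"
proof -
  have cont: "continuous_on {u..v} (\<lambda>r. b (X r \<omega>))" if "0 \<le> u" "v \<le> T" for u v
    by (intro continuous_on_compose2[OF b_cont] continuous_on_subset[OF X_continuous[OF \<omega>]]) (use that in auto)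
  have eq: "(LINT r:{0..v}|lborel. b (X r \<omega>)) = integral {0..v} (\<lambda>r. b (X r \<omega>))" if "v \<le> T" for v
    using cont[of 0 v] that by (intro set_borel_integral_eq_integral(2) borel_integrable_atLeastAtMost') auto
  have int: "(\<lambda>r. b (X r \<omega>)) integrable_on {u..v}" if "0 \<le> u" "v \<le> T" for u v
    using cont[OF that] by (rule integrable_continuous_real)
  have "integral {0..a} (\<lambda>r. b (X r \<omega>)) + integral {a..c} (\<lambda>r. b (X r \<omega>)) = integral {0..c} (\<lambda>r. b (X r \<omega>))"
    using ac int[of 0 c] by (intro Henstock_Kurzweil_Integration.integral_combine) auto
  moreover have "integral {a..c} (\<lambda>r. b (X r \<omega>) - b (X c \<omega>)) = integral {a..c} (\<lambda>r. b (X r \<omega>)) - (c - a) *\<^sub>R b (X c \<omega>)"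
    using int[of a c] ac by (subst integral_diff) auto
  ultimately show ?thesis using ac eq[of a] eq[of c] by simp
qed

text \<open>Expectation of the pathwise recursion, for every \<open>m \<le> M\<close> so that
  Gronwall's lemma can follow. Apart from the \<open>\<tau>\<close> in front of the error moments
  all powers of the step cancel, which is why \<open>\<alpha>\<close> is chosen before
  \<open>\<tau>\<close> and \<open>M\<close>.\<close>

lemma error_moment_recursion:
  fixes \<epsilon> \<kappa> :: real
  assumes \<epsilon>: "0 < \<epsilon>" and \<kappa>: "\<kappa> < 1"
  obtains \<alpha> where "0 \<le> \<alpha>" "\<And>\<tau> M Y Z m. 0 < \<tau> \<Longrightarrow> real M * \<tau> = T \<Longrightarrow> (2 * L + \<epsilon>) * \<tau> \<le> \<kappa> \<Longrightarrow>
    backward_euler P W b \<sigma> X0 \<tau> M Y \<Longrightarrow> (\<And>k. k \<le> M \<Longrightarrow> Z k \<in> borel_measurable (F (real k * \<tau>))) \<Longrightarrow>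
    (AE \<omega> in P. \<forall>k\<le>M. Y k \<omega> = Z k \<omega>) \<Longrightarrow> m \<le> M \<Longrightarrow>
    (\<integral>\<^sup>+\<omega>. ennreal (running_max (\<lambda>n. norm (X (real n * \<tau>) \<omega> - Z n \<omega>)) m powr p) \<partial>P) \<le>
    ennreal \<alpha> * (\<Sum>j<m. ennreal \<tau> * (\<integral>\<^sup>+\<omega>. ennreal (norm (X (real j * \<tau>) \<omega> - Z j \<omega>) powr p) \<partial>P) +
      (\<integral>\<^sup>+\<omega>. osc (real j * \<tau>) (real (Suc j) * \<tau>) (real j * \<tau>) \<omega> \<partial>P) +
      (\<integral>\<^sup>+\<omega>. b_osc (real j * \<tau>) (real (Suc j) * \<tau>) (real (Suc j) * \<tau>) \<omega> \<partial>P))"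
proof -
  obtain CS where CS: "0 \<le> CS" "\<And>\<tau> m Z J. 0 < \<tau> \<Longrightarrow> real m * \<tau> \<le> T \<Longrightarrow>
    (\<And>j. j < m \<Longrightarrow> Z j \<in> borel_measurable (F (real j * \<tau>))) \<Longrightarrow>
    (\<And>n. n \<le> m \<Longrightarrow> has_ito_integral P F W (real n * \<tau>) (\<lambda>r \<omega>. \<sigma> (X r \<omega>)) (J n)) \<Longrightarrow>
    (\<integral>\<^sup>+\<omega>. ennreal (running_max (\<lambda>n. \<Sum>j<n. (X (real j * \<tau>) \<omega> - Z j \<omega>) \<bullet>
      (J (Suc j) \<omega> - J j \<omega> - \<sigma> (Z j \<omega>) *v (W (real (Suc j) * \<tau>) \<omega> - W (real j * \<tau>) \<omega>))) m powr (p / 2)) \<partial>P) \<le>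
    ennreal CS * (\<Sum>j<m. ennreal \<tau> * (\<integral>\<^sup>+\<omega>. ennreal (norm (X (real j * \<tau>) \<omega> - Z j \<omega>) powr p) \<partial>P) +
      (\<integral>\<^sup>+\<omega>. osc (real j * \<tau>) (real (Suc j) * \<tau>) (real j * \<tau>) \<omega> \<partial>P))"
  proof (rule error_martingale_moment, goal_cases)
    case (1 C)
    show ?case by (rule 1(1)[of C, OF 1(2,3)])
  qed
  obtain CN where CN: "0 \<le> CN" "\<And>\<tau> j Z J. 0 < \<tau> \<Longrightarrow> real (Suc j) * \<tau> \<le> T \<Longrightarrow>
    (\<And>k. k \<le> j \<Longrightarrow> Z k \<in> borel_measurable (F (real k * \<tau>))) \<Longrightarrow>
    (\<And>n. n \<le> Suc j \<Longrightarrow> has_ito_integral P F W (real n * \<tau>) (\<lambda>r \<omega>. \<sigma> (X r \<omega>)) (J n)) \<Longrightarrow>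
    (\<integral>\<^sup>+\<omega>. ennreal (norm (J (Suc j) \<omega> - J j \<omega> - \<sigma> (Z j \<omega>) *v (W (real (Suc j) * \<tau>) \<omega> - W (real j * \<tau>) \<omega>)) powr p) \<partial>P) \<le>
    ennreal (CN * \<tau> powr (p / 2 - 1)) * (ennreal \<tau> * (\<integral>\<^sup>+\<omega>. ennreal (norm (X (real j * \<tau>) \<omega> - Z j \<omega>) powr p) \<partial>P) +
      (\<integral>\<^sup>+\<omega>. osc (real j * \<tau>) (real (Suc j) * \<tau>) (real j * \<tau>) \<omega> \<partial>P))"
  proof (rule noise_increment_moment, goal_cases)
    case (1 C)
    note C = this
    show ?case
    proof (rule C(1)[of C, OF C(2)], goal_cases)
      case (1 \<tau> j Z J)
      then show ?case by (rule C(3)[of \<tau> j Z J])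
    qed
  qed
  define q where "q = p / 2"
  have q: "1 \<le> q" "2 * q = p" using p_ge by (auto simp: q_def)
  define K where "K = 2 * L + \<epsilon>"
  have K: "0 \<le> K" using L_nonneg \<epsilon> by (simp add: K_def)
  define \<theta> where "\<theta> = 2 powr q * T powr (q - 1)"
  have \<theta>: "0 \<le> \<theta>" by (simp add: \<theta>_def)
  \<comment> \<open>The factor \<open>4 powr q\<close> of the recursion divided by the absorbed
    coefficient \<open>(1 - \<kappa>) powr q\<close>; \<open>k1\<close> to \<open>k4\<close> are the
    resulting coefficients of error, drift remainder, martingale and noise increments.\<close>
  define \<beta> where "\<beta> = 4 powr q / (1 - \<kappa>) powr q"
  have \<beta>: "0 \<le> \<beta>" by (simp add: \<beta>_def)
  define k1 where "k1 = \<beta> * (K powr q * \<theta>)"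
  define k2 where "k2 = \<beta> * (\<epsilon> powr (- q) * \<theta>)"
  define k3 where "k3 = \<beta> * 2 powr q"
  define k4 where "k4 = \<beta> * \<theta>"
  have k: "0 \<le> k1" "0 \<le> k2" "0 \<le> k3" "0 \<le> k4" using \<beta> \<theta> by (auto simp: k1_def k2_def k3_def k4_def)
  define \<alpha> where "\<alpha> = k1 + k2 * 2 powr p + k3 * CS + k4 * CN"
  show ?thesis
  proof (rule that[of \<alpha>])
    show "0 \<le> \<alpha>" using k CS(1) CN(1) by (simp add: \<alpha>_def)
    fix \<tau> :: real and M m :: nat and Y Z :: "nat \<Rightarrow> 'a \<Rightarrow> real ^ 'n"
    assume \<tau>: "0 < \<tau>" and M: "real M * \<tau> = T" and \<tau>\<kappa>: "(2 * L + \<epsilon>) * \<tau> \<le> \<kappa>"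
      and Y: "backward_euler P W b \<sigma> X0 \<tau> M Y"
      and Z: "\<And>k. k \<le> M \<Longrightarrow> Z k \<in> borel_measurable (F (real k * \<tau>))"
      and YZ: "AE \<omega> in P. \<forall>k\<le>M. Y k \<omega> = Z k \<omega>" and m: "m \<le> M"
    define t where "t j = real j * \<tau>" for j
    have tle: "0 \<le> t n" "t n \<le> T" if "n \<le> M" for n
      using \<tau> that M mult_right_mono[of "real n" "real M" \<tau>] by (auto simp: t_def)
    have mT: "real n * \<tau> \<le> T" if "n \<le> M" for n using tle[OF that] by (simp add: t_def)
    have sub: "{t j..t (Suc j)} \<subseteq> {0..T}" "t j \<in> {0..T}" "t (Suc j) \<in> {0..T}" "t j < t (Suc j)" "t (Suc j) - t j = \<tau>"
      if "j < M" for j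
      using tle[of j] tle[of "Suc j"] that \<tau> by (auto simp: t_def distrib_right)
    have "\<exists>J. has_ito_integral P F W (t n) (\<lambda>r \<omega>. \<sigma> (X r \<omega>)) J \<and>
      (AE \<omega> in P. X (t n) \<omega> = X0 \<omega> + (LINT r:{0..t n}|lborel. b (X r \<omega>)) + J \<omega>)" if "n \<le> M" for n
      using X_solution tle[OF that] by (simp add: sde_solution_def)
    then have "\<forall>n. \<exists>J. n \<le> M \<longrightarrow> has_ito_integral P F W (t n) (\<lambda>r \<omega>. \<sigma> (X r \<omega>)) J \<and>
      (AE \<omega> in P. X (t n) \<omega> = X0 \<omega> + (LINT r:{0..t n}|lborel. b (X r \<omega>)) + J \<omega>)" by blast
    \<comment> \<open>The solution supplies one integral per time, each with its own null set. The
      grid has finitely many times, so all these identities hold simultaneously almost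
      surely.\<close>
    from choice[OF this] obtain J where J_all: "\<forall>n. n \<le> M \<longrightarrow> has_ito_integral P F W (t n) (\<lambda>r \<omega>. \<sigma> (X r \<omega>)) (J n) \<and>
      (AE \<omega> in P. X (t n) \<omega> = X0 \<omega> + (LINT r:{0..t n}|lborel. b (X r \<omega>)) + J n \<omega>)" ..
    have J: "has_ito_integral P F W (real n * \<tau>) (\<lambda>r \<omega>. \<sigma> (X r \<omega>)) (J n)" if "n \<le> M" for n
      using J_all that by (simp add: t_def)
    have "AE \<omega> in P. \<forall>n\<in>{..M}. X (t n) \<omega> = X0 \<omega> + (LINT r:{0..t n}|lborel. b (X r \<omega>)) + J n \<omega>"
      using J_all by (subst AE_ball_countable) auto
    then have XJ: "AE \<omega> in P. \<forall>n\<le>M. X (t n) \<omega> = X0 \<omega> + (LINT r:{0..t n}|lborel. b (X r \<omega>)) + J n \<omega>"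
      by (rule AE_mp) auto
    define e where "e n \<omega> = X (t n) \<omega> - Z n \<omega>" for n \<omega>
    define N where "N j \<omega> = J (Suc j) \<omega> - J j \<omega> - \<sigma> (Z j \<omega>) *v (W (t (Suc j)) \<omega> - W (t j) \<omega>)" for j \<omega>
    define R where "R j \<omega> = integral {t j..t (Suc j)} (\<lambda>r. b (X r \<omega>) - b (X (t (Suc j)) \<omega>))" for j \<omega>
    define S where "S \<omega> = running_max (\<lambda>n. \<Sum>j<n. e j \<omega> \<bullet> N j \<omega>) m" for \<omega>
    define bo where "bo j = b_osc (t j) (t (Suc j)) (t (Suc j))" for j
    define os where "os j = osc (t j) (t (Suc j)) (t j)" for j
    have ZP: "Z n \<in> borel_measurable P" if "n \<le> M" for n
      using F_measurable_P[OF Z[OF that]] \<tau> by simp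
    have eP: "e n \<in> borel_measurable P" if "n \<le> M" for n
      unfolding e_def using X_P[OF tle[OF that]] ZP[OF that] by measurable
    have NP: "N j \<in> borel_measurable P" if "j < M" for j
    proof -
      have [measurable]: "J (Suc j) \<in> borel_measurable P" "J j \<in> borel_measurable P"
        using J[of j] J[of "Suc j"] that by (simp_all add: has_ito_integral_def)
      have [measurable]: "W (t (Suc j)) \<in> borel_measurable P" "W (t j) \<in> borel_measurable P"
        using tle[of j] tle[of "Suc j"] that by (auto intro!: W_measurable_P)
      note [measurable] = \<sigma>_borel ZP[OF less_imp_le[OF that]]
      show ?thesis unfolding N_def by measurable
    qed
    have boP: "bo j \<in> borel_measurable P" if "j < M" for j
      unfolding bo_def by (rule b_osc(1)[OF sub(1,3)[OF that]])
    have SP[measurable]: "S \<in> borel_measurable P"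
      unfolding S_def using eP NP m by (intro running_max_measurable borel_measurable_sum borel_measurable_inner) auto
    have "AE \<omega> in P. \<forall>j\<in>{..<M}. Y (Suc j) \<omega> = Y j \<omega> + \<tau> *\<^sub>R b (Y (Suc j) \<omega>) + \<sigma> (Y j \<omega>) *v (W (t (Suc j)) \<omega> - W (t j) \<omega>)"
      using Y by (subst AE_ball_countable) (auto simp: backward_euler_def t_def)
    moreover have "AE \<omega> in P. Y 0 \<omega> = X0 \<omega>" using Y by (simp add: backward_euler_def)
    moreover have "AE \<omega> in P. X 0 \<omega> = X0 \<omega>" using X_solution by (simp add: sde_solution_def)
    ultimately have pt: "AE \<omega> in P. ennreal (running_max (\<lambda>n. norm (e n \<omega>)) m powr p) \<le>
        ennreal (k1 * \<tau>) * (\<Sum>j<m. ennreal (norm (e j \<omega>) powr p)) +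
        ennreal (k2 * 2 powr p) * (\<Sum>j<m. bo j \<omega>) +
        ennreal k3 * ennreal (S \<omega> powr q) +
        ennreal (k4 * \<tau> powr (1 - q)) * (\<Sum>j<m. ennreal (norm (N j \<omega>) powr p))"
      using YZ XJ AE_space
    proof eventually_elim
      case (elim \<omega>)
      have e0: "e 0 \<omega> = 0" using elim(2,3,4) by (simp add: e_def t_def)
      have step: "e (Suc j) \<omega> = e j \<omega> + \<tau> *\<^sub>R (b (X (t (Suc j)) \<omega>) - b (Z (Suc j) \<omega>)) + R j \<omega> + N j \<omega>" if j: "j < M" for j
      proof -
        have "X (t (Suc j)) \<omega> - X (t j) \<omega> = \<tau> *\<^sub>R b (X (t (Suc j)) \<omega>) + R j \<omega> + (J (Suc j) \<omega> - J j \<omega>)"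
        proof -
          define I where "I n = (LINT r:{0..t n}|lborel. b (X r \<omega>))" for n
          have XI: "X (t n) \<omega> = X0 \<omega> + I n + J n \<omega>" if "n \<le> M" for n
            using elim(5) that by (simp add: I_def)
          have "X (t (Suc j)) \<omega> - X (t j) \<omega> = (X0 \<omega> + I (Suc j) + J (Suc j) \<omega>) - (X0 \<omega> + I j + J j \<omega>)"
            using j by (simp only: XI[of j, symmetric] XI[of "Suc j", symmetric] less_imp_le Suc_leI)
          also have "\<dots> = (I (Suc j) - I j) + (J (Suc j) \<omega> - J j \<omega>)" by simp
          also have "I (Suc j) - I j = \<tau> *\<^sub>R b (X (t (Suc j)) \<omega>) + R j \<omega>"
            using drift_integral_split[OF elim(6), of "t j" "t (Suc j)"] tle[of j] tle[of "Suc j"] sub(4,5)[OF j] j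
            by (simp add: R_def I_def)
          finally show ?thesis .
        qed
        moreover have "Z (Suc j) \<omega> - Z j \<omega> = \<tau> *\<^sub>R b (Z (Suc j) \<omega>) + \<sigma> (Z j \<omega>) *v (W (t (Suc j)) \<omega> - W (t j) \<omega>)"
        proof -
          have sub_eq: "z' - z = v + w" if "z' = z + v + w" for z z' v w :: "real ^ 'n" using that by simp
          show ?thesis
            using elim(1)[rule_format, of j] elim(4)[rule_format, of j] elim(4)[rule_format, of "Suc j"] j
            by (intro sub_eq) simp
        qed
        moreover have "x' - z' = x - z + (v - w) + r + (d - s)" if "x' - x = v + r + d" "z' - z = w + s"
          for x x' z z' v w r d s :: "real ^ 'n"
        proof -
          have "x' = x + v + r + d" "z' = z + w + s" using that by (simp_all add: diff_eq_eq add_ac)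
          then show ?thesis by simp
        qed
        ultimately show ?thesis unfolding e_def N_def scaleR_diff_right by blast
      qed
      have rec: "(norm (e (Suc j) \<omega>))\<^sup>2 \<le> (norm (e j \<omega>))\<^sup>2 + K * \<tau> * (norm (e (Suc j) \<omega>))\<^sup>2 +
          (norm (R j \<omega>))\<^sup>2 / (\<epsilon> * \<tau>) + 2 * (e j \<omega> \<bullet> N j \<omega>) + (norm (N j \<omega>))\<^sup>2" if j: "j < m" for j
        unfolding K_def
        by (rule implicit_error_step[OF step _ \<tau> \<epsilon>]) (use j m b_one_sided in \<open>auto simp: e_def\<close>)
      have "(1 - \<kappa>) powr q * running_max (\<lambda>n. norm (e n \<omega>)) m powr (2 * q) \<le>
        4 powr q * (K powr q * (2 powr q * T powr (q - 1)) * \<tau> * (\<Sum>j<m. norm (e j \<omega>) powr (2 * q)) +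
        \<epsilon> powr (- q) * (2 powr q * T powr (q - 1)) * \<tau> powr (1 - 2 * q) * (\<Sum>j<m. norm (R j \<omega>) powr (2 * q)) +
        2 powr q * running_max (\<lambda>n. \<Sum>j<n. e j \<omega> \<bullet> N j \<omega>) m powr q +
        2 powr q * T powr (q - 1) * \<tau> powr (1 - q) * (\<Sum>j<m. norm (N j \<omega>) powr (2 * q)))"
        by (rule error_recursion_bound[OF e0 rec \<tau> \<epsilon> K _ \<kappa> mT[OF m] T_pos q(1)]) (use \<tau>\<kappa> in \<open>simp_all add: K_def\<close>)
      then have "running_max (\<lambda>n. norm (e n \<omega>)) m powr p \<le>
        4 powr q * (K powr q * \<theta> * \<tau> * (\<Sum>j<m. norm (e j \<omega>) powr p) +
        \<epsilon> powr (- q) * \<theta> * \<tau> powr (1 - p) * (\<Sum>j<m. norm (R j \<omega>) powr p) +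
        2 powr q * S \<omega> powr q + \<theta> * \<tau> powr (1 - q) * (\<Sum>j<m. norm (N j \<omega>) powr p)) / (1 - \<kappa>) powr q"
        using \<kappa> unfolding q(2) \<theta>_def[symmetric] S_def[symmetric] by (simp add: pos_le_divide_eq mult.commute)
      also have "\<dots> = k1 * \<tau> * (\<Sum>j<m. norm (e j \<omega>) powr p) + k2 * \<tau> powr (1 - p) * (\<Sum>j<m. norm (R j \<omega>) powr p) +
          k3 * S \<omega> powr q + k4 * \<tau> powr (1 - q) * (\<Sum>j<m. norm (N j \<omega>) powr p)"
        using \<kappa> by (simp add: k1_def k2_def k3_def k4_def \<beta>_def field_simps)
      finally have "ennreal (running_max (\<lambda>n. norm (e n \<omega>)) m powr p) \<le>
        ennreal (k1 * \<tau> * (\<Sum>j<m. norm (e j \<omega>) powr p) + k2 * \<tau> powr (1 - p) * (\<Sum>j<m. norm (R j \<omega>) powr p) +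
          k3 * S \<omega> powr q + k4 * \<tau> powr (1 - q) * (\<Sum>j<m. norm (N j \<omega>) powr p))"
        by (rule ennreal_leI)
      also have "\<dots> = ennreal (k1 * \<tau>) * (\<Sum>j<m. ennreal (norm (e j \<omega>) powr p)) +
          ennreal (k2 * \<tau> powr (1 - p)) * (\<Sum>j<m. ennreal (norm (R j \<omega>) powr p)) +
          ennreal k3 * ennreal (S \<omega> powr q) + ennreal (k4 * \<tau> powr (1 - q)) * (\<Sum>j<m. ennreal (norm (N j \<omega>) powr p))"
        using k \<tau> by (simp add: ennreal_plus sum_nonneg ennreal_mult'' sum_ennreal)
      also have "ennreal (k2 * \<tau> powr (1 - p)) * (\<Sum>j<m. ennreal (norm (R j \<omega>) powr p)) \<le>
          ennreal (k2 * \<tau> powr (1 - p)) * (\<Sum>j<m. ennreal (2 powr p * \<tau> powr (p - 1)) * bo j \<omega>)"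
      proof (intro mult_left_mono sum_mono)
        fix j assume "j \<in> {..<m}"
        then have j: "j < M" using m by simp
        show "ennreal (norm (R j \<omega>) powr p) \<le> ennreal (2 powr p * \<tau> powr (p - 1)) * bo j \<omega>"
          using drift_remainder_powr_le[OF elim(6) sub(1,4)[OF j]] unfolding R_def bo_def sub(5)[OF j] .
      qed simp
      also have "\<dots> = ennreal (k2 * \<tau> powr (1 - p) * (2 powr p * \<tau> powr (p - 1))) * (\<Sum>j<m. bo j \<omega>)"
        using k \<tau> by (simp add: ennreal_mult mult.assoc flip: sum_distrib_left)
      also have "k2 * \<tau> powr (1 - p) * (2 powr p * \<tau> powr (p - 1)) = k2 * 2 powr p * (\<tau> powr (1 - p) * \<tau> powr (p - 1))"
        by (simp add: mult_ac)
      also have "\<tau> powr (1 - p) * \<tau> powr (p - 1) = 1" using \<tau> by (simp flip: powr_add)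
      finally show ?case by (simp add: add_right_mono add_left_mono)
    qed
    define a where "a j = (\<integral>\<^sup>+\<omega>. ennreal (norm (e j \<omega>) powr p) \<partial>P)" for j
    define B where "B j = (\<integral>\<^sup>+\<omega>. bo j \<omega> \<partial>P)" for j
    define Vo where "Vo j = (\<integral>\<^sup>+\<omega>. os j \<omega> \<partial>P)" for j
    have meas1: "(\<lambda>\<omega>. \<Sum>j<m. ennreal (norm (e j \<omega>) powr p)) \<in> borel_measurable P"
    proof (rule borel_measurable_sum)
      fix j assume "j \<in> {..<m}"
      then have [measurable]: "e j \<in> borel_measurable P" using eP m by simp
      show "(\<lambda>\<omega>. ennreal (norm (e j \<omega>) powr p)) \<in> borel_measurable P" by measurable
    qed
    have meas2: "(\<lambda>\<omega>. \<Sum>j<m. bo j \<omega>) \<in> borel_measurable P"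
      using boP m by (intro borel_measurable_sum) auto
    have meas3: "(\<lambda>\<omega>. \<Sum>j<m. ennreal (norm (N j \<omega>) powr p)) \<in> borel_measurable P"
    proof (rule borel_measurable_sum)
      fix j assume "j \<in> {..<m}"
      then have [measurable]: "N j \<in> borel_measurable P" using NP m by simp
      show "(\<lambda>\<omega>. ennreal (norm (N j \<omega>) powr p)) \<in> borel_measurable P" by measurable
    qed
    note [measurable] = meas1 meas2 meas3
    have int1: "(\<integral>\<^sup>+\<omega>. (\<Sum>j<m. ennreal (norm (e j \<omega>) powr p)) \<partial>P) = (\<Sum>j<m. a j)"
    proof (subst nn_integral_sum)
      fix j assume "j \<in> {..<m}"
      then have [measurable]: "e j \<in> borel_measurable P" using eP m by simp
      show "(\<lambda>\<omega>. ennreal (norm (e j \<omega>) powr p)) \<in> borel_measurable P" by measurable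
    qed (simp add: a_def)
    have int2: "(\<integral>\<^sup>+\<omega>. (\<Sum>j<m. bo j \<omega>) \<partial>P) = (\<Sum>j<m. B j)"
      unfolding B_def using boP m by (intro nn_integral_sum) auto
    have int3: "(\<integral>\<^sup>+\<omega>. (\<Sum>j<m. ennreal (norm (N j \<omega>) powr p)) \<partial>P) = (\<Sum>j<m. \<integral>\<^sup>+\<omega>. ennreal (norm (N j \<omega>) powr p) \<partial>P)"
    proof (rule nn_integral_sum)
      fix j assume "j \<in> {..<m}"
      then have [measurable]: "N j \<in> borel_measurable P" using NP m by simp
      show "(\<lambda>\<omega>. ennreal (norm (N j \<omega>) powr p)) \<in> borel_measurable P" by measurable
    qed
    have S_le: "(\<integral>\<^sup>+\<omega>. ennreal (S \<omega> powr q) \<partial>P) \<le> ennreal CS * (\<Sum>j<m. ennreal \<tau> * a j + Vo j)"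
      using CS(2)[OF \<tau> mT[OF m], of Z J] Z J m
      unfolding S_def e_def N_def q_def a_def Vo_def os_def t_def by simp
    have N_le: "(\<integral>\<^sup>+\<omega>. ennreal (norm (N j \<omega>) powr p) \<partial>P) \<le> ennreal (CN * \<tau> powr (q - 1)) * (ennreal \<tau> * a j + Vo j)" if "j < m" for j
      using CN(2)[OF \<tau> mT, of j Z J] Z J m that
      unfolding e_def N_def q_def a_def Vo_def os_def t_def by simp
    have "(\<integral>\<^sup>+\<omega>. ennreal (running_max (\<lambda>n. norm (e n \<omega>)) m powr p) \<partial>P) \<le>
        (\<integral>\<^sup>+\<omega>. ennreal (k1 * \<tau>) * (\<Sum>j<m. ennreal (norm (e j \<omega>) powr p)) +
        ennreal (k2 * 2 powr p) * (\<Sum>j<m. bo j \<omega>) +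
        ennreal k3 * ennreal (S \<omega> powr q) +
        ennreal (k4 * \<tau> powr (1 - q)) * (\<Sum>j<m. ennreal (norm (N j \<omega>) powr p)) \<partial>P)"
      by (rule nn_integral_mono_AE[OF pt])
    also have "\<dots> = ennreal (k1 * \<tau>) * (\<Sum>j<m. a j) + ennreal (k2 * 2 powr p) * (\<Sum>j<m. B j) +
        ennreal k3 * (\<integral>\<^sup>+\<omega>. ennreal (S \<omega> powr q) \<partial>P) +
        ennreal (k4 * \<tau> powr (1 - q)) * (\<Sum>j<m. \<integral>\<^sup>+\<omega>. ennreal (norm (N j \<omega>) powr p) \<partial>P)"
      by (simp add: nn_integral_add nn_integral_cmult int1 int2 int3 del: sum_ennreal)
    \<comment> \<open>All four contributions are enlarged to multiples of the same sum, so that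
      their constants simply add up to \<open>\<alpha>\<close>.\<close>
    also have "\<dots> \<le> ennreal k1 * (\<Sum>j<m. ennreal \<tau> * a j + Vo j + B j) +
        ennreal (k2 * 2 powr p) * (\<Sum>j<m. ennreal \<tau> * a j + Vo j + B j) +
        ennreal (k3 * CS) * (\<Sum>j<m. ennreal \<tau> * a j + Vo j + B j) +
        ennreal (k4 * CN) * (\<Sum>j<m. ennreal \<tau> * a j + Vo j + B j)"
    proof (intro add_mono)
      have "ennreal (k1 * \<tau>) * (\<Sum>j<m. a j) = ennreal k1 * (\<Sum>j<m. ennreal \<tau> * a j)"
        using k \<tau> by (simp add: ennreal_mult mult.assoc sum_distrib_left)
      also have "\<dots> \<le> ennreal k1 * (\<Sum>j<m. ennreal \<tau> * a j + Vo j + B j)"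
        by (intro mult_left_mono sum_mono) (auto simp: add.assoc)
      finally show "ennreal (k1 * \<tau>) * (\<Sum>j<m. a j) \<le> ennreal k1 * (\<Sum>j<m. ennreal \<tau> * a j + Vo j + B j)" .
      show "ennreal (k2 * 2 powr p) * (\<Sum>j<m. B j) \<le> ennreal (k2 * 2 powr p) * (\<Sum>j<m. ennreal \<tau> * a j + Vo j + B j)"
        by (intro mult_left_mono sum_mono) auto
      have "ennreal k3 * (\<integral>\<^sup>+\<omega>. ennreal (S \<omega> powr q) \<partial>P) \<le> ennreal k3 * (ennreal CS * (\<Sum>j<m. ennreal \<tau> * a j + Vo j))"
        by (intro mult_left_mono S_le) simp
      also have "\<dots> = ennreal (k3 * CS) * (\<Sum>j<m. ennreal \<tau> * a j + Vo j)"
        using k CS(1) by (simp add: ennreal_mult mult.assoc)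
      also have "\<dots> \<le> ennreal (k3 * CS) * (\<Sum>j<m. ennreal \<tau> * a j + Vo j + B j)"
        by (intro mult_left_mono sum_mono) auto
      finally show "ennreal k3 * (\<integral>\<^sup>+\<omega>. ennreal (S \<omega> powr q) \<partial>P) \<le> ennreal (k3 * CS) * (\<Sum>j<m. ennreal \<tau> * a j + Vo j + B j)" .
      have "ennreal (k4 * \<tau> powr (1 - q)) * (\<Sum>j<m. \<integral>\<^sup>+\<omega>. ennreal (norm (N j \<omega>) powr p) \<partial>P) \<le>
          ennreal (k4 * \<tau> powr (1 - q)) * (\<Sum>j<m. ennreal (CN * \<tau> powr (q - 1)) * (ennreal \<tau> * a j + Vo j))"
        using N_le by (intro mult_left_mono sum_mono) auto
      also have "\<dots> = ennreal (k4 * \<tau> powr (1 - q) * (CN * \<tau> powr (q - 1))) * (\<Sum>j<m. ennreal \<tau> * a j + Vo j)"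
        using k \<tau> CN(1) by (simp add: ennreal_mult mult.assoc flip: sum_distrib_left)
      also have "k4 * \<tau> powr (1 - q) * (CN * \<tau> powr (q - 1)) = k4 * CN * (\<tau> powr (1 - q) * \<tau> powr (q - 1))"
        by (simp add: mult_ac)
      also have "\<tau> powr (1 - q) * \<tau> powr (q - 1) = 1" using \<tau> by (simp flip: powr_add)
      also have "ennreal (k4 * CN * 1) * (\<Sum>j<m. ennreal \<tau> * a j + Vo j) \<le> ennreal (k4 * CN) * (\<Sum>j<m. ennreal \<tau> * a j + Vo j + B j)"
        unfolding mult_1_right by (intro mult_left_mono sum_mono) auto
      finally show "ennreal (k4 * \<tau> powr (1 - q)) * (\<Sum>j<m. \<integral>\<^sup>+\<omega>. ennreal (norm (N j \<omega>) powr p) \<partial>P) \<le>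
          ennreal (k4 * CN) * (\<Sum>j<m. ennreal \<tau> * a j + Vo j + B j)" .
    qed
    also have "\<dots> = ennreal \<alpha> * (\<Sum>j<m. ennreal \<tau> * a j + Vo j + B j)"
      unfolding \<alpha>_def using k CS(1) CN(1) by (simp add: ennreal_plus distrib_right)
    finally show "(\<integral>\<^sup>+\<omega>. ennreal (running_max (\<lambda>n. norm (X (real n * \<tau>) \<omega> - Z n \<omega>)) m powr p) \<partial>P) \<le>
    ennreal \<alpha> * (\<Sum>j<m. ennreal \<tau> * (\<integral>\<^sup>+\<omega>. ennreal (norm (X (real j * \<tau>) \<omega> - Z j \<omega>) powr p) \<partial>P) +
      (\<integral>\<^sup>+\<omega>. osc (real j * \<tau>) (real (Suc j) * \<tau>) (real j * \<tau>) \<omega> \<partial>P) +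
      (\<integral>\<^sup>+\<omega>. b_osc (real j * \<tau>) (real (Suc j) * \<tau>) (real (Suc j) * \<tau>) \<omega> \<partial>P))"
      unfolding e_def t_def a_def Vo_def os_def B_def bo_def .
  qed
qed

text \<open>The recursion bounds the moment of the running maximum through moments of single errors;
  these are in turn bounded by the running maximum, which closes the system for Gronwall. The growth
  factor \<open>(1 + \<alpha> * \<tau>) ^ M\<close> is at most \<open>exp (\<alpha> * T)\<close> for
  every step.\<close>

lemma backward_euler_error:
  fixes \<epsilon> \<kappa> :: real
  assumes \<epsilon>: "0 < \<epsilon>" and \<kappa>: "\<kappa> < 1"
  obtains C where "0 \<le> C" "\<And>\<tau> M Y. 0 < \<tau> \<Longrightarrow> real M * \<tau> = T \<Longrightarrow> (2 * L + \<epsilon>) * \<tau> \<le> \<kappa> \<Longrightarrow>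
    backward_euler P W b \<sigma> X0 \<tau> M Y \<Longrightarrow>
    (\<integral>\<^sup>+\<omega>. (SUP k\<in>{0..M}. ennreal (norm (X (real k * \<tau>) \<omega> - Y k \<omega>) powr p)) \<partial>P) \<le>
    ennreal C * (\<Sum>j<M. (\<integral>\<^sup>+\<omega>. osc (real j * \<tau>) (real (Suc j) * \<tau>) (real j * \<tau>) \<omega> \<partial>P) +
      (\<integral>\<^sup>+\<omega>. b_osc (real j * \<tau>) (real (Suc j) * \<tau>) (real (Suc j) * \<tau>) \<omega> \<partial>P))"
proof -
  obtain \<alpha> where \<alpha>: "0 \<le> \<alpha>" "\<And>\<tau> M Y Z m. 0 < \<tau> \<Longrightarrow> real M * \<tau> = T \<Longrightarrow> (2 * L + \<epsilon>) * \<tau> \<le> \<kappa> \<Longrightarrow>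
    backward_euler P W b \<sigma> X0 \<tau> M Y \<Longrightarrow> (\<And>k. k \<le> M \<Longrightarrow> Z k \<in> borel_measurable (F (real k * \<tau>))) \<Longrightarrow>
    (AE \<omega> in P. \<forall>k\<le>M. Y k \<omega> = Z k \<omega>) \<Longrightarrow> m \<le> M \<Longrightarrow>
    (\<integral>\<^sup>+\<omega>. ennreal (running_max (\<lambda>n. norm (X (real n * \<tau>) \<omega> - Z n \<omega>)) m powr p) \<partial>P) \<le>
    ennreal \<alpha> * (\<Sum>j<m. ennreal \<tau> * (\<integral>\<^sup>+\<omega>. ennreal (norm (X (real j * \<tau>) \<omega> - Z j \<omega>) powr p) \<partial>P) +
      (\<integral>\<^sup>+\<omega>. osc (real j * \<tau>) (real (Suc j) * \<tau>) (real j * \<tau>) \<omega> \<partial>P) +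
      (\<integral>\<^sup>+\<omega>. b_osc (real j * \<tau>) (real (Suc j) * \<tau>) (real (Suc j) * \<tau>) \<omega> \<partial>P))"
  proof (rule error_moment_recursion[OF \<epsilon> \<kappa>], goal_cases)
    case (1 \<alpha>)
    show ?case by (rule 1(1)[of \<alpha>, OF 1(2,3)])
  qed
  show ?thesis
  proof (rule that[of "exp (\<alpha> * T) * \<alpha>"])
    show "0 \<le> exp (\<alpha> * T) * \<alpha>" using \<alpha>(1) by simp
    fix \<tau> :: real and M :: nat and Y :: "nat \<Rightarrow> 'a \<Rightarrow> real ^ 'n"
    assume \<tau>: "0 < \<tau>" and M: "real M * \<tau> = T" and \<tau>\<kappa>: "(2 * L + \<epsilon>) * \<tau> \<le> \<kappa>"
      and Y: "backward_euler P W b \<sigma> X0 \<tau> M Y"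
    \<comment> \<open>As \<open>L\<close> is nonnegative, the absorption condition implies
      \<open>L * \<tau> < 1\<close>, under which the implicit step is injective.\<close>
    have "L * \<tau> \<le> (2 * L + \<epsilon>) * \<tau>" using \<tau> \<epsilon> L_nonneg by (intro mult_right_mono) auto
    then have L\<tau>: "L * \<tau> < 1" using \<tau>\<kappa> \<kappa> by linarith
    obtain Z where Z: "\<And>k. k \<le> M \<Longrightarrow> Z k \<in> borel_measurable (F (real k * \<tau>))"
      and YZ: "AE \<omega> in P. \<forall>k\<le>M. Y k \<omega> = Z k \<omega>"
      using backward_euler_adapted_version[OF b_cont b_one_sided less_imp_le[OF \<tau>] L\<tau> \<sigma>_cont X0_F Y] by blast
    define e where "e n \<omega> = X (real n * \<tau>) \<omega> - Z n \<omega>" for n \<omega>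
    define A where "A m = (\<integral>\<^sup>+\<omega>. ennreal (running_max (\<lambda>n. norm (e n \<omega>)) m powr p) \<partial>P)" for m
    define D where "D j = (\<integral>\<^sup>+\<omega>. osc (real j * \<tau>) (real (Suc j) * \<tau>) (real j * \<tau>) \<omega> \<partial>P) +
      (\<integral>\<^sup>+\<omega>. b_osc (real j * \<tau>) (real (Suc j) * \<tau>) (real (Suc j) * \<tau>) \<omega> \<partial>P)" for j
    have rec: "A m \<le> ennreal \<alpha> * (\<Sum>j<M. D j) + ennreal (\<alpha> * \<tau>) * (\<Sum>j<m. A j)" if m: "m \<le> M" for m
    proof -
      have "A m \<le> ennreal \<alpha> * (\<Sum>j<m. ennreal \<tau> * (\<integral>\<^sup>+\<omega>. ennreal (norm (e j \<omega>) powr p) \<partial>P) + D j)"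
        using \<alpha>(2)[OF \<tau> M \<tau>\<kappa> Y Z YZ m] unfolding A_def e_def D_def by (simp add: add.assoc)
      also have "\<dots> \<le> ennreal \<alpha> * (\<Sum>j<m. ennreal \<tau> * A j + D j)"
      proof (intro mult_left_mono sum_mono add_right_mono)
        fix j
        show "(\<integral>\<^sup>+\<omega>. ennreal (norm (e j \<omega>) powr p) \<partial>P) \<le> A j"
          unfolding A_def using abs_le_running_max[of j j "\<lambda>n. norm (e n \<omega>)" for \<omega>] p_ge
          by (intro nn_integral_mono ennreal_leI powr_mono2) auto
      qed auto
      also have "\<dots> = ennreal \<alpha> * (\<Sum>j<m. D j) + ennreal (\<alpha> * \<tau>) * (\<Sum>j<m. A j)"
        using \<alpha>(1) \<tau> by (simp add: sum.distrib ennreal_mult distrib_left mult.assoc add.commute flip: sum_distrib_left)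
      also have "\<dots> \<le> ennreal \<alpha> * (\<Sum>j<M. D j) + ennreal (\<alpha> * \<tau>) * (\<Sum>j<m. A j)"
        using m by (intro add_right_mono mult_left_mono sum_mono2) auto
      finally show ?thesis .
    qed
    have "A M \<le> ennreal ((1 + \<alpha> * \<tau>) ^ M) * (ennreal \<alpha> * (\<Sum>j<M. D j))"
      by (rule ennreal_gronwall[OF _ rec]) (use \<alpha>(1) \<tau> in auto)
    also have "\<dots> \<le> ennreal (exp (\<alpha> * T)) * (ennreal \<alpha> * (\<Sum>j<M. D j))"
    proof (intro mult_right_mono ennreal_leI)
      have "(1 + \<alpha> * \<tau>) ^ M \<le> exp (\<alpha> * \<tau>) ^ M"
        using \<alpha>(1) \<tau> by (intro power_mono exp_ge_add_one_self) auto
      also have "\<dots> = exp (\<alpha> * T)" using M by (simp flip: exp_of_nat_mult)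
      finally show "(1 + \<alpha> * \<tau>) ^ M \<le> exp (\<alpha> * T)" .
    qed auto
    finally have AM: "A M \<le> ennreal (exp (\<alpha> * T) * \<alpha>) * (\<Sum>j<M. D j)"
      using \<alpha>(1) by (simp add: ennreal_mult mult.assoc)
    have "(\<integral>\<^sup>+\<omega>. (SUP k\<in>{0..M}. ennreal (norm (X (real k * \<tau>) \<omega> - Y k \<omega>) powr p)) \<partial>P) \<le> A M"
      unfolding A_def
    proof (rule nn_integral_mono_AE)
      show "AE \<omega> in P. (SUP k\<in>{0..M}. ennreal (norm (X (real k * \<tau>) \<omega> - Y k \<omega>) powr p)) \<le>
          ennreal (running_max (\<lambda>n. norm (e n \<omega>)) M powr p)"
        using YZ
      proof eventually_elim
        case (elim \<omega>)
        show ?case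
        proof (rule SUP_least)
          fix k assume k: "k \<in> {0..M}"
          then have "norm (X (real k * \<tau>) \<omega> - Y k \<omega>) \<le> running_max (\<lambda>n. norm (e n \<omega>)) M"
            using abs_le_running_max[of k M "\<lambda>n. norm (e n \<omega>)"] elim by (simp add: e_def)
          then show "ennreal (norm (X (real k * \<tau>) \<omega> - Y k \<omega>) powr p) \<le> ennreal (running_max (\<lambda>n. norm (e n \<omega>)) M powr p)"
            using p_ge by (intro ennreal_leI powr_mono2) auto
        qed
      qed
    qed
    also note AM
    finally show "(\<integral>\<^sup>+\<omega>. (SUP k\<in>{0..M}. ennreal (norm (X (real k * \<tau>) \<omega> - Y k \<omega>) powr p)) \<partial>P) \<le>
    ennreal (exp (\<alpha> * T) * \<alpha>) * (\<Sum>j<M. (\<integral>\<^sup>+\<omega>. osc (real j * \<tau>) (real (Suc j) * \<tau>) (real j * \<tau>) \<omega> \<partial>P) +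
      (\<integral>\<^sup>+\<omega>. b_osc (real j * \<tau>) (real (Suc j) * \<tau>) (real (Suc j) * \<tau>) \<omega> \<partial>P))"
      unfolding D_def .
  qed
qed

end

theorem theorem2p1:
  fixes P :: "'a measure" and F :: "real \<Rightarrow> 'a measure"
    and W :: "real \<Rightarrow> 'a \<Rightarrow> real ^ 'm"
    and b :: "real ^ 'n \<Rightarrow> real ^ 'n" and \<sigma> :: "real ^ 'n \<Rightarrow> real ^ 'm ^ 'n"
    and X0 :: "'a \<Rightarrow> real ^ 'n" and X :: "real \<Rightarrow> 'a \<Rightarrow> real ^ 'n"
    and T L\<^sub>b L\<^sub>\<sigma> p :: real
  assumes wiener: "wiener_process P F W"
    and T_pos: "0 < T"
    and b_continuous: "continuous_on UNIV b"
    and \<sigma>_continuous: "continuous_on UNIV \<sigma>"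
    and b_one_sided_lipschitz: "\<And>x y. (b x - b y) \<bullet> (x - y) \<le> L\<^sub>b * (norm (x - y))\<^sup>2"
    and L\<^sub>\<sigma>_nonneg: "0 \<le> L\<^sub>\<sigma>"
    and \<sigma>_lipschitz: "\<And>x y. norm (\<sigma> x - \<sigma> y) \<le> L\<^sub>\<sigma> * norm (x - y)"
    and X0_measurable: "X0 \<in> borel_measurable (F 0)"
    and X_solution: "sde_solution P F W T b \<sigma> X0 X"
    and p_ge: "4 \<le> p"
    and moments: "(SUP t\<in>{0..T}. \<integral>\<^sup>+\<omega>. ennreal (norm (b (X t \<omega>)) powr p) \<partial>P) +
      (SUP t\<in>{0..T}. \<integral>\<^sup>+\<omega>. ennreal (norm (X t \<omega>) powr p) \<partial>P) < \<infinity>"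
  shows "\<exists>C::real. 0 \<le> C \<and> (\<forall>(M::nat) (Y :: nat \<Rightarrow> 'a \<Rightarrow> real ^ 'n).
    let \<tau> = T / real M; t = (\<lambda>k. real k * \<tau>) in
      0 < M \<and> T < real M \<and> 2 * L\<^sub>b * \<tau> < 1 \<and> backward_euler P W b \<sigma> X0 \<tau> M Y \<longrightarrow>
      (\<integral>\<^sup>+\<omega>. (SUP k\<in>{0..M}. ennreal (norm (X (t k) \<omega> - Y k \<omega>) powr p)) \<partial>P) \<le>
      ennreal C * (\<Sum>i<M. \<integral>\<^sup>+r\<in>{t i..t (Suc i)}.
        ((\<integral>\<^sup>+\<omega>. ennreal (norm (b (X r \<omega>) - b (X (t (Suc i)) \<omega>)) powr p) \<partial>P) +
         (\<integral>\<^sup>+\<omega>. ennreal (norm (X r \<omega> - X (t i) \<omega>) powr p) \<partial>P)) \<partial>lborel))"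
proof -
  \<comment> \<open>Passing to the positive part weakens the one-sided bound but not the step
    condition: for negative \<open>L\<^sub>b\<close> the condition \<open>2 * L * \<tau> < 1\<close>
    reads \<open>0 < 1\<close>.\<close>
  define L where "L = max L\<^sub>b 0"
  interpret W: wiener_process P F W by (rule wiener)
  interpret E: one_sided_sde P F W b \<sigma> X0 X T L L\<^sub>\<sigma> p
  proof unfold_locales
    show "(b x - b y) \<bullet> (x - y) \<le> L * (norm (x - y))\<^sup>2" for x y
      by (rule order_trans[OF b_one_sided_lipschitz]) (intro mult_right_mono, auto simp: L_def)
  qed (use assms in \<open>auto simp: L_def\<close>)
  \<comment> \<open>The step sizes with \<open>2 * L * \<tau> < 1\<close> are \<open>T / M\<close> for the integers \<open>M \<ge> M\<^sub>0\<close>, so \<open>2 * L * \<tau>\<close> stays away from 1.\<close>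
  define M\<^sub>0 where "M\<^sub>0 = real_of_int (\<lfloor>2 * L * T\<rfloor> + 1)"
  define \<theta> where "\<theta> = 2 * L * T / M\<^sub>0"
  have LT: "0 \<le> 2 * L * T" using T_pos by (simp add: L_def)
  have M\<^sub>0: "0 < M\<^sub>0" "2 * L * T < M\<^sub>0" using LT unfolding M\<^sub>0_def by linarith+
  have \<theta>: "0 \<le> \<theta>" "\<theta> < 1" using LT M\<^sub>0 by (auto simp: \<theta>_def)
  \<comment> \<open>Half of the gap left below 1: the sum \<open>\<theta> + \<epsilon>\<close> takes
    the role of \<open>\<kappa>\<close>, and neither depends on \<open>M\<close>.\<close>
  define \<epsilon> where "\<epsilon> = (1 - \<theta>) / 2"
  have \<epsilon>: "0 < \<epsilon>" "\<theta> + \<epsilon> < 1" using \<theta> by (auto simp: \<epsilon>_def field_simps)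
  obtain C where C: "0 \<le> C" "\<And>\<tau> M Y. 0 < \<tau> \<Longrightarrow> real M * \<tau> = T \<Longrightarrow> (2 * L + \<epsilon>) * \<tau> \<le> \<theta> + \<epsilon> \<Longrightarrow>
    backward_euler P W b \<sigma> X0 \<tau> M Y \<Longrightarrow>
    (\<integral>\<^sup>+\<omega>. (SUP k\<in>{0..M}. ennreal (norm (X (real k * \<tau>) \<omega> - Y k \<omega>) powr p)) \<partial>P) \<le>
    ennreal C * (\<Sum>j<M. (\<integral>\<^sup>+\<omega>. E.osc (real j * \<tau>) (real (Suc j) * \<tau>) (real j * \<tau>) \<omega> \<partial>P) +
      (\<integral>\<^sup>+\<omega>. E.b_osc (real j * \<tau>) (real (Suc j) * \<tau>) (real (Suc j) * \<tau>) \<omega> \<partial>P))"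
    using E.backward_euler_error[OF \<epsilon>] by blast
  show ?thesis
  proof (intro exI[of _ C] conjI C(1) allI)
    fix M :: nat and Y :: "nat \<Rightarrow> 'a \<Rightarrow> real ^ 'n"
    define \<tau> where "\<tau> = T / real M"
    define t where "t k = real k * \<tau>" for k
    have "(\<integral>\<^sup>+\<omega>. (SUP k\<in>{0..M}. ennreal (norm (X (t k) \<omega> - Y k \<omega>) powr p)) \<partial>P) \<le>
      ennreal C * (\<Sum>i<M. \<integral>\<^sup>+r\<in>{t i..t (Suc i)}.
        ((\<integral>\<^sup>+\<omega>. ennreal (norm (b (X r \<omega>) - b (X (t (Suc i)) \<omega>)) powr p) \<partial>P) +
         (\<integral>\<^sup>+\<omega>. ennreal (norm (X r \<omega> - X (t i) \<omega>) powr p) \<partial>P)) \<partial>lborel)"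
      if M: "0 < M" "T < real M" and \<tau>L: "2 * L\<^sub>b * \<tau> < 1" and Y: "backward_euler P W b \<sigma> X0 \<tau> M Y"
    proof -
      have \<tau>: "0 < \<tau>" "real M * \<tau> = T" "\<tau> < 1" using M T_pos by (auto simp: \<tau>_def)
      have "2 * L * \<tau> < 1" using \<tau>L \<tau> by (auto simp: L_def max_def)
      then have "2 * L * T < real M" using M by (simp add: \<tau>_def field_simps)
      then have "\<lfloor>2 * L * T\<rfloor> + 1 \<le> int M" by linarith
      then have "M\<^sub>0 \<le> real M" unfolding M\<^sub>0_def by linarith
      then have "2 * L * T / real M \<le> \<theta>" unfolding \<theta>_def using LT M\<^sub>0 by (intro divide_left_mono) auto
      then have "2 * L * \<tau> \<le> \<theta>" by (simp add: \<tau>_def)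
      \<comment> \<open>Here \<open>T < M\<close> enters: it makes the step shorter than 1, so
        \<open>\<epsilon>\<close> need not be adjusted to it.\<close>
      moreover have "\<epsilon> * \<tau> \<le> \<epsilon>" using \<epsilon> \<tau> by (simp add: mult_left_le)
      ultimately have "(2 * L + \<epsilon>) * \<tau> \<le> \<theta> + \<epsilon>" by (simp add: distrib_right)
      from C(2)[OF \<tau>(1,2) this Y]
      have "(\<integral>\<^sup>+\<omega>. (SUP k\<in>{0..M}. ennreal (norm (X (t k) \<omega> - Y k \<omega>) powr p)) \<partial>P) \<le>
        ennreal C * (\<Sum>j<M. (\<integral>\<^sup>+\<omega>. E.osc (t j) (t (Suc j)) (t j) \<omega> \<partial>P) + (\<integral>\<^sup>+\<omega>. E.b_osc (t j) (t (Suc j)) (t (Suc j)) \<omega> \<partial>P))"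
        unfolding t_def .
      \<comment> \<open>Tonelli turns each expected oscillation into a time integral of
        expectations, and the two integrals over a block merge into one.\<close>
      also have "(\<Sum>j<M. (\<integral>\<^sup>+\<omega>. E.osc (t j) (t (Suc j)) (t j) \<omega> \<partial>P) + (\<integral>\<^sup>+\<omega>. E.b_osc (t j) (t (Suc j)) (t (Suc j)) \<omega> \<partial>P)) \<le>
        (\<Sum>i<M. \<integral>\<^sup>+r\<in>{t i..t (Suc i)}.
        ((\<integral>\<^sup>+\<omega>. ennreal (norm (b (X r \<omega>) - b (X (t (Suc i)) \<omega>)) powr p) \<partial>P) +
         (\<integral>\<^sup>+\<omega>. ennreal (norm (X r \<omega> - X (t i) \<omega>) powr p) \<partial>P)) \<partial>lborel)"
      proof (rule sum_mono)
        fix j assume "j \<in> {..<M}"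
        then have "j < M" by simp
        note sub = E.grid_subset[OF \<tau>(1) eq_refl[OF \<tau>(2)] this, folded t_def]
        show "(\<integral>\<^sup>+\<omega>. E.osc (t j) (t (Suc j)) (t j) \<omega> \<partial>P) + (\<integral>\<^sup>+\<omega>. E.b_osc (t j) (t (Suc j)) (t (Suc j)) \<omega> \<partial>P) \<le>
          (\<integral>\<^sup>+r\<in>{t j..t (Suc j)}. ((\<integral>\<^sup>+\<omega>. ennreal (norm (b (X r \<omega>) - b (X (t (Suc j)) \<omega>)) powr p) \<partial>P) +
           (\<integral>\<^sup>+\<omega>. ennreal (norm (X r \<omega> - X (t j) \<omega>) powr p) \<partial>P)) \<partial>lborel)"
        proof -
          let ?f = "\<lambda>r. (\<integral>\<^sup>+\<omega>. ennreal (norm (X r \<omega> - X (t j) \<omega>) powr p) \<partial>P) * indicator {t j..t (Suc j)} r"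
          let ?g = "\<lambda>r. (\<integral>\<^sup>+\<omega>. ennreal (norm (b (X r \<omega>) - b (X (t (Suc j)) \<omega>)) powr p) \<partial>P) * indicator {t j..t (Suc j)} r"
          have "(\<integral>\<^sup>+\<omega>. E.osc (t j) (t (Suc j)) (t j) \<omega> \<partial>P) + (\<integral>\<^sup>+\<omega>. E.b_osc (t j) (t (Suc j)) (t (Suc j)) \<omega> \<partial>P) =
              (\<integral>\<^sup>+r. ?f r \<partial>lborel) + (\<integral>\<^sup>+r. ?g r \<partial>lborel)"
            by (simp only: E.osc(2)[OF sub(1,2)] E.b_osc(2)[OF sub(1,3)])
          also have "\<dots> = (\<integral>\<^sup>+r. ?f r + ?g r \<partial>lborel)"
            by (rule nn_integral_add[symmetric, OF E.osc(3)[OF sub(1,2)] E.b_osc(3)[OF sub(1,3)]])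
          finally show ?thesis by (simp add: distrib_right add.commute)
        qed
      qed
      finally show ?thesis by (simp add: mult_left_mono)
    qed
    then show "let \<tau> = T / real M; t = (\<lambda>k. real k * \<tau>) in
      0 < M \<and> T < real M \<and> 2 * L\<^sub>b * \<tau> < 1 \<and> backward_euler P W b \<sigma> X0 \<tau> M Y \<longrightarrow>
      (\<integral>\<^sup>+\<omega>. (SUP k\<in>{0..M}. ennreal (norm (X (t k) \<omega> - Y k \<omega>) powr p)) \<partial>P) \<le>
      ennreal C * (\<Sum>i<M. \<integral>\<^sup>+r\<in>{t i..t (Suc i)}.
        ((\<integral>\<^sup>+\<omega>. ennreal (norm (b (X r \<omega>) - b (X (t (Suc i)) \<omega>)) powr p) \<partial>P) +
         (\<integral>\<^sup>+\<omega>. ennreal (norm (X r \<omega> - X (t i) \<omega>) powr p) \<partial>P)) \<partial>lborel)"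
      unfolding Let_def t_def \<tau>_def by blast
  qed
qed

end
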